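(* Assume that $\mathcal A$ is bounded. Then $\mathcal V(t)=Y(t)^{\otimes2}$ has the representation $$\mathcal V(t)=\mathcal V(0)+\int_0^t\Phi(s)\,ds+\int_0^t\Psi(s)\,dW(s),\qquad t\ge0,$$ where $\{\Phi(t)\}_{t\ge0}$ is the $\mathcal H$-valued process $$\Phi(s)=\mathcal AY(s)\otimes Y(s)+Y(s)\otimes\mathcal AY(s)+\eta Q_W\eta^*,$$ and $\{\Psi(t)\}_{t\ge0}$ is the $L(H,\mathcal H)$-valued process $$\Psi(s)(\cdot)=\eta(\cdot)\otimes Y(s)+Y(s)\otimes\eta(\cdot).$$
   Context: $(\Omega,\mathcal F,\{\mathcal F_t\}_{t\ge0},\mathbb P)$ is a filtered probability space. $H$ is a real separable Hilbert space with inner product $\langle\cdot,\cdot\rangle$; $L(H)$ is the space of bounded linear operators on $H$; $\mathcal H=L_{HS}(H)$ is the Hilbert space of Hilbert-Schmidt operators on $H$; $L(H,\mathcal H)$ is the space of bounded linear operators from $H$ to $\mathcal H$. For $f,g\in H$ the tensor product is the operator $f\otimes g:=\langle f,\cdot\rangle g$, and $f^{\otimes2}:=f\otimes f$. $\{W(t)\}_{t\ge0}$ is an $H$-valued $\mathcal F_t$-Wiener process with covariance operator $Q_W$ (symmetric, positive definite, trace class), $\eta\in L(H)$, $Y_0\in H$. $\{Y(t)\}_{t\ge0}$ is the solution of $dY(t)=\mathcal AY(t)\,dt+\eta\,dW(t)$, $Y(0)=Y_0$; when $\mathcal A\in L(H)$ this is a strong solution, $Y(t)=Y_0+\int_0^t\mathcal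 AY(s)\,ds+\int_0^t\eta\,dW(s)$. The tensor Heston stochastic variance process is $\mathcal V(t):=Y(t)^{\otimes2}$. *)

theory Defs
  imports "HOL-Probability.Probability"
begin

definition orthonormal :: "'a::real_inner set \<Rightarrow> bool" where
  "orthonormal B \<longleftrightarrow> pairwise orthogonal B \<and> (\<forall>e\<in>B. norm e = 1)"

definition orthonormal_basis :: "'a::real_inner set \<Rightarrow> bool" where
  "orthonormal_basis B \<longleftrightarrow> orthonormal B \<and> closure (span B) = UNIV"

lemma orthonormal_inner:
  assumes "orthonormal B" "e \<in> B" "f \<in> B"
  shows "e \<bullet> f = (if e = f then 1 else 0)"
  using assms by (auto simp: orthonormal_def pairwise_def orthogonal_def norm_eq_1)

lemma orthonormal_sum_norm:
  assumes B: "orthonormal B" and F: "finite F" "F \<subseteq> B"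
  shows "(norm (\<Sum>e\<in>F. c e *\<^sub>R e))\<^sup>2 = (\<Sum>e\<in>F. (c e)\<^sup>2)"
proof -
  have "(norm (\<Sum>e\<in>F. c e *\<^sub>R e))\<^sup>2 = (\<Sum>e\<in>F. (norm (c e *\<^sub>R e))\<^sup>2)"
  proof (rule norm_sum_Pythagorean[OF F(1)])
    show "pairwise (\<lambda>i j. orthogonal (c i *\<^sub>R i) (c j *\<^sub>R j)) F"
      using B F(2) unfolding orthonormal_def pairwise_def orthogonal_def by auto
  qed
  also have "\<dots> = (\<Sum>e\<in>F. (c e)\<^sup>2)"
    using B F(2) by (intro sum.cong) (auto simp: orthonormal_def)
  finally show ?thesis .
qed

lemma bessel_finite:
  assumes B: "orthonormal B" and F: "finite F" "F \<subseteq> B"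
  shows "(\<Sum>e\<in>F. (x \<bullet> e)\<^sup>2) \<le> (norm x)\<^sup>2"
proof -
  let ?s = "\<Sum>e\<in>F. (x \<bullet> e) *\<^sub>R e"
  have xs: "x \<bullet> ?s = (\<Sum>e\<in>F. (x \<bullet> e)\<^sup>2)"
    by (simp add: inner_sum_right power2_eq_square)
  have "0 \<le> (norm (x - ?s))\<^sup>2" by simp
  also have "\<dots> = (norm x)\<^sup>2 - 2 * (x \<bullet> ?s) + (norm ?s)\<^sup>2"
    by (simp add: power2_norm_eq_inner inner_diff inner_commute)
  finally show ?thesis
    using orthonormal_sum_norm[OF B F, of "\<lambda>e. x \<bullet> e"] xs by simp
qed

lemma bessel_summable:
  assumes B: "orthonormal B"
  shows "(\<lambda>e. (x \<bullet> e)\<^sup>2) summable_on B"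
proof (rule nonneg_bounded_partial_sums_imp_summable_on)
  show "\<forall>\<^sub>F X in finite_subsets_at_top B. (\<Sum>e\<in>X. (x \<bullet> e)\<^sup>2) \<le> (norm x)\<^sup>2"
    by (rule eventually_finite_subsets_at_top_weakI) (use bessel_finite[OF B] in auto)
qed auto

lemma banach_summable_on_Cauchy:
  fixes f :: "'i \<Rightarrow> 'a::banach"
  assumes "\<And>\<epsilon>. \<epsilon> > 0 \<Longrightarrow> \<exists>E. finite E \<and> E \<subseteq> A \<and>
      (\<forall>F. finite F \<longrightarrow> F \<subseteq> A \<longrightarrow> F \<inter> E = {} \<longrightarrow> norm (sum f F) < \<epsilon>)"
  shows "f summable_on A"
proof -
  have "\<exists>P. eventually P (finite_subsets_at_top A) \<and>
              (\<forall>F F'. P F \<and> P F' \<longrightarrow> dist (sum f F) (sum f F') < \<epsilon>)" if "\<epsilon> > 0" for \<epsilon>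
  proof -
    from assms[of "\<epsilon> / 2"] that obtain E where E: "finite E" "E \<subseteq> A"
      and small: "\<And>F. finite F \<Longrightarrow> F \<subseteq> A \<Longrightarrow> F \<inter> E = {} \<Longrightarrow> norm (sum f F) < \<epsilon> / 2"
      by auto
    define P where "P F \<longleftrightarrow> finite F \<and> E \<subseteq> F \<and> F \<subseteq> A" for F
    have "eventually P (finite_subsets_at_top A)"
      unfolding P_def eventually_finite_subsets_at_top using E by blast
    moreover have "dist (sum f F) (sum f F') < \<epsilon>" if "P F" "P F'" for F F'
    proof -
      have 1: "sum f F = sum f E + sum f (F - E)" "sum f F' = sum f E + sum f (F' - E)"
        using that E by (auto simp: P_def sum.subset_diff add.commute)
      have "norm (sum f (F - E)) < \<epsilon> / 2" "norm (sum f (F' - E)) < \<epsilon> / 2"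
        using that by (intro small; auto simp: P_def)+
      then show ?thesis
        using norm_triangle_ineq4[of "sum f (F - E)" "sum f (F' - E)"] 1
        by (simp add: dist_norm)
    qed
    ultimately show ?thesis by blast
  qed
  then have "cauchy_filter (filtermap (sum f) (finite_subsets_at_top A))"
    by (simp add: cauchy_filter_metric_filtermap)
  then obtain L where "(sum f \<longlongrightarrow> L) (finite_subsets_at_top A)"
    using complete_uniform[where S="UNIV :: 'a set"] complete_UNIV[where 'a='a]
    by (force simp add: filterlim_def)
  then show ?thesis
    using summable_on_def has_sum_def by blast
qed

lemma summable_on_tail:
  fixes f :: "'i \<Rightarrow> real"
  assumes "f summable_on A" "\<And>x. x \<in> A \<Longrightarrow> f x \<ge> 0" "\<epsilon> > 0"
  shows "\<exists>E. finite E \<and> E \<subseteq> A \<and>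
    (\<forall>F. finite F \<longrightarrow> F \<subseteq> A \<longrightarrow> F \<inter> E = {} \<longrightarrow> sum f F < \<epsilon>)"
proof -
  obtain E where E: "finite E" "E \<subseteq> A" "dist (sum f E) (infsum f A) \<le> \<epsilon> / 2"
    using infsum_finite_approximation[OF assms(1), of "\<epsilon>/2"] assms(3) by auto
  have "sum f F < \<epsilon>" if "finite F" "F \<subseteq> A" "F \<inter> E = {}" for F
  proof -
    have "sum f (F \<union> E) \<le> infsum f A"
      using that E assms by (intro finite_sum_le_infsum) auto
    moreover have "sum f (F \<union> E) = sum f F + sum f E"
      using that E by (intro sum.union_disjoint) auto
    ultimately show ?thesis using E(3) assms(3) unfolding dist_real_def by linarith
  qed
  with E show ?thesis by blast
qed

lemma square_summable_scaleR:
  fixes B :: "'a::{real_inner,banach} set"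
  assumes B: "orthonormal B" and c: "(\<lambda>e. (c e)\<^sup>2) summable_on B"
  shows "(\<lambda>e. c e *\<^sub>R e) summable_on B"
proof (rule banach_summable_on_Cauchy)
  fix \<epsilon> :: real assume "\<epsilon> > 0"
  have "\<exists>E. finite E \<and> E \<subseteq> B \<and>
      (\<forall>F. finite F \<longrightarrow> F \<subseteq> B \<longrightarrow> F \<inter> E = {} \<longrightarrow> (\<Sum>e\<in>F. (c e)\<^sup>2) < \<epsilon>\<^sup>2)"
    by (rule summable_on_tail[OF c]) (use \<open>\<epsilon> > 0\<close> in simp_all)
  then obtain E where E: "finite E" "E \<subseteq> B"
      "\<And>F. finite F \<Longrightarrow> F \<subseteq> B \<Longrightarrow> F \<inter> E = {} \<Longrightarrow> (\<Sum>e\<in>F. (c e)\<^sup>2) < \<epsilon>\<^sup>2"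
    by blast
  have "norm (\<Sum>e\<in>F. c e *\<^sub>R e) < \<epsilon>" if F: "finite F" "F \<subseteq> B" "F \<inter> E = {}" for F
  proof (rule power2_less_imp_less)
    show "(norm (\<Sum>e\<in>F. c e *\<^sub>R e))\<^sup>2 < \<epsilon>\<^sup>2"
      unfolding orthonormal_sum_norm[OF B F(1,2)] by (rule E(3)[OF F])
  qed (use \<open>\<epsilon> > 0\<close> in simp)
  then show "\<exists>E. finite E \<and> E \<subseteq> B \<and>
      (\<forall>F. finite F \<longrightarrow> F \<subseteq> B \<longrightarrow> F \<inter> E = {} \<longrightarrow> norm (\<Sum>e\<in>F. c e *\<^sub>R e) < \<epsilon>)"
    using E by blast
qed

lemma orthonormal_summable:
  fixes B :: "'a::{real_inner,banach} set"
  assumes B: "orthonormal B"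
  shows "(\<lambda>e. (x \<bullet> e) *\<^sub>R e) summable_on B"
  by (rule square_summable_scaleR[OF B bessel_summable[OF B]])

lemma orthonormal_residual:
  fixes B :: "'a::{real_inner,banach} set"
  assumes B: "orthonormal B" and f: "f \<in> B"
  shows "(x - (\<Sum>\<^sub>\<infinity>e\<in>B. (x \<bullet> e) *\<^sub>R e)) \<bullet> f = 0"
proof -
  have "((\<lambda>e. ((x \<bullet> e) *\<^sub>R e) \<bullet> f) has_sum ((\<Sum>\<^sub>\<infinity>e\<in>B. (x \<bullet> e) *\<^sub>R e) \<bullet> f)) B"
    by (intro has_sum_bounded_linear[where h="\<lambda>y. y \<bullet> f"] bounded_linear_inner_left
        has_sum_infsum orthonormal_summable[OF B])
  moreover have "((\<lambda>e. ((x \<bullet> e) *\<^sub>R e) \<bullet> f) has_sum (x \<bullet> f)) B"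
  proof -
    have "((\<lambda>e. ((x \<bullet> e) *\<^sub>R e) \<bullet> f) has_sum (\<Sum>e\<in>{f}. ((x \<bullet> e) *\<^sub>R e) \<bullet> f)) {f}"
      by (rule has_sum_finite) simp
    also have "?this \<longleftrightarrow> ((\<lambda>e. ((x \<bullet> e) *\<^sub>R e) \<bullet> f) has_sum (\<Sum>e\<in>{f}. ((x \<bullet> e) *\<^sub>R e) \<bullet> f)) B"
      by (rule has_sum_cong_neutral) (use orthonormal_inner[OF B _ f] f in auto)
    finally show ?thesis using orthonormal_inner[OF B f f] by simp
  qed
  ultimately show ?thesis
    by (metis eq_iff_diff_eq_0 has_sum_unique inner_diff_left)
qed

lemma orthonormal_basis_has_sum:
  fixes B :: "'a::{real_inner,banach} set"
  assumes B: "orthonormal_basis B"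
  shows "((\<lambda>e. (x \<bullet> e) *\<^sub>R e) has_sum x) B"
proof -
  have on: "orthonormal B" using B by (simp add: orthonormal_basis_def)
  define z where "z = x - (\<Sum>\<^sub>\<infinity>e\<in>B. (x \<bullet> e) *\<^sub>R e)"
  have "span B \<subseteq> {y. z \<bullet> y = 0}"
  proof (rule span_minimal)
    show "B \<subseteq> {y. z \<bullet> y = 0}"
      using orthonormal_residual[OF on] by (auto simp: z_def)
    show "subspace {y. z \<bullet> y = 0}"
      by (auto simp: subspace_def inner_add_right)
  qed
  then have "closure (span B) \<subseteq> {y. z \<bullet> y = 0}"
    by (rule closure_minimal) (intro closed_Collect_eq continuous_intros)
  then have "UNIV \<subseteq> {y. z \<bullet> y = 0}" using B unfolding orthonormal_basis_def by metis
  then have "z \<bullet> z = 0" by blast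
  then have "x = (\<Sum>\<^sub>\<infinity>e\<in>B. (x \<bullet> e) *\<^sub>R e)" by (simp add: z_def)
  with has_sum_infsum[OF orthonormal_summable[OF on, of x]] show ?thesis by simp
qed

lemma orthonormal_basis_exists:
  "\<exists>B::'a::{real_inner,banach} set. orthonormal_basis B"
proof -
  have "\<exists>M\<in>{B::'a set. orthonormal B}. \<forall>X\<in>{B. orthonormal B}. M \<subseteq> X \<longrightarrow> X = M"
  proof (rule subset_Zorn')
    fix C :: "'a set set" assume C: "subset.chain {B. orthonormal B} C"
    have "orthogonal x y" if xy: "x \<in> \<Union>C" "y \<in> \<Union>C" "x \<noteq> y" for x y
    proof -
      from xy obtain X Y where XY: "X \<in> C" "Y \<in> C" "x \<in> X" "y \<in> Y" by blast
      then have "X \<subseteq> Y \<or> Y \<subseteq> X" using C unfolding subset_chain_def by blast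
      then obtain Z where Z: "Z \<in> C" "x \<in> Z" "y \<in> Z" using XY by blast
      then have "orthonormal Z" using C unfolding subset_chain_def by blast
      then show ?thesis using Z xy(3) unfolding orthonormal_def pairwise_def by blast
    qed
    moreover have "norm e = 1" if "e \<in> \<Union>C" for e
      using that C unfolding subset_chain_def orthonormal_def by blast
    ultimately show "\<Union>C \<in> {B. orthonormal B}"
      by (auto simp: orthonormal_def pairwise_def)
  qed
  then obtain B :: "'a set" where B: "orthonormal B"
    and max: "\<And>X. orthonormal X \<Longrightarrow> B \<subseteq> X \<Longrightarrow> X = B" by auto
  have "x \<in> closure (span B)" for x
  proof -
    let ?s = "\<Sum>\<^sub>\<infinity>e\<in>B. (x \<bullet> e) *\<^sub>R e"
    define z where "z = x - ?s"
    have zB: "z \<bullet> e = 0" if "e \<in> B" for e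
      using orthonormal_residual[OF B that, of x] by (simp add: z_def)
    have "z = 0"
    proof (rule ccontr)
      assume nz: "z \<noteq> 0"
      have "orthonormal (insert (z /\<^sub>R norm z) B)"
        using B zB nz unfolding orthonormal_def pairwise_def orthogonal_def
        by (auto simp: inner_commute)
      with max have "z /\<^sub>R norm z \<in> B" by blast
      from zB[OF this] nz show False by simp
    qed
    then have "((\<lambda>e. (x \<bullet> e) *\<^sub>R e) has_sum x) B"
      using has_sum_infsum[OF orthonormal_summable[OF B, of x]] by (simp add: z_def)
    then have "(sum (\<lambda>e. (x \<bullet> e) *\<^sub>R e) \<longlongrightarrow> x) (finite_subsets_at_top B)"
      by (simp add: has_sum_def)
    then show ?thesis
    proof (rule Lim_in_closed_set[rotated -1])
      show "\<forall>\<^sub>F F in finite_subsets_at_top B. (\<Sum>e\<in>F. (x \<bullet> e) *\<^sub>R e) \<in> closure (span B)"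
        by (rule eventually_finite_subsets_at_top_weakI)
          (meson closure_subset span_base span_scale span_sum subsetD)
    qed auto
  qed
  then show ?thesis using B by (auto simp: orthonormal_basis_def)
qed

text \<open>An arbitrary orthonormal basis. The notions defined through it do not depend on the choice:
  see \<open>hilbert_schmidt_any_basis\<close>, \<open>inner_hs_has_sum\<close>, \<open>norm_hs_has_sum\<close> and \<open>op_trace_has_sum\<close>.\<close>

definition some_onb :: "'a::real_inner set" where
  "some_onb = (SOME B. orthonormal_basis B)"

lemma orthonormal_basis_some_onb:
  "orthonormal_basis (some_onb :: 'a::{real_inner,banach} set)"
  unfolding some_onb_def using orthonormal_basis_exists by (rule someI_ex)

lemma parseval:
  fixes B :: "'a::{real_inner,banach} set"
  assumes B: "orthonormal_basis B"
  shows "((\<lambda>e. (x \<bullet> e) * (y \<bullet> e)) has_sum (x \<bullet> y)) B"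
  using has_sum_bounded_linear[OF bounded_linear_inner_right[of y] orthonormal_basis_has_sum[OF B, of x]]
  by (simp add: inner_commute)

lemma parseval_norm:
  fixes B :: "'a::{real_inner,banach} set"
  assumes B: "orthonormal_basis B"
  shows "((\<lambda>e. (x \<bullet> e)\<^sup>2) has_sum (norm x)\<^sup>2) B"
  using parseval[OF B, of x x] unfolding power2_norm_eq_inner by (simp only: power2_eq_square)

text \<open>The Hilbert space adjoint of the library, as a bounded operator.\<close>

definition adj :: "('a::real_inner \<Rightarrow>\<^sub>L 'b::real_inner) \<Rightarrow> 'b \<Rightarrow>\<^sub>L 'a" where
  "adj T = Blinfun (adjoint (blinfun_apply T))"

lemma adjoint_exists:
  fixes T :: "'a::{real_inner,banach} \<Rightarrow>\<^sub>L 'b::real_inner"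
  shows "\<exists>f. \<forall>x y. T x \<bullet> y = x \<bullet> f y"
proof -
  have "\<exists>z. \<forall>x. T x \<bullet> y = x \<bullet> z" for y
  proof -
    let ?B = "some_onb :: 'a set"
    note onb = orthonormal_basis_some_onb[where 'a='a]
    have on: "orthonormal ?B" using onb by (simp add: orthonormal_basis_def)
    have bound: "(\<Sum>e\<in>F. (T e \<bullet> y)\<^sup>2) \<le> (norm T * norm y)\<^sup>2" if F: "finite F" "F \<subseteq> ?B" for F
    proof -
      define v where "v = (\<Sum>e\<in>F. (T e \<bullet> y) *\<^sub>R e)"
      have v2: "(norm v)\<^sup>2 = (\<Sum>e\<in>F. (T e \<bullet> y)\<^sup>2)"
        unfolding v_def by (rule orthonormal_sum_norm[OF on F])
      also have "\<dots> = T v \<bullet> y"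
        by (simp add: v_def blinfun.sum_right blinfun.scaleR_right inner_sum_left power2_eq_square)
      also have "\<dots> \<le> norm (T v) * norm y" by (rule norm_cauchy_schwarz)
      also have "\<dots> \<le> norm T * norm v * norm y"
        by (intro mult_right_mono norm_blinfun) auto
      finally have "norm v * norm v \<le> norm v * (norm T * norm y)"
        by (simp add: power2_eq_square algebra_simps)
      then have "norm v \<le> norm T * norm y"
        by (cases "norm v = 0") auto
      then show ?thesis using v2 power_mono[of "norm v" "norm T * norm y" 2] by simp
    qed
    have "(\<lambda>e. (T e \<bullet> y)\<^sup>2) summable_on ?B"
    proof (rule nonneg_bounded_partial_sums_imp_summable_on)
      show "\<forall>\<^sub>F X in finite_subsets_at_top ?B. (\<Sum>e\<in>X. (T e \<bullet> y)\<^sup>2) \<le> (norm T * norm y)\<^sup>2"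
        by (rule eventually_finite_subsets_at_top_weakI) (use bound in auto)
    qed auto
    from square_summable_scaleR[OF on this] obtain z
      where z: "((\<lambda>e. (T e \<bullet> y) *\<^sub>R e) has_sum z) ?B" by (auto simp: summable_on_def)
    have "T x \<bullet> y = x \<bullet> z" for x
    proof -
      have "((\<lambda>e. x \<bullet> ((T e \<bullet> y) *\<^sub>R e)) has_sum (x \<bullet> z)) ?B"
        by (rule has_sum_bounded_linear[OF bounded_linear_inner_right z])
      moreover have "((\<lambda>e. T ((x \<bullet> e) *\<^sub>R e) \<bullet> y) has_sum (T x \<bullet> y)) ?B"
        by (rule has_sum_bounded_linear[OF _ orthonormal_basis_has_sum[OF onb, of x]])
          (intro bounded_linear_intros)
      ultimately show ?thesis
        by (simp add: blinfun.scaleR_right mult.commute has_sum_unique)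
    qed
    then show ?thesis by blast
  qed
  then show ?thesis by metis
qed

lemma adj_works:
  fixes T :: "'a::{real_inner,banach} \<Rightarrow>\<^sub>L 'b::real_inner"
  shows "T x \<bullet> y = x \<bullet> adj T y"
proof -
  have A: "T x \<bullet> y = x \<bullet> adjoint (blinfun_apply T) y" for x y
    unfolding adjoint_def using someI_ex[OF adjoint_exists[of T]] by blast
  have "bounded_linear (adjoint (blinfun_apply T))"
  proof (rule bounded_linear_intro)
    show "adjoint (blinfun_apply T) (x + y) = adjoint (blinfun_apply T) x + adjoint (blinfun_apply T) y" for x y
      by (rule vector_eq_ldot[THEN iffD1]) (simp add: inner_add_right flip: A)
    show "adjoint (blinfun_apply T) (r *\<^sub>R x) = r *\<^sub>R adjoint (blinfun_apply T) x" for r x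
      by (rule vector_eq_ldot[THEN iffD1]) (simp add: inner_scaleR_right flip: A)
    show "norm (adjoint (blinfun_apply T) y) \<le> norm y * norm T" for y
    proof -
      let ?v = "adjoint (blinfun_apply T) y"
      have "norm ?v * norm ?v = T ?v \<bullet> y"
        by (simp add: A power2_norm_eq_inner flip: power2_eq_square)
      also have "\<dots> \<le> norm (T ?v) * norm y" by (rule norm_cauchy_schwarz)
      also have "\<dots> \<le> norm T * norm ?v * norm y"
        by (intro mult_right_mono norm_blinfun) auto
      finally have "norm ?v * norm ?v \<le> norm ?v * (norm y * norm T)"
        by (simp add: algebra_simps)
      then show ?thesis by (cases "norm ?v = 0") auto
    qed
  qed
  then show ?thesis using A by (simp add: adj_def bounded_linear_Blinfun_apply)
qed

lemma adj_adj:
  fixes T :: "'a::{real_inner,banach} \<Rightarrow>\<^sub>L 'b::{real_inner,banach}"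
  shows "adj (adj T) = T"
proof (rule blinfun_eqI)
  fix x show "adj (adj T) x = T x"
    by (rule vector_eq_rdot[THEN iffD1]) (metis adj_works inner_commute)
qed

lemma hs_sum_swap:
  fixes T :: "'a::{real_inner,banach} \<Rightarrow>\<^sub>L 'b::{real_inner,banach}"
  assumes B: "orthonormal_basis B" and C: "orthonormal_basis C"
    and s: "((\<lambda>e. (norm (T e))\<^sup>2) has_sum s) B"
  shows "((\<lambda>f. (norm (adj T f))\<^sup>2) has_sum s) C"
proof -
  let ?g = "\<lambda>(e, f). (T e \<bullet> f)\<^sup>2"
  have 1: "((\<lambda>f. ?g (e, f)) has_sum (norm (T e))\<^sup>2) C" for e
    using parseval_norm[OF C, of "T e"] by simp
  have sm: "?g summable_on B \<times> C"
    by (rule summable_on_SigmaI[OF 1]) (use s in \<open>auto simp: summable_on_def\<close>)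
  have "(?g has_sum s) (B \<times> C)"
    by (rule has_sum_SigmaI[OF 1 s sm])
  then have "((\<lambda>(f, e). ?g (e, f)) has_sum s) (C \<times> B)"
    by (subst (asm) has_sum_swap) (simp add: case_prod_unfold)
  then show ?thesis
  proof (rule has_sum_SigmaD)
    fix f
    have "((\<lambda>e. (adj T f \<bullet> e)\<^sup>2) has_sum (norm (adj T f))\<^sup>2) B"
      by (rule parseval_norm[OF B])
    then show "((\<lambda>e. case (f, e) of (f, e) \<Rightarrow> case (e, f) of (e, f) \<Rightarrow> (T e \<bullet> f)\<^sup>2) has_sum
        (norm (adj T f))\<^sup>2) B"
      by (simp only: case_prod_conv adj_works inner_commute[of _ "adj T f"])
  qed
qed

lemma hs_sum_any_basis:
  fixes T :: "'a::{real_inner,banach} \<Rightarrow>\<^sub>L 'b::{real_inner,banach}"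
  assumes "orthonormal_basis B" "orthonormal_basis B'"
    and "((\<lambda>e. (norm (T e))\<^sup>2) has_sum s) B"
  shows "((\<lambda>e. (norm (T e))\<^sup>2) has_sum s) B'"
  using hs_sum_swap[OF orthonormal_basis_some_onb assms(2)
      hs_sum_swap[OF assms(1) orthonormal_basis_some_onb assms(3)]]
  by (simp add: adj_adj)

definition hilbert_schmidt :: "('a::real_inner \<Rightarrow>\<^sub>L 'b::real_inner) \<Rightarrow> bool" where
  "hilbert_schmidt T \<longleftrightarrow> (\<lambda>e. (norm (T e))\<^sup>2) summable_on some_onb"

lemma hilbert_schmidt_any_basis:
  fixes T :: "'a::{real_inner,banach} \<Rightarrow>\<^sub>L 'b::{real_inner,banach}"
  assumes "orthonormal_basis B"
  shows "hilbert_schmidt T \<longleftrightarrow> (\<lambda>e. (norm (T e))\<^sup>2) summable_on B"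
  using hs_sum_any_basis[OF assms orthonormal_basis_some_onb]
    hs_sum_any_basis[OF orthonormal_basis_some_onb assms]
  unfolding hilbert_schmidt_def summable_on_def by blast

lemma hs_mult_summable:
  assumes "hilbert_schmidt S" "hilbert_schmidt T"
  shows "(\<lambda>e. S e \<bullet> T e) summable_on some_onb"
proof -
  have "(\<lambda>e. (norm (S e))\<^sup>2 + (norm (T e))\<^sup>2) summable_on some_onb"
    using assms unfolding hilbert_schmidt_def by (rule summable_on_add)
  then have "(\<lambda>e. norm (S e \<bullet> T e)) summable_on some_onb"
  proof (rule summable_on_comparison_test)
    fix e
    have "\<bar>S e \<bullet> T e\<bar> \<le> norm (S e) * norm (T e)" by (rule Cauchy_Schwarz_ineq2)
    also have "\<dots> \<le> (norm (S e))\<^sup>2 + (norm (T e))\<^sup>2"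
      using sum_squares_bound[of "norm (S e)" "norm (T e)"]
        mult_nonneg_nonneg[OF norm_ge_zero norm_ge_zero, of "S e" "T e"] by linarith
    finally show "norm (S e \<bullet> T e) \<le> (norm (S e))\<^sup>2 + (norm (T e))\<^sup>2" by simp
  qed simp
  then show ?thesis by (rule Infinite_Sum.abs_summable_summable)
qed

lemma hilbert_schmidt_0: "hilbert_schmidt 0"
  by (simp add: hilbert_schmidt_def)

lemma hilbert_schmidt_scaleR: "hilbert_schmidt S \<Longrightarrow> hilbert_schmidt (r *\<^sub>R S)"
  unfolding hilbert_schmidt_def
  by (simp add: blinfun.scaleR_left power_mult_distrib summable_on_cmult_right)

lemma hilbert_schmidt_add:
  assumes "hilbert_schmidt S" "hilbert_schmidt T"
  shows "hilbert_schmidt (S + T)"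
proof -
  have "(\<lambda>e. (norm (S e))\<^sup>2 + (norm (T e))\<^sup>2 + 2 * (S e \<bullet> T e)) summable_on some_onb"
    using assms hs_mult_summable[OF assms] unfolding hilbert_schmidt_def
    by (intro summable_on_add summable_on_cmult_right)
  then show ?thesis
    unfolding hilbert_schmidt_def
    by (simp add: blinfun.add_left power2_norm_eq_inner inner_add inner_commute algebra_simps)
qed

lemma hilbert_schmidt_uminus: "hilbert_schmidt S \<Longrightarrow> hilbert_schmidt (- S)"
  using hilbert_schmidt_scaleR[of S "-1"] by simp

lemma hilbert_schmidt_diff:
  "hilbert_schmidt S \<Longrightarrow> hilbert_schmidt T \<Longrightarrow> hilbert_schmidt (S - T)"
  using hilbert_schmidt_add[OF _ hilbert_schmidt_uminus, of S T] by simp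

typedef (overloaded) 'a hs = "{T :: 'a::real_inner \<Rightarrow>\<^sub>L 'a. hilbert_schmidt T}"
  morphisms blinfun_of_hs hs_of_blinfun
  using hilbert_schmidt_0 by blast

setup_lifting type_definition_hs

instantiation hs :: ("{real_inner,banach}") real_inner
begin

lift_definition zero_hs :: "'a hs" is 0 by (rule hilbert_schmidt_0)
lift_definition plus_hs :: "'a hs \<Rightarrow> 'a hs \<Rightarrow> 'a hs" is "(+)" by (rule hilbert_schmidt_add)
lift_definition minus_hs :: "'a hs \<Rightarrow> 'a hs \<Rightarrow> 'a hs" is "(-)" by (rule hilbert_schmidt_diff)
lift_definition uminus_hs :: "'a hs \<Rightarrow> 'a hs" is uminus by (rule hilbert_schmidt_uminus)
lift_definition scaleR_hs :: "real \<Rightarrow> 'a hs \<Rightarrow> 'a hs" is scaleR by (rule hilbert_schmidt_scaleR)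
lift_definition inner_hs :: "'a hs \<Rightarrow> 'a hs \<Rightarrow> real"
  is "\<lambda>S T. \<Sum>\<^sub>\<infinity>e\<in>some_onb. blinfun_apply S e \<bullet> blinfun_apply T e" .

definition norm_hs :: "'a hs \<Rightarrow> real" where "norm_hs S = sqrt (S \<bullet> S)"
definition dist_hs :: "'a hs \<Rightarrow> 'a hs \<Rightarrow> real" where "dist_hs S T = norm (S - T)"
definition sgn_hs :: "'a hs \<Rightarrow> 'a hs" where "sgn_hs S = scaleR (inverse (norm S)) S"
definition uniformity_hs :: "('a hs \<times> 'a hs) filter" where
  "uniformity_hs = (INF e\<in>{0 <..}. principal {(S, T). dist S T < e})"
definition open_hs :: "'a hs set \<Rightarrow> bool" where
  "open_hs U = (\<forall>S\<in>U. \<forall>\<^sub>F (S', T) in uniformity. S' = S \<longrightarrow> T \<in> U)"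

instance
proof
  fix R S T :: "'a hs" and a b :: real
  show "R + S + T = R + (S + T)" "R + S = S + R" "0 + S = S" "- S + S = 0" "R - S = R + - S"
    by (transfer; simp)+
  show "a *\<^sub>R (S + T) = a *\<^sub>R S + a *\<^sub>R T" "(a + b) *\<^sub>R S = a *\<^sub>R S + b *\<^sub>R S"
    "a *\<^sub>R b *\<^sub>R S = (a * b) *\<^sub>R S" "1 *\<^sub>R S = S"
    by (transfer; simp add: algebra_simps)+
  show "sgn S = inverse (norm S) *\<^sub>R S" by (rule sgn_hs_def)
  show "dist S T = norm (S - T)" by (rule dist_hs_def)
  show "(uniformity :: ('a hs \<times> 'a hs) filter) = (INF e\<in>{0 <..}. principal {(S, T). dist S T < e})"
    by (rule uniformity_hs_def)
  show "open U = (\<forall>S\<in>U. \<forall>\<^sub>F (S', T) in uniformity. S' = S \<longrightarrow> T \<in> U)" for U :: "'a hs set"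
    by (rule open_hs_def)
  show "S \<bullet> T = T \<bullet> S" by transfer (simp add: inner_commute)
  show "(R + S) \<bullet> T = R \<bullet> T + S \<bullet> T"
    by transfer (simp add: blinfun.add_left inner_add_left infsum_add hs_mult_summable)
  show "(a *\<^sub>R S) \<bullet> T = a * (S \<bullet> T)"
    by transfer (simp add: blinfun.scaleR_left infsum_cmult_right hs_mult_summable)
  show "0 \<le> S \<bullet> S" by transfer (simp add: infsum_nonneg)
  show "(S \<bullet> S = 0) = (S = 0)"
  proof transfer
    fix S :: "'a \<Rightarrow>\<^sub>L 'a" assume S: "hilbert_schmidt S"
    note onb = orthonormal_basis_some_onb[where 'a='a]
    show "((\<Sum>\<^sub>\<infinity>e\<in>some_onb. S e \<bullet> S e) = 0) = (S = 0)"
    proof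
      assume 0: "(\<Sum>\<^sub>\<infinity>e\<in>some_onb. S e \<bullet> S e) = 0"
      have e: "S e = 0" if "e \<in> some_onb" for e
        using nonneg_infsum_le_0D[OF _ hs_mult_summable[OF S S] _ that] 0 by simp
      have "S x = 0" for x
        using has_sum_bounded_linear[OF blinfun.bounded_linear_right[of S] orthonormal_basis_has_sum[OF onb, of x]]
        by (subst (asm) has_sum_cong[where g="\<lambda>_. 0"])
          (use e in \<open>auto simp: blinfun.scaleR_right dest: has_sum_unique[OF _ has_sum_0]\<close>)
      then show "S = 0" by (intro blinfun_eqI) simp
    qed simp
  qed
  show "norm S = sqrt (S \<bullet> S)" by (rule norm_hs_def)
qed

end

lemma norm_hs_has_sum:
  fixes S :: "'a::{real_inner,banach} hs"
  assumes "orthonormal_basis B"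
  shows "((\<lambda>e. (norm (blinfun_of_hs S e))\<^sup>2) has_sum (norm S)\<^sup>2) B"
proof (rule hs_sum_any_basis[OF orthonormal_basis_some_onb assms])
  have "(norm S)\<^sup>2 = (\<Sum>\<^sub>\<infinity>e\<in>some_onb. (norm (blinfun_of_hs S e))\<^sup>2)"
    by (simp add: power2_norm_eq_inner inner_hs.rep_eq)
  moreover have "hilbert_schmidt (blinfun_of_hs S)" using blinfun_of_hs by blast
  ultimately show "((\<lambda>e. (norm (blinfun_of_hs S e))\<^sup>2) has_sum (norm S)\<^sup>2) some_onb"
    by (simp add: hilbert_schmidt_def)
qed

lemma has_sum_uminusI:
  fixes f :: "'i \<Rightarrow> real"
  shows "(f has_sum s) A \<Longrightarrow> ((\<lambda>x. - f x) has_sum - s) A"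
  by (simp add: has_sum_uminus)

lemma inner_hs_has_sum:
  fixes S T :: "'a::{real_inner,banach} hs"
  assumes B: "orthonormal_basis B"
  shows "((\<lambda>e. blinfun_of_hs S e \<bullet> blinfun_of_hs T e) has_sum (S \<bullet> T)) B"
proof -
  have "((\<lambda>e. 1/4 * ((norm (blinfun_of_hs (S + T) e))\<^sup>2 + - ((norm (blinfun_of_hs (S - T) e))\<^sup>2)))
      has_sum (1/4 * ((norm (S + T))\<^sup>2 + - ((norm (S - T))\<^sup>2)))) B"
    by (intro has_sum_cmult_right has_sum_add has_sum_uminusI norm_hs_has_sum[OF B])
  then show ?thesis
    by (simp add: plus_hs.rep_eq minus_hs.rep_eq blinfun.add_left blinfun.diff_left
        power2_norm_eq_inner inner_add inner_diff inner_commute algebra_simps)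
qed

lemma norm_blinfun_of_hs:
  fixes S :: "'a::{real_inner,banach} hs"
  shows "norm (blinfun_of_hs S) \<le> norm S"
proof (rule norm_blinfun_bound)
  fix x :: 'a
  let ?T = "blinfun_of_hs S" and ?B = "some_onb :: 'a set"
  note onb = orthonormal_basis_some_onb[where 'a='a]
  have "((\<lambda>f. (norm (adj ?T f))\<^sup>2) has_sum (norm S)\<^sup>2) ?B"
    by (rule hs_sum_swap[OF onb onb norm_hs_has_sum[OF onb]])
  then have 1: "((\<lambda>f. (norm (adj ?T f))\<^sup>2 * (norm x)\<^sup>2) has_sum ((norm S)\<^sup>2 * (norm x)\<^sup>2)) ?B"
    by (rule has_sum_cmult_left)
  have "(norm (?T x))\<^sup>2 \<le> (norm S)\<^sup>2 * (norm x)\<^sup>2"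
  proof (rule has_sum_mono[OF parseval_norm[OF onb, of "?T x"] 1])
    fix f
    have "\<bar>x \<bullet> adj ?T f\<bar> \<le> norm x * norm (adj ?T f)" by (rule Cauchy_Schwarz_ineq2)
    then have "\<bar>x \<bullet> adj ?T f\<bar>\<^sup>2 \<le> (norm x * norm (adj ?T f))\<^sup>2" by (intro power_mono) auto
    then show "(?T x \<bullet> f)\<^sup>2 \<le> (norm (adj ?T f))\<^sup>2 * (norm x)\<^sup>2"
      by (simp add: adj_works power_mult_distrib mult.commute)
  qed
  then show "norm (?T x) \<le> norm S * norm x"
    by (simp flip: power_mult_distrib)
qed simp

instance hs :: ("{real_inner,banach}") banach
proof
  fix X :: "nat \<Rightarrow> 'a hs" assume X: "Cauchy X"
  note onb = orthonormal_basis_some_onb[where 'a='a]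
  let ?B = "some_onb :: 'a set"
  let ?R = "\<lambda>n. blinfun_of_hs (X n)"
  have "Cauchy ?R"
  proof (rule metric_CauchyI)
    fix \<epsilon> :: real assume "\<epsilon> > 0"
    then obtain M where M: "\<And>m n. m \<ge> M \<Longrightarrow> n \<ge> M \<Longrightarrow> dist (X m) (X n) < \<epsilon>"
      using metric_CauchyD[OF X] by blast
    have "dist (?R m) (?R n) < \<epsilon>" if "m \<ge> M" "n \<ge> M" for m n
      using M[OF that] norm_blinfun_of_hs[of "X m - X n"]
      by (simp add: dist_norm minus_hs.rep_eq)
    then show "\<exists>M. \<forall>m\<ge>M. \<forall>n\<ge>M. dist (?R m) (?R n) < \<epsilon>" by blast
  qed
  then obtain T where T: "?R \<longlonglongrightarrow> T" by (auto simp: Cauchy_convergent_iff convergent_def)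
  have bound: "(\<Sum>e\<in>F. (norm ((T - ?R n) e))\<^sup>2) \<le> \<epsilon>\<^sup>2"
    if F: "finite F" "F \<subseteq> ?B" and M: "\<And>m. m \<ge> M \<Longrightarrow> dist (X m) (X n) \<le> \<epsilon>" for F n \<epsilon> M
  proof (rule LIMSEQ_le_const2)
    show "(\<lambda>m. \<Sum>e\<in>F. (norm ((?R m - ?R n) e))\<^sup>2) \<longlonglongrightarrow> (\<Sum>e\<in>F. (norm ((T - ?R n) e))\<^sup>2)"
      by (intro tendsto_intros T)
    have "(\<Sum>e\<in>F. (norm ((?R m - ?R n) e))\<^sup>2) \<le> \<epsilon>\<^sup>2" if "m \<ge> M" for m
    proof -
      have "(\<Sum>e\<in>F. (norm (blinfun_of_hs (X m - X n) e))\<^sup>2) \<le> (norm (X m - X n))\<^sup>2"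
      proof -
        have "(\<Sum>e\<in>F. (norm (blinfun_of_hs (X m - X n) e))\<^sup>2)
            \<le> (\<Sum>\<^sub>\<infinity>e\<in>?B. (norm (blinfun_of_hs (X m - X n) e))\<^sup>2)"
          using norm_hs_has_sum[OF onb, of "X m - X n"] F
          by (intro finite_sum_le_infsum) (auto simp: summable_on_def)
        then show ?thesis using norm_hs_has_sum[OF onb, of "X m - X n"] by (simp add: infsumI)
      qed
      also have "\<dots> \<le> \<epsilon>\<^sup>2"
        using M[OF that] by (intro power_mono) (auto simp: dist_norm)
      finally show ?thesis by (simp add: minus_hs.rep_eq)
    qed
    then show "\<exists>N. \<forall>m\<ge>N. (\<Sum>e\<in>F. (norm ((?R m - ?R n) e))\<^sup>2) \<le> \<epsilon>\<^sup>2" by blast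
  qed
  have hs: "hilbert_schmidt (T - ?R n)" if M: "\<And>m. m \<ge> M \<Longrightarrow> dist (X m) (X n) \<le> \<epsilon>" for n \<epsilon> M
    unfolding hilbert_schmidt_def
  proof (rule nonneg_bounded_partial_sums_imp_summable_on)
    show "\<forall>\<^sub>F F in finite_subsets_at_top ?B. (\<Sum>e\<in>F. (norm ((T - ?R n) e))\<^sup>2) \<le> \<epsilon>\<^sup>2"
      by (rule eventually_finite_subsets_at_top_weakI) (use bound[OF _ _ M] in auto)
  qed auto
  have "hilbert_schmidt T"
  proof -
    obtain M where "\<And>m n. m \<ge> M \<Longrightarrow> n \<ge> M \<Longrightarrow> dist (X m) (X n) < 1"
      using metric_CauchyD[OF X, of 1] by auto
    then have "hilbert_schmidt (T - ?R M)" by (intro hs[of M _ 1]) (auto intro: less_imp_le)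
    then have "hilbert_schmidt (T - ?R M + ?R M)"
      using blinfun_of_hs by (intro hilbert_schmidt_add) auto
    then show ?thesis by simp
  qed
  then obtain Y where Y: "blinfun_of_hs Y = T"
    by (metis hs_of_blinfun_inverse mem_Collect_eq)
  have "X \<longlonglongrightarrow> Y"
  proof (rule metric_LIMSEQ_I)
    fix r :: real assume "r > 0"
    then obtain M where M: "\<And>m n. m \<ge> M \<Longrightarrow> n \<ge> M \<Longrightarrow> dist (X m) (X n) < r / 2"
      using metric_CauchyD[OF X, of "r / 2"] by auto
    have "dist (X n) Y < r" if "n \<ge> M" for n
    proof -
      have "(norm (Y - X n))\<^sup>2 \<le> (r / 2)\<^sup>2"
        using norm_hs_has_sum[OF onb, of "Y - X n"]
      proof (rule has_sum_le_finite_sums)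
        fix F assume F: "finite F" "F \<subseteq> ?B"
        show "(\<Sum>e\<in>F. (norm (blinfun_of_hs (Y - X n) e))\<^sup>2) \<le> (r / 2)\<^sup>2"
          using bound[OF F, of M n "r / 2"] M[OF _ that] Y
          by (simp add: minus_hs.rep_eq less_imp_le)
      qed
      then have "norm (Y - X n) \<le> r / 2" using \<open>r > 0\<close> by (simp add: power2_le_iff_abs_le)
      then show ?thesis using \<open>r > 0\<close> by (simp add: dist_norm norm_minus_commute)
    qed
    then show "\<exists>no. \<forall>n\<ge>no. dist (X n) Y < r" by blast
  qed
  then show "convergent X" by (auto simp: convergent_def)
qed

text \<open>The order of the arguments follows the convention \<open>(f \<otimes> g) x = (f \<bullet> x) *\<^sub>R g\<close>.\<close>

lift_definition hs_tensor :: "'a::{real_inner,banach} \<Rightarrow> 'a \<Rightarrow> 'a hs"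
  is "\<lambda>f g. Blinfun (\<lambda>x. (f \<bullet> x) *\<^sub>R g)"
proof -
  fix f g :: 'a
  have "bounded_linear (\<lambda>x. (f \<bullet> x) *\<^sub>R g)" by (intro bounded_linear_intros)
  then show "hilbert_schmidt (Blinfun (\<lambda>x. (f \<bullet> x) *\<^sub>R g))"
    using parseval_norm[OF orthonormal_basis_some_onb, of f]
    by (auto simp: hilbert_schmidt_def bounded_linear_Blinfun_apply power_mult_distrib
        intro!: summable_on_cmult_left) (auto simp: summable_on_def)
qed

notation hs_tensor (infixl "\<otimes>" 70)

lemma hs_tensor_apply: "blinfun_of_hs (hs_tensor f g) x = (f \<bullet> x) *\<^sub>R g"
  by (simp add: hs_tensor.rep_eq bounded_linear_Blinfun_apply bounded_linear_intros)

lemma norm_hs_tensor: "norm (hs_tensor f g) = norm f * norm g"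
proof -
  have "((\<lambda>e. (f \<bullet> e)\<^sup>2 * (norm g)\<^sup>2) has_sum ((norm f)\<^sup>2 * (norm g)\<^sup>2)) some_onb"
    by (intro has_sum_cmult_left parseval_norm orthonormal_basis_some_onb)
  with norm_hs_has_sum[OF orthonormal_basis_some_onb, of "hs_tensor f g"]
  have "(norm (hs_tensor f g))\<^sup>2 = (norm f)\<^sup>2 * (norm g)\<^sup>2"
    by (auto simp: hs_tensor_apply power_mult_distrib intro: has_sum_unique)
  then show ?thesis
    by (metis mult_nonneg_nonneg norm_ge_zero power2_eq_imp_eq power_mult_distrib)
qed

lemma hs_eqI: "(\<And>x. blinfun_of_hs S x = blinfun_of_hs T x) \<Longrightarrow> S = T"
  by (metis blinfun_eqI blinfun_of_hs_inject)

lemma bounded_bilinear_hs_tensor: "bounded_bilinear hs_tensor"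
proof
  fix f f' g g' :: 'a and r :: real
  show "hs_tensor (f + f') g = hs_tensor f g + hs_tensor f' g"
    "hs_tensor f (g + g') = hs_tensor f g + hs_tensor f g'"
    "hs_tensor (r *\<^sub>R f) g = r *\<^sub>R hs_tensor f g"
    "hs_tensor f (r *\<^sub>R g) = r *\<^sub>R hs_tensor f g"
    by (rule hs_eqI; simp add: hs_tensor_apply plus_hs.rep_eq scaleR_hs.rep_eq blinfun.add_left
        blinfun.scaleR_left inner_add_left scaleR_add_left scaleR_add_right)+
  show "\<exists>K. \<forall>f g :: 'a. norm (hs_tensor f g) \<le> norm f * norm g * K"
    by (rule exI[of _ 1]) (simp add: norm_hs_tensor)
qed

lemma countable_dense_imp_subbasis:
  fixes S :: "'a::metric_space set"
  assumes S: "countable S" and dense: "closure S = UNIV"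
  shows "\<exists>B::'a set set. countable B \<and> open = generate_topology B"
proof -
  define B where "B = (\<lambda>(s, n). ball s (inverse (real (Suc n)))) ` (S \<times> (UNIV :: nat set))"
  have "topological_basis B"
  proof (rule topological_basisI)
    fix U and x :: 'a assume U: "open U" "x \<in> U"
    then obtain e where e: "e > 0" "ball x e \<subseteq> U" by (meson openE)
    obtain n where n: "inverse (real (Suc n)) < e / 2"
      using reals_Archimedean[of "e / 2"] e by auto
    obtain s where s: "s \<in> S" "dist s x < inverse (real (Suc n))"
      using dense closure_approachable[of x S] by (metis UNIV_I inverse_positive_iff_positive of_nat_0_less_iff zero_less_Suc)
    have "ball s (inverse (real (Suc n))) \<subseteq> ball x e"
    proof
      fix y assume "y \<in> ball s (inverse (real (Suc n)))"
      then show "y \<in> ball x e"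
        using s n dist_triangle[of x y s] by (simp add: dist_commute)
    qed
    then show "\<exists>V\<in>B. x \<in> V \<and> V \<subseteq> U"
      using s e unfolding B_def
      by (intro bexI[of _ "ball s (inverse (real (Suc n)))"] conjI image_eqI[of _ _ "(s, n)"]) auto
  qed (auto simp: B_def)
  moreover have "countable B" using S by (simp add: B_def)
  ultimately show ?thesis using topological_basis_imp_subbasis by blast
qed

instance hs :: ("{real_inner,banach,second_countable_topology}") second_countable_topology
proof
  obtain D :: "'a set" where D: "countable D" "\<And>U. open U \<Longrightarrow> U \<noteq> {} \<Longrightarrow> \<exists>d\<in>D. d \<in> U"
    using countable_dense_setE by blast
  have Dcl: "closure D = UNIV"
    using D(2) by (metis Compl_UNIV_eq Compl_iff UNIV_I closed_closure closure_subset double_compl open_Compl subsetD)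
  interpret tensor: bounded_bilinear "hs_tensor :: 'a \<Rightarrow> 'a \<Rightarrow> 'a hs" by (rule bounded_bilinear_hs_tensor)
  define S where "S = (\<lambda>l. \<Sum>(a, b)\<leftarrow>l. hs_tensor a b) ` lists (D \<times> D)"
  have "countable S" using D(1) by (simp add: S_def)
  have add: "x + y \<in> closure S" if xy: "x \<in> closure S" "y \<in> closure S" for x y
  proof -
    from xy obtain f g where f: "\<And>n :: nat. f n \<in> S" "f \<longlonglongrightarrow> x" and g: "\<And>n :: nat. g n \<in> S" "g \<longlonglongrightarrow> y"
      unfolding closure_sequential by blast
    have "f n + g n \<in> S" for n
    proof -
      obtain k l where "k \<in> lists (D \<times> D)" "f n = (\<Sum>(a, b)\<leftarrow>k. hs_tensor a b)"
          "l \<in> lists (D \<times> D)" "g n = (\<Sum>(a, b)\<leftarrow>l. hs_tensor a b)"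
        using f(1)[of n] g(1)[of n] unfolding S_def by blast
      then show ?thesis unfolding S_def by (intro image_eqI[of _ _ "k @ l"]) auto
    qed
    then show ?thesis
      unfolding closure_sequential using tendsto_add[OF f(2) g(2)]
      by (intro exI[of _ "\<lambda>n. f n + g n"]) simp
  qed
  have zero: "0 \<in> closure S"
    by (rule subsetD[OF closure_subset]) (auto simp: S_def intro!: image_eqI[of _ _ "[]"])
  have tens: "hs_tensor a b \<in> closure S" for a b
  proof -
    obtain f g where f: "\<And>n :: nat. f n \<in> D" "f \<longlonglongrightarrow> a" and g: "\<And>n :: nat. g n \<in> D" "g \<longlonglongrightarrow> b"
      using Dcl unfolding closure_sequential by (metis UNIV_I closure_sequential)
    have "hs_tensor (f n) (g n) \<in> S" for n
      unfolding S_def using f(1) g(1) by (intro image_eqI[of _ _ "[(f n, g n)]"]) auto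
    then show ?thesis
      unfolding closure_sequential using tensor.tendsto[OF f(2) g(2)]
      by (intro exI[of _ "\<lambda>n. hs_tensor (f n) (g n)"]) simp
  qed
  have sums: "(\<Sum>e\<in>F. hs_tensor e (h e)) \<in> closure S" if "finite F" for F h
    using that by induction (auto intro: zero add tens)
  note onb = orthonormal_basis_some_onb[where 'a='a]
  have on: "orthonormal (some_onb :: 'a set)" using onb by (simp add: orthonormal_basis_def)
  have "T \<in> closure S" for T :: "'a hs"
  proof -
    have "\<exists>U\<in>closure S. dist U T < \<epsilon>" if "\<epsilon> > 0" for \<epsilon>
    proof -
      have sq: "\<epsilon>\<^sup>2 / 4 > 0" using that by simp
      have "(\<lambda>e. (norm (blinfun_of_hs T e))\<^sup>2) summable_on some_onb"
        using norm_hs_has_sum[OF onb, of T] by (auto simp: summable_on_def)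
      from summable_on_tail[OF this _ sq] obtain E where E: "finite E" "E \<subseteq> some_onb"
        "\<And>F. finite F \<Longrightarrow> F \<subseteq> some_onb \<Longrightarrow> F \<inter> E = {} \<Longrightarrow>
            (\<Sum>e\<in>F. (norm (blinfun_of_hs T e))\<^sup>2) < \<epsilon>\<^sup>2 / 4" by auto
      define U where "U = (\<Sum>e\<in>E. hs_tensor e (blinfun_of_hs T e))"
      have bls: "blinfun_of_hs (\<Sum>e\<in>F. g e) x = (\<Sum>e\<in>F. blinfun_of_hs (g e) x)" if "finite F"
        for F and g :: "'a \<Rightarrow> 'a hs" and x
        using that by induction (simp_all add: zero_hs.rep_eq plus_hs.rep_eq blinfun.add_left)
      have Ue: "blinfun_of_hs U e = (if e \<in> E then blinfun_of_hs T e else 0)" if "e \<in> some_onb" for e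
      proof -
        have "blinfun_of_hs U e = (\<Sum>f\<in>E. (f \<bullet> e) *\<^sub>R blinfun_of_hs T f)"
          by (simp add: U_def bls[OF E(1)] hs_tensor_apply)
        also have "\<dots> = (\<Sum>f\<in>E. if f = e then blinfun_of_hs T f else 0)"
          using E(2) that by (intro sum.cong) (auto simp: orthonormal_inner[OF on])
        finally show ?thesis using E(1) by simp
      qed
      have "(norm (U - T))\<^sup>2 \<le> \<epsilon>\<^sup>2 / 4"
        using norm_hs_has_sum[OF onb, of "U - T"]
      proof (rule has_sum_le_finite_sums)
        fix F :: "'a set" assume F: "finite F" "F \<subseteq> some_onb"
        have "(\<Sum>e\<in>F. (norm (blinfun_of_hs (U - T) e))\<^sup>2) = (\<Sum>e\<in>F - E. (norm (blinfun_of_hs T e))\<^sup>2)"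
          using F by (intro sum.mono_neutral_cong_right) (auto simp: minus_hs.rep_eq blinfun.diff_left Ue)
        also have "\<dots> \<le> \<epsilon>\<^sup>2 / 4" using F by (intro order_less_imp_le[OF E(3)]) auto
        finally show "(\<Sum>e\<in>F. (norm (blinfun_of_hs (U - T) e))\<^sup>2) \<le> \<epsilon>\<^sup>2 / 4" .
      qed
      then have "(norm (U - T))\<^sup>2 \<le> (\<epsilon> / 2)\<^sup>2" by (simp add: power_divide)
      then have "norm (U - T) \<le> \<epsilon> / 2" by (rule power2_le_imp_le) (use that in simp)
      then have "dist U T < \<epsilon>" using that by (simp add: dist_norm)
      moreover have "U \<in> closure S" unfolding U_def by (rule sums[OF E(1)])
      ultimately show ?thesis by blast
    qed
    then show ?thesis by (metis closure_approachable closure_closure)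
  qed
  then show "\<exists>B::'a hs set set. countable B \<and> open = generate_topology B"
    using countable_dense_imp_subbasis[OF \<open>countable S\<close>] by blast
qed

text \<open>Trace class in the sense of nuclear: \<open>T\<close> is an absolutely convergent series of rank one
  operators. Unlike summability of \<open>T e \<bullet> e\<close>, this needs no positivity of \<open>T\<close> and no basis.\<close>

definition trace_class :: "('a::real_inner \<Rightarrow>\<^sub>L 'a) \<Rightarrow> bool" where
  "trace_class T \<longleftrightarrow> (\<exists>a b :: nat \<Rightarrow> 'a. summable (\<lambda>k. norm (a k) * norm (b k)) \<and>
     (\<forall>x. (\<lambda>k. (a k \<bullet> x) *\<^sub>R b k) sums T x))"

definition op_trace :: "('a::real_inner \<Rightarrow>\<^sub>L 'a) \<Rightarrow> real" where
  "op_trace T = (\<Sum>\<^sub>\<infinity>e\<in>some_onb. T e \<bullet> e)"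

lemma trace_class_imp_hilbert_schmidt:
  fixes T :: "'a::{real_inner,banach} \<Rightarrow>\<^sub>L 'a"
  assumes "trace_class T"
  shows "hilbert_schmidt T"
proof -
  from assms obtain a b :: "nat \<Rightarrow> 'a" where ab: "summable (\<lambda>k. norm (a k) * norm (b k))"
    and T: "\<And>x. (\<lambda>k. (a k \<bullet> x) *\<^sub>R b k) sums T x"
    unfolding trace_class_def by blast
  have "summable (\<lambda>k. hs_tensor (a k) (b k))"
    by (rule summable_norm_cancel) (simp add: norm_hs_tensor ab)
  then obtain S where S: "(\<lambda>k. hs_tensor (a k) (b k)) sums S" by (auto simp: summable_def)
  have bl: "bounded_linear (\<lambda>S. blinfun_of_hs S x)" for x :: 'a
  proof (rule bounded_linear_intro)
    show "norm (blinfun_of_hs S x) \<le> norm S * norm x" for S :: "'a hs"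
      by (rule order_trans[OF norm_blinfun mult_right_mono[OF norm_blinfun_of_hs]]) simp
  qed (simp_all add: plus_hs.rep_eq scaleR_hs.rep_eq blinfun.add_left blinfun.scaleR_left)
  have "blinfun_of_hs S = T"
  proof (rule blinfun_eqI)
    fix x
    have "(\<lambda>k. (a k \<bullet> x) *\<^sub>R b k) sums blinfun_of_hs S x"
      using bounded_linear.sums[OF bl S, of x] by (simp add: hs_tensor_apply)
    then show "blinfun_of_hs S x = T x" using T sums_unique2 by blast
  qed
  then show ?thesis using blinfun_of_hs[of S] by simp
qed

lemma trace_class_sandwich:
  fixes \<eta> :: "'a::{real_inner,banach} \<Rightarrow>\<^sub>L 'b::{real_inner,banach}"
  assumes "trace_class Q"
  shows "trace_class (\<eta> o\<^sub>L Q o\<^sub>L adj \<eta>)"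
proof -
  from assms obtain a b :: "nat \<Rightarrow> 'a" where ab: "summable (\<lambda>k. norm (a k) * norm (b k))"
    and Q: "\<And>x. (\<lambda>k. (a k \<bullet> x) *\<^sub>R b k) sums Q x"
    unfolding trace_class_def by blast
  have "summable (\<lambda>k. norm (\<eta> (a k)) * norm (\<eta> (b k)))"
  proof (rule summable_comparison_test')
    show "summable (\<lambda>k. norm \<eta> * norm \<eta> * (norm (a k) * norm (b k)))"
      by (intro summable_mult ab)
    fix k
    have "norm (\<eta> (a k)) * norm (\<eta> (b k)) \<le> (norm \<eta> * norm (a k)) * (norm \<eta> * norm (b k))"
      by (intro mult_mono norm_blinfun) auto
    then show "norm (norm (\<eta> (a k)) * norm (\<eta> (b k))) \<le> norm \<eta> * norm \<eta> * (norm (a k) * norm (b k))"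
      by (simp add: algebra_simps)
  qed
  moreover have "(\<lambda>k. (\<eta> (a k) \<bullet> x) *\<^sub>R \<eta> (b k)) sums (\<eta> o\<^sub>L Q o\<^sub>L adj \<eta>) x" for x
    using bounded_linear.sums[OF blinfun.bounded_linear_right[of \<eta>] Q[of "adj \<eta> x"]]
    by (simp add: adj_works blinfun.scaleR_right)
  ultimately show ?thesis unfolding trace_class_def
    by (intro exI[of _ "\<lambda>k. \<eta> (a k)"] exI[of _ "\<lambda>k. \<eta> (b k)"]) blast
qed

lemma op_trace_has_sum:
  fixes T :: "'a::{real_inner,banach} \<Rightarrow>\<^sub>L 'a"
  assumes T: "trace_class T" and B: "orthonormal_basis B"
  shows "((\<lambda>e. T e \<bullet> e) has_sum op_trace T) B"
proof -
  from T obtain a b :: "nat \<Rightarrow> 'a" where ab: "summable (\<lambda>k. norm (a k) * norm (b k))"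
    and T: "\<And>x. (\<lambda>k. (a k \<bullet> x) *\<^sub>R b k) sums T x"
    unfolding trace_class_def by blast
  let ?g = "\<lambda>(k, e). (a k \<bullet> e) * (b k \<bullet> e)"
  have *: "((\<lambda>e. T e \<bullet> e) has_sum (\<Sum>\<^sub>\<infinity>k. a k \<bullet> b k)) C" if C: "orthonormal_basis C" for C
  proof -
    have on: "orthonormal C" using C by (simp add: orthonormal_basis_def)
    have part: "(\<Sum>e\<in>F. \<bar>(x \<bullet> e) * (y \<bullet> e)\<bar>) \<le> norm x * norm y" if F: "finite F" "F \<subseteq> C" for F x y
    proof -
      have "(\<Sum>e\<in>F. \<bar>x \<bullet> e\<bar> * \<bar>y \<bullet> e\<bar>) \<le> L2_set (\<lambda>e. x \<bullet> e) F * L2_set (\<lambda>e. y \<bullet> e) F"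
        by (rule L2_set_mult_ineq)
      also have "\<dots> \<le> norm x * norm y"
        using bessel_finite[OF on F, of x] bessel_finite[OF on F, of y]
        by (intro mult_mono) (auto simp: L2_set_def real_sqrt_le_iff intro: real_le_lsqrt sum_nonneg)
      finally show ?thesis by (simp add: abs_mult)
    qed
    have row: "(\<lambda>e. \<bar>(x \<bullet> e) * (y \<bullet> e)\<bar>) summable_on C" for x y
    proof (rule nonneg_bounded_partial_sums_imp_summable_on)
      show "\<forall>\<^sub>F F in finite_subsets_at_top C. (\<Sum>e\<in>F. \<bar>(x \<bullet> e) * (y \<bullet> e)\<bar>) \<le> norm x * norm y"
        by (rule eventually_finite_subsets_at_top_weakI) (use part in auto)
    qed simp
    have rowle: "(\<Sum>\<^sub>\<infinity>e\<in>C. \<bar>(x \<bullet> e) * (y \<bullet> e)\<bar>) \<le> norm x * norm y" for x y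
      by (rule infsum_le_finite_sums[OF row]) (use part in auto)
    have rows: "(\<lambda>k. \<Sum>\<^sub>\<infinity>e\<in>C. \<bar>(a k \<bullet> e) * (b k \<bullet> e)\<bar>) summable_on UNIV"
    proof (rule summable_on_comparison_test)
      show "(\<lambda>k. norm (a k) * norm (b k)) summable_on UNIV"
        by (rule summable_nonneg_imp_summable_on[OF ab]) simp
    qed (use rowle in \<open>auto intro: infsum_nonneg\<close>)
    have "(\<lambda>(k, e). \<bar>(a k \<bullet> e) * (b k \<bullet> e)\<bar>) summable_on UNIV \<times> C"
      by (rule summable_on_SigmaI[OF _ rows]) (use row in auto)
    then have "(\<lambda>p. norm (?g p)) summable_on UNIV \<times> C"
      by (simp add: case_prod_unfold)
    then have sm: "?g summable_on UNIV \<times> C" by (rule Infinite_Sum.abs_summable_summable)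
    have "(?g has_sum (\<Sum>\<^sub>\<infinity>k. a k \<bullet> b k)) (UNIV \<times> C)"
    proof (rule has_sum_SigmaI[OF _ _ sm])
      show r: "((\<lambda>e. ?g (k, e)) has_sum (a k \<bullet> b k)) C" for k
        using parseval[OF C, of "a k" "b k"] by simp
      obtain s where s: "(?g has_sum s) (UNIV \<times> C)" using sm by (auto simp: summable_on_def)
      have "((\<lambda>k. a k \<bullet> b k) has_sum s) UNIV"
        by (rule has_sum_SigmaD[OF s]) (use r in auto)
      then show "((\<lambda>k. a k \<bullet> b k) has_sum (\<Sum>\<^sub>\<infinity>k. a k \<bullet> b k)) UNIV"
        by (rule has_sum_infsum[OF has_sum_imp_summable])
    qed
    then have sw: "((\<lambda>(e, k). ?g (k, e)) has_sum (\<Sum>\<^sub>\<infinity>k. a k \<bullet> b k)) (C \<times> UNIV)"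
      by (subst (asm) has_sum_swap)
    show ?thesis
    proof (rule has_sum_SigmaD[OF sw])
      fix e assume e: "e \<in> C"
      have "(\<lambda>(e, k). ?g (k, e)) summable_on C \<times> UNIV" using sw by (auto simp: summable_on_def)
      then have "(\<lambda>k. ?g (k, e)) summable_on UNIV"
        using summable_on_SigmaD1[of "\<lambda>e k. ?g (k, e)" C "\<lambda>_. UNIV" e] e by simp
      then obtain s where s: "((\<lambda>k. ?g (k, e)) has_sum s) UNIV" by (auto simp: summable_on_def)
      have "(\<lambda>k. ((a k \<bullet> e) *\<^sub>R b k) \<bullet> e) sums (T e \<bullet> e)"
        by (rule bounded_linear.sums[OF bounded_linear_inner_left T])
      then have "s = T e \<bullet> e"
        using has_sum_imp_sums[OF s] by (auto intro: sums_unique2)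
      with s show "((\<lambda>k. case (e, k) of (e, k) \<Rightarrow> ?g (k, e)) has_sum (T e \<bullet> e)) UNIV" by simp
    qed
  qed
  have "op_trace T = (\<Sum>\<^sub>\<infinity>k. a k \<bullet> b k)"
    unfolding op_trace_def using *[OF orthonormal_basis_some_onb] by (rule infsumI)
  then show ?thesis using *[OF B] by simp
qed

lemma hilbert_schmidt_sandwich:
  fixes \<eta> :: "'a::{real_inner,banach} \<Rightarrow>\<^sub>L 'b::{real_inner,banach}"
  assumes "trace_class Q"
  shows "hilbert_schmidt (\<eta> o\<^sub>L Q o\<^sub>L adj \<eta>)"
  by (rule trace_class_imp_hilbert_schmidt[OF trace_class_sandwich[OF assms]])

lemma bounded_linear_tensor_sym:
  fixes \<eta> :: "'a::{real_inner,banach} \<Rightarrow>\<^sub>L 'a"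
  shows "bounded_linear (\<lambda>h. \<eta> h \<otimes> y + y \<otimes> \<eta> h)"
  by (intro bounded_linear_add
      bounded_linear_compose[OF bounded_bilinear.bounded_linear_left[OF bounded_bilinear_hs_tensor]]
      bounded_linear_compose[OF bounded_bilinear.bounded_linear_right[OF bounded_bilinear_hs_tensor]]
      blinfun.bounded_linear_right)

text \<open>Time is the half line \<open>t \<ge> 0\<close>; values of a filtration or of a process at negative times
  are never constrained or used.\<close>

definition filtered_prob_space :: "'w measure \<Rightarrow> (real \<Rightarrow> 'w measure) \<Rightarrow> bool" where
  "filtered_prob_space M F \<longleftrightarrow> prob_space M \<and> (\<forall>t\<ge>0. subalgebra M (F t)) \<and>
     (\<forall>s t. 0 \<le> s \<and> s \<le> t \<longrightarrow> sets (F s) \<subseteq> sets (F t))"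

definition progressively_measurable ::
    "(real \<Rightarrow> 'w measure) \<Rightarrow> (real \<Rightarrow> 'w \<Rightarrow> 'u::topological_space) \<Rightarrow> bool" where
  "progressively_measurable F X \<longleftrightarrow>
     (\<forall>T\<ge>0. (\<lambda>(s, \<omega>). X s \<omega>) \<in> borel_measurable (restrict_space borel {0..T} \<Otimes>\<^sub>M F T))"

definition covariance_operator :: "('h::real_inner \<Rightarrow>\<^sub>L 'h) \<Rightarrow> bool" where
  "covariance_operator Q \<longleftrightarrow>
     (\<forall>x y. Q x \<bullet> y = x \<bullet> Q y) \<and> (\<forall>x. x \<noteq> 0 \<longrightarrow> 0 < Q x \<bullet> x) \<and> trace_class Q"

text \<open>The increment over \<open>[s, t]\<close> is Gaussian with mean \<open>0\<close> and covariance \<open>(t - s) Q\<close>, i.e. each of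
  its one-dimensional projections is. As \<open>Q\<close> is positive definite, these are nondegenerate.\<close>

definition wiener_process ::
    "'w measure \<Rightarrow> (real \<Rightarrow> 'w measure) \<Rightarrow> ('h::real_inner \<Rightarrow>\<^sub>L 'h) \<Rightarrow> (real \<Rightarrow> 'w \<Rightarrow> 'h) \<Rightarrow> bool" where
  "wiener_process M F Q W \<longleftrightarrow>
     (\<forall>t\<ge>0. W t \<in> borel_measurable (F t)) \<and>
     (AE \<omega> in M. W 0 \<omega> = 0) \<and>
     (AE \<omega> in M. continuous_on {0..} (\<lambda>t. W t \<omega>)) \<and>
     (\<forall>s t. 0 \<le> s \<and> s < t \<longrightarrow>
        prob_space.indep_set M (sets (F s))
          (sets (vimage_algebra (space M) (\<lambda>\<omega>. W t \<omega> - W s \<omega>) borel)) \<and>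
        (\<forall>h. h \<noteq> 0 \<longrightarrow>
           distributed M lborel (\<lambda>\<omega>. (W t \<omega> - W s \<omega>) \<bullet> h)
             (normal_density 0 (sqrt ((t - s) * (Q h \<bullet> h))))))"

text \<open>A list of tuples \<open>(a, b, A, L)\<close> encodes the simple process
  \<open>\<Sum> L 1\<^bsub>(a, b]\<^esub>(s) 1\<^bsub>A\<^esub>(\<omega>)\<close>; its stochastic integral up to time \<open>t\<close> is
  \<open>\<Sum> 1\<^bsub>A\<^esub> L (W(b \<and> t) - W(a \<and> t))\<close>.\<close>

type_synonym ('w, 'h, 'u) simple = "(real \<times> real \<times> 'w set \<times> ('h \<Rightarrow>\<^sub>L 'u)) list"

definition simple_adapted ::
    "(real \<Rightarrow> 'w measure) \<Rightarrow> ('w, 'h::real_inner, 'u::real_inner) simple \<Rightarrow> bool" where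
  "simple_adapted F xs \<longleftrightarrow> (\<forall>(a, b, A, L)\<in>set xs. 0 \<le> a \<and> a \<le> b \<and> A \<in> sets (F a))"

definition simple_process ::
    "('w, 'h::real_inner, 'u::real_inner) simple \<Rightarrow> real \<Rightarrow> 'w \<Rightarrow> 'h \<Rightarrow>\<^sub>L 'u" where
  "simple_process xs s \<omega> = (\<Sum>(a, b, A, L)\<leftarrow>xs. if a < s \<and> s \<le> b \<and> \<omega> \<in> A then L else 0)"

definition simple_integral ::
    "(real \<Rightarrow> 'w \<Rightarrow> 'h) \<Rightarrow> ('w, 'h::real_inner, 'u::real_inner) simple \<Rightarrow> real \<Rightarrow> 'w \<Rightarrow> 'u" where
  "simple_integral W xs t \<omega> =
     (\<Sum>(a, b, A, L)\<leftarrow>xs. if \<omega> \<in> A then L (W (min b t) \<omega> - W (min a t) \<omega>) else 0)"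

text \<open>The squared Hilbert-Schmidt norm of \<open>L Q\<^bsup>1/2\<^esup>\<close>, written as the trace of \<open>L Q L\<^sup>*\<close>; it is the
  integrand in the Ito isometry.\<close>

definition q_norm2 :: "('h::real_inner \<Rightarrow>\<^sub>L 'h) \<Rightarrow> ('h \<Rightarrow>\<^sub>L 'u::real_inner) \<Rightarrow> real" where
  "q_norm2 Q L = op_trace (L o\<^sub>L Q o\<^sub>L adj L)"

text \<open>\<open>X\<close> is (a version of) the Ito integral of \<open>\<Psi>\<close> over \<open>[0, t]\<close>: there are simple processes
  converging to \<open>\<Psi>\<close> in the norm \<open>E \<integral>\<^sub>0\<^sup>t q_norm2 Q \<cdot> ds\<close> whose integrals converge to \<open>X\<close> in mean square.
  Measurability of \<open>\<Psi>\<close> is required pointwise, since the space of bounded operators is not separable.\<close>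

definition has_stoch_integral ::
    "'w measure \<Rightarrow> (real \<Rightarrow> 'w measure) \<Rightarrow> ('h::real_inner \<Rightarrow>\<^sub>L 'h) \<Rightarrow> (real \<Rightarrow> 'w \<Rightarrow> 'h) \<Rightarrow>
     (real \<Rightarrow> 'w \<Rightarrow> 'h \<Rightarrow>\<^sub>L 'u::real_inner) \<Rightarrow> real \<Rightarrow> ('w \<Rightarrow> 'u) \<Rightarrow> bool" where
  "has_stoch_integral M F Q W \<Psi> t X \<longleftrightarrow>
     (\<forall>h. progressively_measurable F (\<lambda>s \<omega>. \<Psi> s \<omega> h)) \<and>
     X \<in> borel_measurable M \<and>
     (\<exists>xs. (\<forall>n::nat. simple_adapted F (xs n)) \<and>
        (\<lambda>n. \<integral>\<^sup>+\<omega>. (\<integral>\<^sup>+s\<in>{0..t}. ennreal (q_norm2 Q (simple_process (xs n) s \<omega> - \<Psi> s \<omega>)) \<partial>lborel) \<partial>M)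
          \<longlonglongrightarrow> 0 \<and>
        (\<lambda>n. \<integral>\<^sup>+\<omega>. ennreal ((norm (simple_integral W (xs n) t \<omega> - X \<omega>))\<^sup>2) \<partial>M) \<longlonglongrightarrow> 0)"

text \<open>Strong solution of \<open>dY(t) = A Y(t) dt + \<eta> dW(t)\<close>, \<open>Y(0) = Y\<^sub>0\<close>, for bounded \<open>A\<close>. Here \<open>Z t\<close> is the
  stochastic integral of the constant integrand \<open>\<eta>\<close> over \<open>[0, t]\<close>.\<close>

definition strong_solution ::
    "'w measure \<Rightarrow> (real \<Rightarrow> 'w measure) \<Rightarrow> ('h::{real_inner,banach,second_countable_topology} \<Rightarrow>\<^sub>L 'h) \<Rightarrow>
     (real \<Rightarrow> 'w \<Rightarrow> 'h) \<Rightarrow> ('h \<Rightarrow>\<^sub>L 'h) \<Rightarrow> ('h \<Rightarrow>\<^sub>L 'h) \<Rightarrow> 'h \<Rightarrow> (real \<Rightarrow> 'w \<Rightarrow> 'h) \<Rightarrow> bool" where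
  "strong_solution M F Q W A \<eta> Y\<^sub>0 Y \<longleftrightarrow>
     progressively_measurable F Y \<and>
     (\<exists>Z. \<forall>t\<ge>0. has_stoch_integral M F Q W (\<lambda>s \<omega>. \<eta>) t (Z t) \<and>
        (AE \<omega> in M. set_integrable lborel {0..t} (\<lambda>s. A (Y s \<omega>)) \<and>
           Y t \<omega> = Y\<^sub>0 + (LINT s:{0..t}|lborel. A (Y s \<omega>)) + Z t \<omega>))"

end

theory Submission
  imports Defs
begin

text \<open>Write \<open>Y = X + U\<close> with \<open>X(t) = Y\<^sub>0 + \<integral>\<^sub>0\<^sup>t A Y(s) ds\<close>. By the Ito isometry \<open>U(t) = \<eta> W(t)\<close> almost
  surely for each \<open>t\<close>, and Gronwall's lemma applied to the paths of \<open>X\<close> bounds the fourth moments of \<open>Y\<close>;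
  no path continuity is used. On a cell \<open>[r, s]\<close> of a uniform grid, expand \<open>Y \<otimes> Y\<close> bilinearly around \<open>Y(r)\<close>.
  The increment minus \<open>\<integral>\<^sub>r\<^sup>s \<Phi>\<close> minus \<open>\<Psi>(r) (W(s) - W(r))\<close> is the sum of a remainder with second moment
  \<open>O((s - r)\<^sup>3)\<close> and of \<open>\<eta> \<Delta>W \<otimes> \<eta> \<Delta>W - (s - r) \<eta> Q \<eta>\<^sup>*\<close>, which has mean zero, second moment
  \<open>O((s - r)\<^sup>2)\<close>, and is orthogonal over different cells. Hence the Riemann sums \<open>\<Sum> \<Psi>(t\<^sub>k) \<Delta>W\<^sub>k\<close> converge in
  mean square to \<open>V(t) - V(0) - \<integral>\<^sub>0\<^sup>t \<Phi>\<close>, which is therefore the stochastic integral.\<close>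

subsection \<open>Orthonormal bases of separable spaces and Gaussian moments\<close>

text \<open>The equation in \<open>strong_solution\<close> and the limits in
  \<open>has_stoch_integral\<close> concern one time each, with null sets that depend on it.
  Estimates are therefore made in mean square at fixed times and carried to time integrals by
  Tonelli's theorem. With N cells of length T/N, remainders of second moment O(N^-3) may be summed
  by the triangle inequality, at the cost of a factor N^2, and still tend to 0. The deviation of the
  quadratic variation has second moment O(N^-2) per cell, where that factor would leave O(1);
  orthogonality lowers the cost to N and makes the sum vanish. Fourth moments enter because Y
  \<otimes> Y is quadratic and its error is measured in mean square. It is replaced by a finitely
  valued F(r)-measurable function that is close in mean square both by itself and after
  multiplication with the norm of the increment of W: the first gives convergence of the integrands,
  the second that of their integrals.\<close>

lemma sum2_le: "(a + b)\<^sup>2 \<le> 2 * (a\<^sup>2 + b\<^sup>2)" for a b :: real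
  using sum_squares_bound[of a b] by (simp add: power2_sum)

lemma sum4_le: "(a + b) ^ 4 \<le> 8 * (a ^ 4 + b ^ 4)" for a b :: real
proof -
  have "((a + b)\<^sup>2)\<^sup>2 \<le> (2 * (a\<^sup>2 + b\<^sup>2))\<^sup>2" by (intro power_mono sum2_le) auto
  also have "\<dots> = 4 * (a\<^sup>2 + b\<^sup>2)\<^sup>2" by (simp only: power_mult_distrib) simp
  also have "\<dots> \<le> 4 * (2 * ((a\<^sup>2)\<^sup>2 + (b\<^sup>2)\<^sup>2))" by (intro mult_left_mono sum2_le) auto
  finally show ?thesis by (simp flip: power_mult)
qed

text \<open>Distinct elements have distance sqrt 2 > 1, so the balls of radius 1/2 around them are
  disjoint, nonempty and open; a second countable space has only countably many such sets.\<close>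

lemma countable_orthonormal:
  fixes B :: "'a::{real_inner,second_countable_topology} set"
  assumes "orthonormal B"
  shows "countable B"
proof -
  have far: "1 < dist x y" if "x \<in> B" "y \<in> B" "x \<noteq> y" for x y
  proof (rule power_less_imp_less_base)
    show "1 ^ 2 < (dist x y)\<^sup>2"
      using orthonormal_inner[OF assms] that
      by (simp add: dist_norm power2_norm_eq_inner inner_diff inner_commute)
  qed simp
  have disj: "disjoint_family_on (\<lambda>x. ball x (1/2)) B"
  proof -
    have "z \<notin> ball y (1/2)" if "x \<in> B" "y \<in> B" "x \<noteq> y" "z \<in> ball x (1/2)" for x y z
      using far[OF that(1-3)] that(4) dist_triangle[of x y z] by (auto simp: dist_commute)
    then show ?thesis unfolding disjoint_family_on_def by blast
  qed
  have "countable ((\<lambda>x. ball x (1/2)) ` B)"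
  proof (rule countable_disjoint_open_subsets)
    show "disjoint ((\<lambda>x. ball x (1/2)) ` B)"
      using disj by (rule disjoint_family_on_disjoint_image)
  qed auto
  moreover have "inj_on (\<lambda>x. ball x (1/2)) B"
  proof (rule inj_onI, rule ccontr)
    fix x y assume "x \<in> B" "y \<in> B" "ball x (1/2) = ball y (1/2)" "x \<noteq> y"
    moreover have "x \<in> ball x (1/2)" by simp
    ultimately show False using far[of x y] by (auto simp: dist_commute)
  qed
  ultimately show ?thesis by (rule countable_image_inj_on)
qed

text \<open>Unordered sums over \<open>some_onb\<close> become series, the form in which monotone
  and dominated convergence apply. Only Parseval's identity and the trace formula are exported, so
  \<open>e\<close> may contain zeros.\<close>

lemma enumerated_basis:
  obtains e :: "nat \<Rightarrow> 'a::{real_inner,banach,second_countable_topology}"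
  where "\<And>x y. (\<lambda>n. (x \<bullet> e n) * (y \<bullet> e n)) sums (x \<bullet> y)"
    and "\<And>T. trace_class T \<Longrightarrow> (\<lambda>n. T (e n) \<bullet> e n) sums op_trace T"
proof -
  let ?B = "some_onb :: 'a set"
  note onb = orthonormal_basis_some_onb[where 'a='a]
  have B: "countable ?B" using onb by (intro countable_orthonormal) (simp add: orthonormal_basis_def)
  \<comment> \<open>Indices outside the enumeration are filled with 0, which covers finite dimension
    as well; the summands used vanish at 0.\<close>
  define e where "e n = (if n \<in> to_nat_on ?B ` ?B then from_nat_into ?B n else 0)" for n
  have sums: "(\<lambda>n. g (e n)) sums s" if "(g has_sum s) ?B" and g0: "g 0 = 0" for g :: "'a \<Rightarrow> real" and s
  proof -
    have "((\<lambda>n. g (e n)) has_sum s) (to_nat_on ?B ` ?B)"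
      using that B by (subst has_sum_reindex) (auto simp: e_def o_def cong: has_sum_cong)
    then have "((\<lambda>n. g (e n)) has_sum s) UNIV"
      by (subst (asm) has_sum_cong_neutral[where T=UNIV and g="\<lambda>n. g (e n)"]) (auto simp: e_def g0)
    then show ?thesis by (rule has_sum_imp_sums)
  qed
  show thesis
  proof (rule that[of e])
    show "(\<lambda>n. (x \<bullet> e n) * (y \<bullet> e n)) sums (x \<bullet> y)" for x y
      by (rule sums[OF parseval[OF onb]]) simp
    show "(\<lambda>n. T (e n) \<bullet> e n) sums op_trace T" if "trace_class T" for T
      by (rule sums[OF op_trace_has_sum[OF that onb]]) simp
  qed
qed

text \<open>Cauchy-Schwarz on the partial sums plus Bessel's inequality, the latter read off from
  the assumed identity at \<open>x = y\<close>. It supplies the dominating function in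
  \<open>increment_orthogonal\<close>.\<close>

lemma parseval_partial_bound:
  fixes e :: "nat \<Rightarrow> 'a::real_inner"
  assumes e: "\<And>x y. (\<lambda>n. (x \<bullet> e n) * (y \<bullet> e n)) sums (x \<bullet> y)"
  shows "\<bar>\<Sum>n<N. (x \<bullet> e n) * (y \<bullet> e n)\<bar> \<le> norm x * norm y"
proof -
  have L2: "L2_set (\<lambda>n. x \<bullet> e n) {..<N} \<le> norm x" for x
    unfolding L2_set_def
  proof (rule real_le_lsqrt)
    have "(\<Sum>n<N. (x \<bullet> e n) * (x \<bullet> e n)) \<le> (\<Sum>n. (x \<bullet> e n) * (x \<bullet> e n))"
      by (rule sum_le_suminf[OF sums_summable[OF e]]) auto
    also have "\<dots> = x \<bullet> x" by (rule sums_unique[OF e, symmetric])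
    finally show "(\<Sum>n<N. (x \<bullet> e n)\<^sup>2) \<le> (norm x)\<^sup>2"
      by (simp add: power2_norm_eq_inner) (simp only: power2_eq_square)
  qed (simp_all add: sum_nonneg)
  have "\<bar>\<Sum>n<N. (x \<bullet> e n) * (y \<bullet> e n)\<bar> \<le> (\<Sum>n<N. \<bar>x \<bullet> e n\<bar> * \<bar>y \<bullet> e n\<bar>)"
    by (rule order_trans[OF sum_abs]) (simp add: abs_mult)
  also have "\<dots> \<le> L2_set (\<lambda>n. x \<bullet> e n) {..<N} * L2_set (\<lambda>n. y \<bullet> e n) {..<N}"
    by (rule L2_set_mult_ineq)
  also have "\<dots> \<le> norm x * norm y" by (intro mult_mono L2) (auto simp: L2_set_nonneg)
  finally show ?thesis .
qed

lemma (in prob_space) distributed_normal_moments: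
  assumes D: "distributed M lborel X (normal_density 0 \<sigma>)" and \<sigma>: "0 < \<sigma>"
  shows "has_bochner_integral M X 0" "has_bochner_integral M (\<lambda>x. (X x)\<^sup>2) (\<sigma>\<^sup>2)"
    and "has_bochner_integral M (\<lambda>x. X x ^ 4) (3 * \<sigma> ^ 4)"
proof -
  have tr: "has_bochner_integral M (\<lambda>x. X x ^ k) s"
    if "has_bochner_integral lborel (\<lambda>x. normal_density 0 \<sigma> x * x ^ k) s" for k s
  proof -
    have 1: "integrable M (\<lambda>x. X x ^ k)"
      using distributed_integrable[OF D, of "\<lambda>x. x ^ k"] that
      by (simp add: has_bochner_integral_iff)
    moreover have "(\<integral>x. X x ^ k \<partial>M) = s"
      using distributed_integral[OF D, of "\<lambda>x. x ^ k"] that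
      by (simp add: has_bochner_integral_iff)
    ultimately show ?thesis by (simp add: has_bochner_integral_iff)
  qed
  show "has_bochner_integral M X 0"
    using tr[of 1] normal_moment_odd[OF \<sigma>, of 0 0] by simp
  show "has_bochner_integral M (\<lambda>x. (X x)\<^sup>2) (\<sigma>\<^sup>2)"
    using tr[of 2 "\<sigma>\<^sup>2"] normal_moment_even[OF \<sigma>, of 0 1] \<sigma> by simp
  \<comment> \<open>The even moments are
    \<open>fact (2 * k) / ((2 / \<sigma>\<^sup>2) ^ k * fact k)\<close>; this is k = 2.\<close>
  have "fact 4 / ((2 / \<sigma>\<^sup>2)\<^sup>2 * fact 2) = 3 * \<sigma> ^ 4"
    using \<sigma> by (simp add: fact_numeral field_simps)
  then show "has_bochner_integral M (\<lambda>x. X x ^ 4) (3 * \<sigma> ^ 4)"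
    using tr[of 4] normal_moment_even[OF \<sigma>, of 0 2] by simp
qed

subsection \<open>Increments of the Wiener process\<close>

lemma integrable_inner_of_squares:
  fixes f g :: "'a \<Rightarrow> 'b::{real_inner,banach,second_countable_topology}"
  assumes [measurable]: "f \<in> borel_measurable M" "g \<in> borel_measurable M"
    and fg: "integrable M (\<lambda>x. (norm (f x))\<^sup>2)" "integrable M (\<lambda>x. (norm (g x))\<^sup>2)"
  shows "integrable M (\<lambda>x. norm (f x) * norm (g x))" "integrable M (\<lambda>x. f x \<bullet> g x)"
proof -
  have bd: "norm (f x) * norm (g x) \<le> (norm (f x))\<^sup>2 + (norm (g x))\<^sup>2" for x
    using sum_squares_bound[of "norm (f x)" "norm (g x)"]
      mult_nonneg_nonneg[OF norm_ge_zero norm_ge_zero, of "f x" "g x"] by linarith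
  show 1: "integrable M (\<lambda>x. norm (f x) * norm (g x))"
    by (rule Bochner_Integration.integrable_bound[OF Bochner_Integration.integrable_add[OF fg]])
      (use bd in auto)
  show "integrable M (\<lambda>x. f x \<bullet> g x)"
    by (rule Bochner_Integration.integrable_bound[OF 1]) (auto intro!: Cauchy_Schwarz_ineq2)
qed

locale hilbert_wiener =
  fixes M :: "'w measure" and F :: "real \<Rightarrow> 'w measure"
    and Q :: "'h::{real_inner,banach,second_countable_topology} \<Rightarrow>\<^sub>L 'h"
    and W :: "real \<Rightarrow> 'w \<Rightarrow> 'h"
  assumes filtered: "filtered_prob_space M F"
    and covariance: "covariance_operator Q"
    and wiener: "wiener_process M F Q W"
begin

sublocale prob_space M using filtered by (simp add: filtered_prob_space_def)

lemma subalgebra_F: "0 \<le> t \<Longrightarrow> subalgebra M (F t)"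
  using filtered by (simp add: filtered_prob_space_def)

lemma space_F: "0 \<le> t \<Longrightarrow> space (F t) = space M"
  using subalgebra_F by (simp add: subalgebra_def)

lemma sets_F: "0 \<le> t \<Longrightarrow> A \<in> sets (F t) \<Longrightarrow> A \<in> sets M"
  using subalgebra_F by (auto simp: subalgebra_def)

lemma sets_F_mono: "0 \<le> s \<Longrightarrow> s \<le> t \<Longrightarrow> A \<in> sets (F s) \<Longrightarrow> A \<in> sets (F t)"
  using filtered by (auto simp: filtered_prob_space_def)

lemma measurable_F: "0 \<le> t \<Longrightarrow> f \<in> measurable (F t) N \<Longrightarrow> f \<in> measurable M N"
  by (rule measurable_from_subalg[OF subalgebra_F])

lemma measurable_F_mono:
  "0 \<le> s \<Longrightarrow> s \<le> t \<Longrightarrow> f \<in> measurable (F s) N \<Longrightarrow> f \<in> measurable (F t) N"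
  by (rule measurable_from_subalg[of _ "F s"]) (auto simp: subalgebra_def space_F sets_F_mono)

lemma W_measurable_F: "0 \<le> t \<Longrightarrow> W t \<in> borel_measurable (F t)"
  using wiener by (simp add: wiener_process_def)

lemma W_measurable: "0 \<le> t \<Longrightarrow> W t \<in> borel_measurable M"
  by (rule measurable_F[OF _ W_measurable_F])

lemma W_0: "AE \<omega> in M. W 0 \<omega> = 0"
  using wiener by (simp add: wiener_process_def)

lemma trace_class_Q: "trace_class Q"
  using covariance by (simp add: covariance_operator_def)

lemma Q_symmetric: "Q x \<bullet> y = x \<bullet> Q y"
  using covariance by (simp add: covariance_operator_def)

lemma Q_pos:
  "x \<noteq> 0 \<Longrightarrow> 0 < Q x \<bullet> x"
  using covariance unfolding covariance_operator_def by blast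

lemma Q_nonneg: "0 \<le> Q x \<bullet> x"
  using Q_pos[of x] by (cases "x = 0") (simp_all add: less_imp_le)

lemma increment_moments:
  assumes st: "0 \<le> s" "s \<le> t"
  shows "has_bochner_integral M (\<lambda>\<omega>. (W t \<omega> - W s \<omega>) \<bullet> h) 0"
    and "has_bochner_integral M (\<lambda>\<omega>. ((W t \<omega> - W s \<omega>) \<bullet> h)\<^sup>2) ((t - s) * (Q h \<bullet> h))"
    and "has_bochner_integral M (\<lambda>\<omega>. ((W t \<omega> - W s \<omega>) \<bullet> h) ^ 4) (3 * ((t - s) * (Q h \<bullet> h))\<^sup>2)"
proof -
  let ?X = "\<lambda>\<omega>. (W t \<omega> - W s \<omega>) \<bullet> h" and ?s = "sqrt ((t - s) * (Q h \<bullet> h))"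
  have "has_bochner_integral M ?X 0 \<and> has_bochner_integral M (\<lambda>\<omega>. (?X \<omega>)\<^sup>2) ((t - s) * (Q h \<bullet> h)) \<and>
    has_bochner_integral M (\<lambda>\<omega>. ?X \<omega> ^ 4) (3 * ((t - s) * (Q h \<bullet> h))\<^sup>2)"
  \<comment> \<open>A density is given only for s < t and nonzero h; in the remaining cases the
    projection is identically 0.\<close>
  proof (cases "h = 0 \<or> s = t")
    case True
    then show ?thesis by auto
  next
    case False
    then have "distributed M lborel ?X (normal_density 0 ?s)"
      using wiener st by (simp add: wiener_process_def)
    moreover have pos: "0 < (t - s) * (Q h \<bullet> h)"
      using False st by (intro mult_pos_pos Q_pos) auto
    moreover have "?s ^ 4 = ((t - s) * (Q h \<bullet> h))\<^sup>2"
    proof -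
      have "?s ^ 4 = (?s\<^sup>2)\<^sup>2" by (simp flip: power_mult)
      then show ?thesis using pos by simp
    qed
    ultimately show ?thesis
      using distributed_normal_moments[of ?X ?s] by (simp del: real_sqrt_mult)
  qed
  then show "has_bochner_integral M ?X 0"
    "has_bochner_integral M (\<lambda>\<omega>. (?X \<omega>)\<^sup>2) ((t - s) * (Q h \<bullet> h))"
    "has_bochner_integral M (\<lambda>\<omega>. ?X \<omega> ^ 4) (3 * ((t - s) * (Q h \<bullet> h))\<^sup>2)" by auto
qed

lemma increment_measurable:
  "0 \<le> s \<Longrightarrow> s \<le> t \<Longrightarrow> (\<lambda>\<omega>. W t \<omega> - W s \<omega>) \<in> borel_measurable M"
  by (intro borel_measurable_diff W_measurable) auto

lemma borel_measurable_blinfun: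
  "f \<in> borel_measurable N \<Longrightarrow> (\<lambda>\<omega>. blinfun_apply L (f \<omega>)) \<in> borel_measurable N"
  by (rule borel_measurable_continuous_on[of "blinfun_apply L"]) (auto intro!: continuous_intros)

text \<open>The isometry for one increment. Along a basis \<open>e\<close> of the target, the n-th
  coordinate has second moment (t - s) times \<open>Q (adj L (e n)) \<bullet> adj L (e n)\<close>,
  and these terms sum to the trace of L Q L*. Each is nonnegative, hence so is the trace.\<close>

lemma increment_q_norm2:
  fixes L :: "'h \<Rightarrow>\<^sub>L 'u::{real_inner,banach,second_countable_topology}"
  assumes st: "0 \<le> s" "s \<le> t"
  shows "has_bochner_integral M (\<lambda>\<omega>. (norm (L (W t \<omega> - W s \<omega>)))\<^sup>2) ((t - s) * q_norm2 Q L)"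
    and "0 \<le> q_norm2 Q L"
proof -
  obtain e :: "nat \<Rightarrow> 'u" where e: "\<And>x y. (\<lambda>n. (x \<bullet> e n) * (y \<bullet> e n)) sums (x \<bullet> y)"
    and tr: "\<And>T. trace_class T \<Longrightarrow> (\<lambda>n. T (e n) \<bullet> e n) sums op_trace T"
    by (rule enumerated_basis) blast
  note [measurable] = increment_measurable[OF st]
  define q where "q n = Q (adj L (e n)) \<bullet> adj L (e n)" for n
  have q: "q sums q_norm2 Q L"
    using tr[OF trace_class_sandwich[OF trace_class_Q, of L]]
    by (simp add: q_def[abs_def] q_norm2_def adj_works[of L])
  have q0: "0 \<le> q n" for n by (simp add: q_def Q_nonneg)
  show nn: "0 \<le> q_norm2 Q L"
    using q q0 by (rule sums_le[rotated 1, OF sums_zero])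
  have second_moment: "(\<integral>\<^sup>+\<omega>. ennreal ((L (W t \<omega> - W s \<omega>) \<bullet> e n)\<^sup>2) \<partial>M) = ennreal ((t - s) * q n)" for n
    using increment_moments(2)[OF st, of "adj L (e n)"]
    unfolding adj_works q_def
    by (subst nn_integral_eq_integral) (auto simp: has_bochner_integral_iff)
  have "(\<integral>\<^sup>+\<omega>. ennreal ((norm (L (W t \<omega> - W s \<omega>)))\<^sup>2) \<partial>M)
      = (\<integral>\<^sup>+\<omega>. (\<Sum>n. ennreal ((L (W t \<omega> - W s \<omega>) \<bullet> e n)\<^sup>2)) \<partial>M)"
  proof (rule nn_integral_cong)
    fix \<omega>
    let ?x = "L (W t \<omega> - W s \<omega>)"
    have s: "(\<lambda>n. (?x \<bullet> e n)\<^sup>2) sums (norm ?x)\<^sup>2"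
      using e[of ?x ?x] unfolding power2_norm_eq_inner by (simp only: power2_eq_square)
    show "ennreal ((norm ?x)\<^sup>2) = (\<Sum>n. ennreal ((?x \<bullet> e n)\<^sup>2))"
      using sums_unique[OF s] by (subst suminf_ennreal2[OF _ sums_summable[OF s]]) auto
  qed
  also have "\<dots> = (\<Sum>n. \<integral>\<^sup>+\<omega>. ennreal ((L (W t \<omega> - W s \<omega>) \<bullet> e n)\<^sup>2) \<partial>M)"
    by (rule nn_integral_suminf) (measurable, rule borel_measurable_blinfun, measurable)
  also have "\<dots> = ennreal ((t - s) * q_norm2 Q L)"
    unfolding second_moment
    using sums_mult[OF q, of "t - s"] st q0
    by (subst suminf_ennreal2) (auto simp: sums_iff)
  finally show "has_bochner_integral M (\<lambda>\<omega>. (norm (L (W t \<omega> - W s \<omega>)))\<^sup>2) ((t - s) * q_norm2 Q L)"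
    using nn st by (intro has_bochner_integral_nn_integral)
      (auto intro!: borel_measurable_power borel_measurable_norm[THEN measurable_compose[rotated]] borel_measurable_blinfun)
qed

text \<open>The coordinates v_n of the increment along \<open>e\<close> may be correlated, as
  \<open>e\<close> need not diagonalise \<open>Q\<close>. Cauchy-Schwarz with the weights q_n = <Q
  e_n, e_n> gives |v|^4 <= \<tau> * sum v_n^4 / q_n, where \<tau> is the trace of Q, and the
  Gaussian value E v_n^4 = 3 (t - s)^2 q_n^2 turns the right side into 3 \<tau>^2 (t - s)^2.\<close>

lemma increment_norm4:
  "\<exists>K\<ge>0. \<forall>s t. 0 \<le> s \<and> s \<le> t \<longrightarrow>
     (\<integral>\<^sup>+\<omega>. ennreal (norm (W t \<omega> - W s \<omega>) ^ 4) \<partial>M) \<le> ennreal (K * (t - s)\<^sup>2)"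
proof -
  obtain e :: "nat \<Rightarrow> 'h" where e: "\<And>x y. (\<lambda>n. (x \<bullet> e n) * (y \<bullet> e n)) sums (x \<bullet> y)"
    and tr: "\<And>T. trace_class T \<Longrightarrow> (\<lambda>n. T (e n) \<bullet> e n) sums op_trace T"
    by (rule enumerated_basis) blast
  define q where "q n = Q (e n) \<bullet> e n" for n
  define \<tau> where "\<tau> = op_trace Q"
  have q: "q sums \<tau>" using tr[OF trace_class_Q] by (simp add: q_def[abs_def] \<tau>_def)
  have q0: "0 \<le> q n" for n by (simp add: q_def Q_nonneg)
  have \<tau>: "0 \<le> \<tau>" using q q0 by (rule sums_le[rotated 1, OF sums_zero])
  have "(\<integral>\<^sup>+\<omega>. ennreal (norm (W t \<omega> - W s \<omega>) ^ 4) \<partial>M) \<le> ennreal (3 * \<tau>\<^sup>2 * (t - s)\<^sup>2)"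
    if st: "0 \<le> s" "s \<le> t" for s t
  proof -
    note [measurable] = increment_measurable[OF st]
    have [measurable]: "W t \<in> borel_measurable M" "W s \<in> borel_measurable M"
      using st by (auto intro: W_measurable)
    let ?x = "\<lambda>\<omega> n. (W t \<omega> - W s \<omega>) \<bullet> e n"
    have "(\<integral>\<^sup>+\<omega>. ennreal (norm (W t \<omega> - W s \<omega>) ^ 4) \<partial>M)
        \<le> (\<integral>\<^sup>+\<omega>. ennreal \<tau> * (\<Sum>n. ennreal (?x \<omega> n ^ 4 / q n)) \<partial>M)"
    proof (rule nn_integral_mono)
      fix \<omega>
      let ?v = "W t \<omega> - W s \<omega>"
      have s: "(\<lambda>n. (?x \<omega> n)\<^sup>2) sums (norm ?v)\<^sup>2"
        using e[of ?v ?v] unfolding power2_norm_eq_inner by (simp only: power2_eq_square)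
      have "(\<lambda>N. ennreal ((\<Sum>n<N. (?x \<omega> n)\<^sup>2)\<^sup>2)) \<longlonglongrightarrow> ennreal (((norm ?v)\<^sup>2)\<^sup>2)"
        using s unfolding sums_def by (intro tendsto_intros)
      moreover have "ennreal ((\<Sum>n<N. (?x \<omega> n)\<^sup>2)\<^sup>2) \<le> ennreal \<tau> * (\<Sum>n. ennreal (?x \<omega> n ^ 4 / q n))" for N
      proof -
        have "(\<Sum>n<N. (?x \<omega> n)\<^sup>2) = (\<Sum>n<N. sqrt (q n) * ((?x \<omega> n)\<^sup>2 / sqrt (q n)))"
        \<comment> \<open>Positive definiteness gives \<open>q n > 0\<close> unless
          \<open>e n\<close> is a filler 0; then both sides are 0, as division by 0 yields
          0.\<close>
        proof (rule sum.cong)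
          fix n
          show "(?x \<omega> n)\<^sup>2 = sqrt (q n) * ((?x \<omega> n)\<^sup>2 / sqrt (q n))"
            using Q_pos[of "e n"] by (cases "e n = 0") (auto simp: q_def)
        qed simp
        then have "(\<Sum>n<N. (?x \<omega> n)\<^sup>2)\<^sup>2 \<le> (\<Sum>n<N. (sqrt (q n))\<^sup>2) * (\<Sum>n<N. ((?x \<omega> n)\<^sup>2 / sqrt (q n))\<^sup>2)"
          using Cauchy_Schwarz_ineq_sum[of "\<lambda>n. sqrt (q n)" "\<lambda>n. (?x \<omega> n)\<^sup>2 / sqrt (q n)" "{..<N}"] by metis
        also have "\<dots> = (\<Sum>n<N. q n) * (\<Sum>n<N. ?x \<omega> n ^ 4 / q n)"
          using q0 by (simp add: power_divide flip: power_mult)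
        also have "\<dots> \<le> \<tau> * (\<Sum>n<N. ?x \<omega> n ^ 4 / q n)"
        proof (rule mult_right_mono)
          show "(\<Sum>n<N. q n) \<le> \<tau>"
            unfolding sums_unique[OF q] by (rule sum_le_suminf[OF sums_summable[OF q]]) (auto simp: q0)
        qed (auto intro!: sum_nonneg divide_nonneg_nonneg q0)
        finally have "ennreal ((\<Sum>n<N. (?x \<omega> n)\<^sup>2)\<^sup>2) \<le> ennreal (\<tau> * (\<Sum>n<N. ?x \<omega> n ^ 4 / q n))"
          by (rule ennreal_leI)
        also have "\<dots> = ennreal \<tau> * (\<Sum>n<N. ennreal (?x \<omega> n ^ 4 / q n))"
          using \<tau> q0 by (subst ennreal_mult) (auto intro!: sum_nonneg simp: sum_ennreal)
        also have "\<dots> \<le> ennreal \<tau> * (\<Sum>n. ennreal (?x \<omega> n ^ 4 / q n))"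
          by (intro mult_left_mono sum_le_suminf) auto
        finally show ?thesis .
      qed
      ultimately have "ennreal (((norm ?v)\<^sup>2)\<^sup>2) \<le> ennreal \<tau> * (\<Sum>n. ennreal (?x \<omega> n ^ 4 / q n))"
        by - (rule LIMSEQ_le_const2, assumption, blast)
      then show "ennreal (norm ?v ^ 4) \<le> ennreal \<tau> * (\<Sum>n. ennreal (?x \<omega> n ^ 4 / q n))"
        by (simp flip: power_mult)
    qed
    also have "\<dots> = ennreal \<tau> * (\<Sum>n. \<integral>\<^sup>+\<omega>. ennreal (?x \<omega> n ^ 4 / q n) \<partial>M)"
      by (simp add: nn_integral_cmult nn_integral_suminf)
    also have "(\<lambda>n. \<integral>\<^sup>+\<omega>. ennreal (?x \<omega> n ^ 4 / q n) \<partial>M) = (\<lambda>n. ennreal (3 * (t - s)\<^sup>2 * q n))"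
    proof
      fix n
      have "has_bochner_integral M (\<lambda>\<omega>. ?x \<omega> n ^ 4 / q n) (3 * ((t - s) * q n)\<^sup>2 / q n)"
        unfolding q_def by (intro has_bochner_integral_divide_zero increment_moments st)
      then have "(\<integral>\<^sup>+\<omega>. ennreal (?x \<omega> n ^ 4 / q n) \<partial>M) = ennreal (3 * ((t - s) * q n)\<^sup>2 / q n)"
        using q0 by (subst nn_integral_eq_integral) (auto simp: has_bochner_integral_iff)
      also have "3 * ((t - s) * q n)\<^sup>2 / q n = 3 * (t - s)\<^sup>2 * q n"
        by (simp add: power2_eq_square)
      finally show "(\<integral>\<^sup>+\<omega>. ennreal (?x \<omega> n ^ 4 / q n) \<partial>M) = ennreal (3 * (t - s)\<^sup>2 * q n)" .
    qed
    also have "(\<Sum>n. ennreal (3 * (t - s)\<^sup>2 * q n)) = ennreal (3 * (t - s)\<^sup>2 * \<tau>)"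
      using sums_mult[OF q, of "3 * (t - s)\<^sup>2"] q0 by (subst suminf_ennreal2) (auto simp: sums_iff)
    also have "ennreal \<tau> * \<dots> = ennreal (3 * \<tau>\<^sup>2 * (t - s)\<^sup>2)"
    proof -
      have "3 * \<tau>\<^sup>2 * (t - s)\<^sup>2 = \<tau> * (3 * (t - s)\<^sup>2 * \<tau>)" by (simp add: power2_eq_square)
      then show ?thesis using \<tau> by (simp only: ennreal_mult')
    qed
    finally show ?thesis .
  qed
  then show ?thesis by (intro exI[of _ "3 * \<tau>\<^sup>2"]) auto
qed

end

subsection \<open>Orthogonality and the Ito isometry\<close>

context hilbert_wiener begin

text \<open>\<open>X\<close> generates a sub-sigma-algebra of \<open>F s\<close>, and a function of
  the increment generates one of the sigma-algebra of the increment; independence passes to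
  both.\<close>

lemma indep_increment:
  assumes s: "0 \<le> s" "s < t" and X: "X \<in> borel_measurable (F s)" and \<phi>: "\<phi> \<in> borel_measurable borel"
  shows "indep_var borel X borel (\<lambda>\<omega>. \<phi> (W t \<omega> - W s \<omega>) :: real)"
proof -
  let ?V = "vimage_algebra (space M) (\<lambda>\<omega>. W t \<omega> - W s \<omega>) borel"
  let ?Y = "\<lambda>\<omega>. \<phi> (W t \<omega> - W s \<omega>)"
  have I: "indep_set (sets (F s)) (sets ?V)"
    using wiener s by (simp add: wiener_process_def)
  have "(\<lambda>\<omega>. W t \<omega> - W s \<omega>) \<in> measurable ?V borel"
    by (rule measurable_vimage_algebra1) simp
  then have Y: "?Y \<in> measurable ?V borel"
    by (rule measurable_compose[OF _ \<phi>])
  have 1: "sigma_sets (space M) {X -` A \<inter> space M |A. A \<in> sets borel} \<subseteq> sets (F s)"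
    using sets.sigma_sets_subset[of "{X -` A \<inter> space M |A. A \<in> sets borel}" "F s"]
      measurable_sets[OF X] s by (auto simp: space_F)
  have 2: "sigma_sets (space M) {?Y -` A \<inter> space M |A. A \<in> sets borel} \<subseteq> sets ?V"
    using sets.sigma_sets_subset[of "{?Y -` A \<inter> space M |A. A \<in> sets borel}" ?V]
      measurable_sets[OF Y] by auto
  have "indep_set (sigma_sets (space M) {X -` A \<inter> space M |A. A \<in> sets borel})
     (sigma_sets (space M) {?Y -` A \<inter> space M |A. A \<in> sets borel})"
    using I unfolding indep_set_def
    by (rule indep_sets_mono_sets) (use 1 2 in \<open>auto split: bool.split\<close>)
  moreover have "X \<in> borel_measurable M" using X s by (intro measurable_F[of s]) auto
  moreover have "?Y \<in> borel_measurable M"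
    using increment_measurable[of s t] s \<phi> by (intro measurable_compose[OF _ \<phi>]) auto
  ultimately show ?thesis by (simp add: indep_var_eq)
qed

text \<open>The inner product is expanded along a basis, so that only independence of real random
  variables is needed.\<close>

lemma increment_orthogonal:
  fixes X :: "'w \<Rightarrow> 'u::{real_inner,banach,second_countable_topology}"
  assumes st: "0 \<le> s" "s \<le> t"
    and X: "X \<in> borel_measurable (F s)" "integrable M (\<lambda>\<omega>. (norm (X \<omega>))\<^sup>2)"
    and \<phi>: "\<phi> \<in> borel_measurable borel" "integrable M (\<lambda>\<omega>. (norm (\<phi> (W t \<omega> - W s \<omega>)))\<^sup>2)"
    and mean: "\<And>u. (\<integral>\<omega>. \<phi> (W t \<omega> - W s \<omega>) \<bullet> u \<partial>M) = 0"
  shows "(\<integral>\<omega>. X \<omega> \<bullet> \<phi> (W t \<omega> - W s \<omega>) \<partial>M) = 0"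
proof (cases "s = t")
  case True
  \<comment> \<open>The increment is 0 here, and the mean condition tested with
    \<open>u = \<phi> 0\<close> forces \<open>\<phi> 0 = 0\<close>.\<close>
  have "\<phi> 0 \<bullet> \<phi> 0 = 0" using mean[of "\<phi> 0"] True by (simp add: prob_space)
  then show ?thesis using True by simp
next
  case False
  then have lt: "s < t" using st by simp
  let ?D = "\<lambda>\<omega>. \<phi> (W t \<omega> - W s \<omega>)"
  obtain e :: "nat \<Rightarrow> 'u" where e: "\<And>x y. (\<lambda>n. (x \<bullet> e n) * (y \<bullet> e n)) sums (x \<bullet> y)"
    by (rule enumerated_basis) blast
  have XM [measurable]: "X \<in> borel_measurable M" using X st by (intro measurable_F[of s])
  have DM [measurable]: "?D \<in> borel_measurable M"
    using increment_measurable[OF st] by (intro measurable_compose[OF _ \<phi>(1)])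
  have int: "integrable M (\<lambda>\<omega>. Z \<omega> \<bullet> u)"
    if [measurable]: "Z \<in> borel_measurable M" and "integrable M (\<lambda>\<omega>. (norm (Z \<omega>))\<^sup>2)"
    for Z :: "'w \<Rightarrow> 'u" and u
    by (rule integrable_inner_of_squares) (use that in auto)
  have 0: "(\<integral>\<omega>. (X \<omega> \<bullet> e n) * (?D \<omega> \<bullet> e n) \<partial>M) = 0"
    and i: "integrable M (\<lambda>\<omega>. (X \<omega> \<bullet> e n) * (?D \<omega> \<bullet> e n))" for n
  proof -
    have iv: "indep_var borel (\<lambda>\<omega>. X \<omega> \<bullet> e n) borel (\<lambda>\<omega>. ?D \<omega> \<bullet> e n)"
      by (rule indep_increment[OF st(1) lt, of _ "\<lambda>v. \<phi> v \<bullet> e n"]) (use X \<phi> in auto)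
    show "(\<integral>\<omega>. (X \<omega> \<bullet> e n) * (?D \<omega> \<bullet> e n) \<partial>M) = 0"
      using indep_var_lebesgue_integral[OF iv int[OF XM X(2)] int[OF DM \<phi>(2)]] mean by simp
    show "integrable M (\<lambda>\<omega>. (X \<omega> \<bullet> e n) * (?D \<omega> \<bullet> e n))"
      by (rule indep_var_integrable[OF iv int[OF XM X(2)] int[OF DM \<phi>(2)]])
  qed
  \<comment> \<open>The coordinate products have expectation 0 one by one. Their partial sums
    converge to the inner product and are dominated by the product of the norms.\<close>
  have "(\<lambda>N. \<integral>\<omega>. (\<Sum>n<N. (X \<omega> \<bullet> e n) * (?D \<omega> \<bullet> e n)) \<partial>M) \<longlonglongrightarrow> (\<integral>\<omega>. X \<omega> \<bullet> ?D \<omega> \<partial>M)"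
  proof (rule integral_dominated_convergence)
    show "integrable M (\<lambda>\<omega>. norm (X \<omega>) * norm (?D \<omega>))"
      by (rule integrable_inner_of_squares) (use X \<phi> in auto)
    show "AE \<omega> in M. (\<lambda>N. \<Sum>n<N. (X \<omega> \<bullet> e n) * (?D \<omega> \<bullet> e n)) \<longlonglongrightarrow> X \<omega> \<bullet> ?D \<omega>"
      using e unfolding sums_def by auto
    show "AE \<omega> in M. norm (\<Sum>n<N. (X \<omega> \<bullet> e n) * (?D \<omega> \<bullet> e n)) \<le> norm (X \<omega>) * norm (?D \<omega>)" for N
      using parseval_partial_bound[OF e] by auto
  qed auto
  moreover have "(\<integral>\<omega>. (\<Sum>n<N. (X \<omega> \<bullet> e n) * (?D \<omega> \<bullet> e n)) \<partial>M) = 0" for N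
    by (subst Bochner_Integration.integral_sum) (simp_all add: i 0)
  ultimately show ?thesis by (simp add: LIMSEQ_const_iff)
qed

text \<open>This is the trace of L Q K*, written by polarisation so that its properties follow from
  those of \<open>q_norm2\<close>.\<close>

definition q_cov :: "('h \<Rightarrow>\<^sub>L 'u::real_inner) \<Rightarrow> ('h \<Rightarrow>\<^sub>L 'u) \<Rightarrow> real" where
  "q_cov L K = (q_norm2 Q (L + K) - q_norm2 Q (L - K)) / 4"

lemma increment_q_cov:
  fixes L K :: "'h \<Rightarrow>\<^sub>L 'u::{real_inner,banach,second_countable_topology}"
  assumes st: "0 \<le> s" "s \<le> t"
  shows "has_bochner_integral M (\<lambda>\<omega>. L (W t \<omega> - W s \<omega>) \<bullet> K (W t \<omega> - W s \<omega>)) ((t - s) * q_cov L K)"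
proof -
  have "has_bochner_integral M (\<lambda>\<omega>. ((norm ((L + K) (W t \<omega> - W s \<omega>)))\<^sup>2
      - (norm ((L - K) (W t \<omega> - W s \<omega>)))\<^sup>2) / 4)
      (((t - s) * q_norm2 Q (L + K) - (t - s) * q_norm2 Q (L - K)) / 4)"
    by (intro has_bochner_integral_divide_zero has_bochner_integral_diff increment_q_norm2 st)
  moreover have "((norm ((L + K) v))\<^sup>2 - (norm ((L - K) v))\<^sup>2) / 4 = L v \<bullet> K v" for v
    by (simp add: power2_norm_eq_inner blinfun.add_left blinfun.diff_left inner_add inner_diff inner_commute)
  ultimately show ?thesis by (simp add: q_cov_def right_diff_distrib)
qed

text \<open>\<open>C\<close> is known at time \<open>s\<close> and the inner product depends on the
  increment only, so the expectation factors.\<close>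

lemma increment_q_cov_indicator:
  fixes L K :: "'h \<Rightarrow>\<^sub>L 'u::{real_inner,banach,second_countable_topology}"
  assumes st: "0 \<le> s" "s \<le> t" and C: "C \<in> sets (F s)"
  shows "(\<integral>\<omega>. indicator C \<omega> * (L (W t \<omega> - W s \<omega>) \<bullet> K (W t \<omega> - W s \<omega>)) \<partial>M)
    = prob C * ((t - s) * q_cov L K)"
proof (cases "s = t")
  case False
  then have lt: "s < t" using st by simp
  have iv: "indep_var borel (indicator C) borel (\<lambda>\<omega>. L (W t \<omega> - W s \<omega>) \<bullet> K (W t \<omega> - W s \<omega>))"
    by (rule indep_increment[OF st(1) lt, of _ "\<lambda>v. L v \<bullet> K v"])
      (use C in \<open>auto intro!: borel_measurable_continuous_onI continuous_intros\<close>)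
  have CM: "C \<in> sets M" by (rule sets_F[OF st(1) C])
  have "(\<integral>\<omega>. indicator C \<omega> * (L (W t \<omega> - W s \<omega>) \<bullet> K (W t \<omega> - W s \<omega>)) \<partial>M)
    = (\<integral>\<omega>. indicator C \<omega> \<partial>M) * (\<integral>\<omega>. L (W t \<omega> - W s \<omega>) \<bullet> K (W t \<omega> - W s \<omega>) \<partial>M)"
    by (rule indep_var_lebesgue_integral[OF iv]) (use CM increment_q_cov[OF st, of L K] in
        \<open>auto simp: has_bochner_integral_iff emeasure_eq_measure\<close>)
  then show ?thesis
    using CM increment_q_cov[OF st, of L K] by (simp add: has_bochner_integral_iff)
qed simp

text \<open>The stochastic integral of the elementary process with value \<open>L\<close> on (a, b]
  times \<open>A\<close>; simple integrals are sums of these.\<close>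

definition restricted_increment ::
    "'w set \<Rightarrow> ('h \<Rightarrow>\<^sub>L 'u::real_normed_vector) \<Rightarrow> real \<Rightarrow> real \<Rightarrow> 'w \<Rightarrow> 'u" where
  "restricted_increment A L a b \<omega> = (if \<omega> \<in> A then L (W b \<omega> - W a \<omega>) else 0)"

lemma restricted_increment_split:
  "restricted_increment A L a b \<omega> = restricted_increment A L a c \<omega> + restricted_increment A L c b \<omega>"
  by (simp add: restricted_increment_def blinfun.diff_right)

lemma restricted_increment_measurable_F:
  fixes L :: "'h \<Rightarrow>\<^sub>L 'u::{real_inner,banach,second_countable_topology}"
  assumes "0 \<le> a" "a \<le> b" "A \<in> sets (F a)" "b \<le> c"
  shows "restricted_increment A L a b \<in> borel_measurable (F c)"
proof -
  have [measurable]: "A \<in> sets (F c)" using assms by (intro sets_F_mono[of a c]) auto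
  have [measurable]: "W a \<in> borel_measurable (F c)" "W b \<in> borel_measurable (F c)"
    using assms by (auto intro!: measurable_F_mono[OF _ _ W_measurable_F])
  show ?thesis
    unfolding restricted_increment_def[abs_def]
    by (intro measurable_If_set borel_measurable_blinfun) measurable
qed

lemma restricted_increment_measurable:
  fixes L :: "'h \<Rightarrow>\<^sub>L 'u::{real_inner,banach,second_countable_topology}"
  assumes "0 \<le> a" "a \<le> b" "A \<in> sets (F a)"
  shows "restricted_increment A L a b \<in> borel_measurable M"
  using restricted_increment_measurable_F[OF assms order_refl, of L] assms
  by (intro measurable_F[of b]) auto

lemma restricted_increment_square_integrable:
  fixes L :: "'h \<Rightarrow>\<^sub>L 'u::{real_inner,banach,second_countable_topology}"
  assumes "0 \<le> a" "a \<le> b" "A \<in> sets (F a)"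
  shows "integrable M (\<lambda>\<omega>. (norm (restricted_increment A L a b \<omega>))\<^sup>2)"
proof (rule Bochner_Integration.integrable_bound)
  show "integrable M (\<lambda>\<omega>. (norm (L (W b \<omega> - W a \<omega>)))\<^sup>2)"
    using increment_q_norm2(1)[OF assms(1,2), of L] by (simp add: has_bochner_integral_iff)
  show "(\<lambda>\<omega>. (norm (restricted_increment A L a b \<omega>))\<^sup>2) \<in> borel_measurable M"
    using restricted_increment_measurable[OF assms, of L] by measurable
qed (auto simp: restricted_increment_def)

lemma restricted_increment_integrable:
  fixes L K :: "'h \<Rightarrow>\<^sub>L 'u::{real_inner,banach,second_countable_topology}"
  assumes "0 \<le> a" "a \<le> b" "A \<in> sets (F a)" "0 \<le> c" "c \<le> d" "B \<in> sets (F c)"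
  shows "integrable M (\<lambda>\<omega>. restricted_increment A L a b \<omega> \<bullet> restricted_increment B K c d \<omega>)"
  by (intro integrable_inner_of_squares restricted_increment_measurable
      restricted_increment_square_integrable assms)

text \<open>Move the indicator of \<open>B\<close> to the earlier factor: the earlier increment, cut
  off to \<open>B\<close>, is still known at time \<open>c\<close>, and the later factor becomes a
  centred function of the increment over [c, d].\<close>

lemma restricted_increment_orthogonal:
  fixes L K :: "'h \<Rightarrow>\<^sub>L 'u::{real_inner,banach,second_countable_topology}"
  assumes "0 \<le> a" "a \<le> b" "b \<le> c" "c \<le> d" "A \<in> sets (F a)" "B \<in> sets (F c)"
  shows "(\<integral>\<omega>. restricted_increment A L a b \<omega> \<bullet> restricted_increment B K c d \<omega> \<partial>M) = 0"
proof -
  have cd: "0 \<le> c" using assms by simp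
  let ?X = "\<lambda>\<omega>. if \<omega> \<in> B then restricted_increment A L a b \<omega> else 0"
  have [measurable]: "B \<in> sets (F c)" by fact
  have [measurable]: "restricted_increment A L a b \<in> borel_measurable (F c)"
    by (rule restricted_increment_measurable_F) (use assms in auto)
  have [measurable]: "restricted_increment A L a b \<in> borel_measurable M" "B \<in> sets M"
    using assms sets_F[OF cd] by (auto intro!: restricted_increment_measurable)
  have "(\<integral>\<omega>. ?X \<omega> \<bullet> K (W d \<omega> - W c \<omega>) \<partial>M) = 0"
  proof (rule increment_orthogonal[OF cd assms(4)])
    show "?X \<in> borel_measurable (F c)" by measurable
    show "integrable M (\<lambda>\<omega>. (norm (?X \<omega>))\<^sup>2)"
    proof (rule Bochner_Integration.integrable_bound)
      show "integrable M (\<lambda>\<omega>. (norm (restricted_increment A L a b \<omega>))\<^sup>2)"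
        by (rule restricted_increment_square_integrable) (use assms in auto)
      show "(\<lambda>\<omega>. (norm (?X \<omega>))\<^sup>2) \<in> borel_measurable M" by measurable
    qed auto
    show "blinfun_apply K \<in> borel_measurable borel"
      by (intro borel_measurable_continuous_onI continuous_intros)
    show "integrable M (\<lambda>\<omega>. (norm (K (W d \<omega> - W c \<omega>)))\<^sup>2)"
      using increment_q_norm2(1)[OF cd assms(4), of K] by (simp add: has_bochner_integral_iff)
    show "(\<integral>\<omega>. K (W d \<omega> - W c \<omega>) \<bullet> u \<partial>M) = 0" for u
      using increment_moments(1)[OF cd assms(4), of "adj K u"]
      unfolding adj_works by (simp add: has_bochner_integral_iff)
  qed
  moreover have "?X \<omega> \<bullet> K (W d \<omega> - W c \<omega>)
      = restricted_increment A L a b \<omega> \<bullet> restricted_increment B K c d \<omega>" for \<omega>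
    by (simp add: restricted_increment_def)
  ultimately show ?thesis by simp
qed

lemma restricted_increment_diagonal:
  fixes L K :: "'h \<Rightarrow>\<^sub>L 'u::{real_inner,banach,second_countable_topology}"
  assumes "0 \<le> c" "c \<le> d" "A \<in> sets (F c)" "B \<in> sets (F c)"
  shows "(\<integral>\<omega>. restricted_increment A L c d \<omega> \<bullet> restricted_increment B K c d \<omega> \<partial>M)
    = prob (A \<inter> B) * ((d - c) * q_cov L K)"
proof -
  have "restricted_increment A L c d \<omega> \<bullet> restricted_increment B K c d \<omega>
     = indicator (A \<inter> B) \<omega> * (L (W d \<omega> - W c \<omega>) \<bullet> K (W d \<omega> - W c \<omega>))" for \<omega>
    by (simp add: restricted_increment_def indicator_def)
  then show ?thesis
    using increment_q_cov_indicator[OF assms(1,2), of "A \<inter> B" L K] assms by simp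
qed

text \<open>Cut the two intervals at each other's end points. Pieces over disjoint intervals are
  orthogonal, and the common piece contributes its length. The sets remain admissible, since no
  piece starts before the interval it comes from.\<close>

lemma restricted_increment_cov_ordered:
  fixes L K :: "'h \<Rightarrow>\<^sub>L 'u::{real_inner,banach,second_countable_topology}"
  assumes a: "0 \<le> a" "a \<le> b" "A \<in> sets (F a)" and c: "c \<le> d" "B \<in> sets (F c)" and ac: "a \<le> c"
  shows "(\<integral>\<omega>. restricted_increment A L a b \<omega> \<bullet> restricted_increment B K c d \<omega> \<partial>M)
    = prob (A \<inter> B) * (max 0 (min b d - c) * q_cov L K)"
proof (cases "b \<le> c")
  case True
  then show ?thesis using restricted_increment_orthogonal[of a b c d A B L K] assms by simp
next
  case False
  have Ac: "A \<in> sets (F r)" if "c \<le> r" for r using sets_F_mono[of a r A] assms that by simp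
  have Bc: "B \<in> sets (F r)" if "c \<le> r" for r using sets_F_mono[of c r B] assms that by simp
  let ?J = "restricted_increment A L" and ?K = "restricted_increment B K"
  have "(\<integral>\<omega>. ?J a b \<omega> \<bullet> ?K c d \<omega> \<partial>M) = (\<integral>\<omega>. ?J a c \<omega> \<bullet> ?K c d \<omega> + ?J c b \<omega> \<bullet> ?K c d \<omega> \<partial>M)"
    using restricted_increment_split[of A L a b _ c] by (simp add: inner_add_left)
  also have "\<dots> = (\<integral>\<omega>. ?J a c \<omega> \<bullet> ?K c d \<omega> \<partial>M) + (\<integral>\<omega>. ?J c b \<omega> \<bullet> ?K c d \<omega> \<partial>M)"
    using assms False by (intro Bochner_Integration.integral_add restricted_increment_integrable) (auto intro: Ac)
  also have "(\<integral>\<omega>. ?J a c \<omega> \<bullet> ?K c d \<omega> \<partial>M) = 0"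
    using assms by (intro restricted_increment_orthogonal) auto
  also have "(\<integral>\<omega>. ?J c b \<omega> \<bullet> ?K c d \<omega> \<partial>M) = prob (A \<inter> B) * ((min b d - c) * q_cov L K)"
  proof (cases "b \<le> d")
    case True
    have "(\<integral>\<omega>. ?J c b \<omega> \<bullet> ?K c d \<omega> \<partial>M) = (\<integral>\<omega>. ?J c b \<omega> \<bullet> ?K c b \<omega> + ?J c b \<omega> \<bullet> ?K b d \<omega> \<partial>M)"
      using restricted_increment_split[of B K c d _ b] by (simp add: inner_add_right)
    also have "\<dots> = (\<integral>\<omega>. ?J c b \<omega> \<bullet> ?K c b \<omega> \<partial>M) + (\<integral>\<omega>. ?J c b \<omega> \<bullet> ?K b d \<omega> \<partial>M)"
      using assms False True
      by (intro Bochner_Integration.integral_add restricted_increment_integrable) (auto intro: Ac Bc)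
    also have "(\<integral>\<omega>. ?J c b \<omega> \<bullet> ?K b d \<omega> \<partial>M) = 0"
      using assms False True by (intro restricted_increment_orthogonal) (auto intro: Ac Bc)
    also have "(\<integral>\<omega>. ?J c b \<omega> \<bullet> ?K c b \<omega> \<partial>M) = prob (A \<inter> B) * ((b - c) * q_cov L K)"
      using assms False by (intro restricted_increment_diagonal) (auto intro: Ac Bc)
    finally show ?thesis using True by simp
  next
    case bd: False
    have "(\<integral>\<omega>. ?J c b \<omega> \<bullet> ?K c d \<omega> \<partial>M) = (\<integral>\<omega>. ?J c d \<omega> \<bullet> ?K c d \<omega> + ?K c d \<omega> \<bullet> ?J d b \<omega> \<partial>M)"
      using restricted_increment_split[of A L c b _ d]
      by (intro Bochner_Integration.integral_cong) (simp_all add: inner_add_left inner_add_right inner_commute)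
    also have "\<dots> = (\<integral>\<omega>. ?J c d \<omega> \<bullet> ?K c d \<omega> \<partial>M) + (\<integral>\<omega>. ?K c d \<omega> \<bullet> ?J d b \<omega> \<partial>M)"
      using assms False bd
      by (intro Bochner_Integration.integral_add restricted_increment_integrable) (auto intro: Ac Bc)
    also have "(\<integral>\<omega>. ?K c d \<omega> \<bullet> ?J d b \<omega> \<partial>M) = 0"
      using assms False bd by (intro restricted_increment_orthogonal) (auto intro: Ac Bc)
    also have "(\<integral>\<omega>. ?J c d \<omega> \<bullet> ?K c d \<omega> \<partial>M) = prob (A \<inter> B) * ((d - c) * q_cov L K)"
      using assms False by (intro restricted_increment_diagonal) (auto intro: Ac Bc)
    finally show ?thesis using bd by simp
  qed
  finally show ?thesis using False assms by (simp add: max_def)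
qed

text \<open>Both are the same expectation over the increment on [0, 1].\<close>

lemma q_cov_commute:
  fixes L K :: "'h \<Rightarrow>\<^sub>L 'u::{real_inner,banach,second_countable_topology}"
  shows "q_cov L K = q_cov K L"
  using increment_q_cov[of 0 1 L K] increment_q_cov[of 0 1 K L]
  by (simp add: inner_commute has_bochner_integral_eq)

lemma restricted_increment_cov:
  fixes L K :: "'h \<Rightarrow>\<^sub>L 'u::{real_inner,banach,second_countable_topology}"
  assumes a: "0 \<le> a" "a \<le> b" "A \<in> sets (F a)" and c: "0 \<le> c" "c \<le> d" "B \<in> sets (F c)"
  shows "(\<integral>\<omega>. restricted_increment A L a b \<omega> \<bullet> restricted_increment B K c d \<omega> \<partial>M)
    = prob (A \<inter> B) * (max 0 (min b d - max a c) * q_cov L K)"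
proof (cases "a \<le> c")
  case True
  then show ?thesis using restricted_increment_cov_ordered[of a b A c d B L K] assms by (simp add: max_def)
next
  case False
  then show ?thesis
    using restricted_increment_cov_ordered[of c d B a b A K L] assms
    by (simp add: max_absorb1 inner_commute Int_commute min.commute q_cov_commute)
qed

text \<open>If t < a, the set \<open>A\<close> need not lie in \<open>F t\<close>, so the covariance
  formula cannot be applied to the stopped interval; but that interval has shrunk to the point t and
  its increment is 0.\<close>

lemma restricted_increment_stopped_cov:
  fixes L K :: "'h \<Rightarrow>\<^sub>L 'u::{real_inner,banach,second_countable_topology}"
  assumes a: "0 \<le> a" "a \<le> b" "A \<in> sets (F a)" and c: "0 \<le> c" "c \<le> d" "B \<in> sets (F c)" and t: "0 \<le> t"
  shows "has_bochner_integral M (\<lambda>\<omega>. restricted_increment A L (min a t) (min b t) \<omega>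
      \<bullet> restricted_increment B K (min c t) (min d t) \<omega>)
    (prob (A \<inter> B) * (max 0 (min (min b t) (min d t) - max (min a t) (min c t)) * q_cov L K))"
proof (cases "a \<le> t \<and> c \<le> t")
  case True
  then show ?thesis
    using assms by (auto simp: has_bochner_integral_iff restricted_increment_cov
        restricted_increment_integrable)
next
  case False
  then have "restricted_increment A L (min a t) (min b t) \<omega>
      \<bullet> restricted_increment B K (min c t) (min d t) \<omega> = 0" for \<omega>
    using a(2) c(2) by (auto simp: restricted_increment_def)
  moreover have "max 0 (min (min b t) (min d t) - max (min a t) (min c t)) = 0"
    using False by (auto simp: max_def min_def)
  ultimately show ?thesis by (simp add: has_bochner_integral_zero)
qed

text \<open>Over the increment on [0, 1] both sides are expectations, and the identity reduces to
  expanding a squared norm.\<close>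

lemma q_norm2_sum:
  fixes L :: "nat \<Rightarrow> 'h \<Rightarrow>\<^sub>L 'u::{real_inner,banach,second_countable_topology}"
  shows "q_norm2 Q (\<Sum>i<n. c i *\<^sub>R L i) = (\<Sum>i<n. \<Sum>j<n. c i * c j * q_cov (L i) (L j))"
proof -
  have "has_bochner_integral M (\<lambda>\<omega>. \<Sum>i<n. \<Sum>j<n. c i * c j * (L i (W 1 \<omega> - W 0 \<omega>) \<bullet> L j (W 1 \<omega> - W 0 \<omega>)))
      (\<Sum>i<n. \<Sum>j<n. c i * c j * ((1 - 0) * q_cov (L i) (L j)))"
    by (intro has_bochner_integral_sum has_bochner_integral_mult_right increment_q_cov) auto
  moreover have "(\<Sum>i<n. \<Sum>j<n. c i * c j * (L i v \<bullet> L j v)) = (norm ((\<Sum>i<n. c i *\<^sub>R L i) v))\<^sup>2" for v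
    by (simp add: power2_norm_eq_inner blinfun.sum_left blinfun.scaleR_left inner_sum_left inner_sum_right
        mult.assoc sum_distrib_left) (subst sum.swap, simp add: mult.left_commute inner_commute)
  ultimately show ?thesis
    using increment_q_norm2(1)[of 0 1 "\<Sum>i<n. c i *\<^sub>R L i"]
    by (simp add: has_bochner_integral_eq)
qed

section \<open>The Ito isometry for simple processes\<close>

lemma simple_process_eq_sum:
  "simple_process xs s \<omega> = (\<Sum>i<length xs. case xs ! i of (a, b, A, L) \<Rightarrow>
     (indicator {a<..b} s * indicator A \<omega>) *\<^sub>R L)"
  unfolding simple_process_def
  by (subst sum_list_sum_nth) (auto intro!: sum.cong simp: atLeast0LessThan indicator_def split: prod.split)

lemma simple_integral_eq_sum:
  "simple_integral W xs t \<omega> = (\<Sum>i<length xs. case xs ! i of (a, b, A, L) \<Rightarrow>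
     restricted_increment A L (min a t) (min b t) \<omega>)"
  unfolding simple_integral_def restricted_increment_def
  by (subst sum_list_sum_nth) (auto intro!: sum.cong simp: atLeast0LessThan split: prod.split)

lemma simple_integral_measurable:
  fixes xs :: "('w, 'h, 'u::{real_inner,banach,second_countable_topology}) simple"
  assumes "simple_adapted F xs" "0 \<le> t"
  shows "simple_integral W xs t \<in> borel_measurable M"
proof -
  have "restricted_increment A L (min a t) (min b t) \<in> borel_measurable M" if "(a, b, A, L) \<in> set xs" for a b A L
  proof (cases "a \<le> t")
    case True
    then show ?thesis using assms that
      by (intro restricted_increment_measurable) (auto simp: simple_adapted_def)
  next
    case False
    then have "restricted_increment A L (min a t) (min b t) = (\<lambda>_. 0)"
      using assms that by (auto simp: restricted_increment_def simple_adapted_def fun_eq_iff)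
    then show ?thesis by simp
  qed
  then show ?thesis
    unfolding simple_integral_eq_sum[abs_def]
    by (intro borel_measurable_sum) (auto split: prod.split dest!: nth_mem)
qed

text \<open>The tuples of the list may overlap in time and in \<omega>, so neither side is a plain
  sum of squares. Both are expanded over pairs of tuples and equal S, to which a pair contributes
  the probability of \<open>A i \<inter> A j\<close>, the length \<open>ov i j\<close> of the common
  time up to t, and the covariance of its operators.\<close>

lemma simple_integral_isometry:
  fixes xs :: "('w, 'h, 'u::{real_inner,banach,second_countable_topology}) simple"
  assumes xs: "simple_adapted F xs" and t: "0 \<le> t"
  shows "(\<integral>\<^sup>+\<omega>. ennreal ((norm (simple_integral W xs t \<omega>))\<^sup>2) \<partial>M)
    = (\<integral>\<^sup>+\<omega>. (\<integral>\<^sup>+s\<in>{0..t}. ennreal (q_norm2 Q (simple_process xs s \<omega>)) \<partial>lborel) \<partial>M)"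
proof -
  define n where "n = length xs"
  obtain a b A L where x: "xs ! i = (a i, b i, A i, L i)" for i
    using that[of "\<lambda>i. fst (xs ! i)" "\<lambda>i. fst (snd (xs ! i))" "\<lambda>i. fst (snd (snd (xs ! i)))"
      "\<lambda>i. snd (snd (snd (xs ! i)))"] by simp
  have ad: "0 \<le> a i" "a i \<le> b i" "A i \<in> sets (F (a i))" if "i < n" for i
    using nth_mem[of i xs] that xs x[of i] by (auto simp: simple_adapted_def n_def)
  define ov where "ov i j = max 0 (min (min (b i) t) (min (b j) t) - max (min (a i) t) (min (a j) t))" for i j
  define S where "S = (\<Sum>i<n. \<Sum>j<n. prob (A i \<inter> A j) * (ov i j * q_cov (L i) (L j)))"
  let ?J = "\<lambda>i. restricted_increment (A i) (L i) (min (a i) t) (min (b i) t)"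
  let ?c = "\<lambda>\<omega> s i. indicator {a i<..b i} s * indicator (A i) \<omega> :: real"
  have sq: "(norm (simple_integral W xs t \<omega>))\<^sup>2 = (\<Sum>i<n. \<Sum>j<n. ?J i \<omega> \<bullet> ?J j \<omega>)" for \<omega>
    by (simp add: simple_integral_eq_sum x power2_norm_eq_inner inner_sum_left inner_sum_right n_def)
      (rule sum.swap)
  have lhs: "has_bochner_integral M (\<lambda>\<omega>. (norm (simple_integral W xs t \<omega>))\<^sup>2) S"
    unfolding sq S_def ov_def
    by (intro has_bochner_integral_sum restricted_increment_stopped_cov ad t) auto
  let ?G = "\<lambda>\<omega>. \<Sum>i<n. \<Sum>j<n. indicator (A i \<inter> A j) \<omega> * (ov i j * q_cov (L i) (L j))"
  \<comment> \<open>For fixed \<omega> the time integral is a finite sum of lengths; the expectation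
    then only turns the indicator of \<open>A i \<inter> A j\<close> into its probability.\<close>
  have inner: "(\<integral>\<^sup>+s\<in>{0..t}. ennreal (q_norm2 Q (simple_process xs s \<omega>)) \<partial>lborel) = ennreal (?G \<omega>) \<and> 0 \<le> ?G \<omega>" for \<omega>
  proof -
    have q: "q_norm2 Q (simple_process xs s \<omega>) = (\<Sum>i<n. \<Sum>j<n. ?c \<omega> s i * ?c \<omega> s j * q_cov (L i) (L j))" for s
      using q_norm2_sum[where n=n and c="\<lambda>i. ?c \<omega> s i" and L=L] by (simp add: simple_process_eq_sum x n_def)
    have ov: "has_bochner_integral lborel (\<lambda>s. indicator {0..t} s * (indicator {a i<..b i} s * indicator {a j<..b j} s)) (ov i j)"
      if "i < n" "j < n" for i j
    proof -
      define l where "l = max (a i) (a j)"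
      define u where "u = min t (min (b i) (b j))"
      have eq: "indicator {0..t} s * (indicator {a i<..b i} s * indicator {a j<..b j} s) = (indicator {l<..u} s :: real)" for s
        using ad[of i] ad[of j] that by (auto simp: indicator_def l_def u_def)
      have "has_bochner_integral lborel (indicator {l<..u}) (measure lborel {l<..u})"
        by (rule has_bochner_integral_real_indicator, simp) (cases "l \<le> u"; simp)
      moreover have "measure lborel {l<..u} = max 0 (u - l)" by (cases "l \<le> u") (simp_all add: max_def)
      moreover have "max 0 (u - l) = ov i j" by (auto simp: ov_def l_def u_def max_def min_def)
      ultimately show ?thesis unfolding eq by simp
    qed
    have "has_bochner_integral lborel (\<lambda>s. \<Sum>i<n. \<Sum>j<n. indicator (A i \<inter> A j) \<omega> *
        ((indicator {0..t} s * (indicator {a i<..b i} s * indicator {a j<..b j} s)) * q_cov (L i) (L j))) (?G \<omega>)"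
      by (intro has_bochner_integral_sum has_bochner_integral_mult_right has_bochner_integral_mult_left ov) auto
    also have "(\<lambda>s. \<Sum>i<n. \<Sum>j<n. indicator (A i \<inter> A j) \<omega> *
        ((indicator {0..t} s * (indicator {a i<..b i} s * indicator {a j<..b j} s)) * q_cov (L i) (L j)))
      = (\<lambda>s. indicator {0..t} s * q_norm2 Q (simple_process xs s \<omega>))"
      unfolding q sum_distrib_left indicator_inter_arith by (simp add: mult_ac)
    finally have h: "has_bochner_integral lborel (\<lambda>s. indicator {0..t} s * q_norm2 Q (simple_process xs s \<omega>)) (?G \<omega>)" .
    have nn: "0 \<le> indicator {0..t} s * q_norm2 Q (simple_process xs s \<omega>)" for s
      using increment_q_norm2(2)[of 0 0 "simple_process xs s \<omega>"] by (auto simp: indicator_def)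
    have "(\<integral>\<^sup>+s. ennreal (indicator {0..t} s * q_norm2 Q (simple_process xs s \<omega>)) \<partial>lborel) = ennreal (?G \<omega>)"
      using h nn by (subst nn_integral_eq_integral) (auto simp: has_bochner_integral_iff)
    moreover have "0 \<le> ?G \<omega>"
      using h nn Bochner_Integration.integral_nonneg[of lborel "\<lambda>s. indicator {0..t} s * q_norm2 Q (simple_process xs s \<omega>)"]
      by (auto simp: has_bochner_integral_iff)
    ultimately show ?thesis by (simp add: ennreal_mult' ennreal_indicator mult.commute)
  qed
  have AM: "A i \<in> sets M" if "i < n" for i using ad[OF that] by (intro sets_F[of "a i"]) auto
  have rhs: "has_bochner_integral M ?G S"
    unfolding S_def
    by (intro has_bochner_integral_sum has_bochner_integral_mult_left has_bochner_integral_real_indicator)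
      (auto intro!: sets.Int AM simp: emeasure_eq_measure)
  have "(\<integral>\<^sup>+\<omega>. ennreal ((norm (simple_integral W xs t \<omega>))\<^sup>2) \<partial>M) = ennreal S"
    using lhs by (subst nn_integral_eq_integral) (auto simp: has_bochner_integral_iff)
  also have "\<dots> = (\<integral>\<^sup>+\<omega>. ennreal (?G \<omega>) \<partial>M)"
    using rhs inner by (subst nn_integral_eq_integral) (auto simp: has_bochner_integral_iff)
  finally show ?thesis using inner by simp
qed

text \<open>By the isometry, the simple integrals that approximate \<open>Z\<close> also converge to \<open>\<eta> W(t)\<close>.\<close>

lemma stoch_integral_const:
  fixes \<eta> :: "'h \<Rightarrow>\<^sub>L 'u::{real_inner,banach,second_countable_topology}"
  assumes Z: "has_stoch_integral M F Q W (\<lambda>s \<omega>. \<eta>) t Z" and t: "0 \<le> t"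
  shows "AE \<omega> in M. Z \<omega> = \<eta> (W t \<omega>)"
proof -
  obtain xs where xs: "\<And>n::nat. simple_adapted F (xs n)"
    and q: "(\<lambda>n. \<integral>\<^sup>+\<omega>. (\<integral>\<^sup>+s\<in>{0..t}. ennreal (q_norm2 Q (simple_process (xs n) s \<omega> - \<eta>)) \<partial>lborel) \<partial>M) \<longlonglongrightarrow> 0"
    and lim: "(\<lambda>n. \<integral>\<^sup>+\<omega>. ennreal ((norm (simple_integral W (xs n) t \<omega> - Z \<omega>))\<^sup>2) \<partial>M) \<longlonglongrightarrow> 0"
    and [measurable]: "Z \<in> borel_measurable M"
    using Z unfolding has_stoch_integral_def by blast
  let ?S = "\<lambda>n. simple_integral W (xs n) t" and ?D = "\<lambda>\<omega>. \<eta> (W t \<omega> - W 0 \<omega>)"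
  have [measurable]: "?S n \<in> borel_measurable M" for n by (rule simple_integral_measurable[OF xs t])
  have [measurable]: "?D \<in> borel_measurable M"
    by (intro borel_measurable_blinfun increment_measurable t) simp
  have iso: "(\<integral>\<^sup>+\<omega>. ennreal ((norm (?S n \<omega> - ?D \<omega>))\<^sup>2) \<partial>M)
      = (\<integral>\<^sup>+\<omega>. (\<integral>\<^sup>+s\<in>{0..t}. ennreal (q_norm2 Q (simple_process (xs n) s \<omega> - \<eta>)) \<partial>lborel) \<partial>M)" for n
  proof -
    \<comment> \<open>Prepending -\<eta> on (0, t] makes the difference itself a simple process, to
      which the isometry applies.\<close>
    let ?ys = "(0, t, space M, - \<eta>) # xs n"
    have "simple_adapted F ?ys"
      using xs t sets.top[of "F 0"] by (auto simp: simple_adapted_def space_F)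
    from simple_integral_isometry[OF this t]
    have "(\<integral>\<^sup>+\<omega>. ennreal ((norm (simple_integral W ?ys t \<omega>))\<^sup>2) \<partial>M)
      = (\<integral>\<^sup>+\<omega>. (\<integral>\<^sup>+s\<in>{0..t}. ennreal (q_norm2 Q (simple_process ?ys s \<omega>)) \<partial>lborel) \<partial>M)" .
    moreover have "(\<integral>\<^sup>+\<omega>. ennreal ((norm (simple_integral W ?ys t \<omega>))\<^sup>2) \<partial>M)
       = (\<integral>\<^sup>+\<omega>. ennreal ((norm (?S n \<omega> - ?D \<omega>))\<^sup>2) \<partial>M)"
      using t by (intro nn_integral_cong) (simp add: simple_integral_def blinfun.minus_left)
    moreover have "(\<integral>\<^sup>+\<omega>. (\<integral>\<^sup>+s\<in>{0..t}. ennreal (q_norm2 Q (simple_process ?ys s \<omega>)) \<partial>lborel) \<partial>M)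
       = (\<integral>\<^sup>+\<omega>. (\<integral>\<^sup>+s\<in>{0..t}. ennreal (q_norm2 Q (simple_process (xs n) s \<omega> - \<eta>)) \<partial>lborel) \<partial>M)"
    proof (rule nn_integral_cong, rule nn_integral_cong_AE)
      fix \<omega> assume \<omega>: "\<omega> \<in> space M"
      \<comment> \<open>The interval of a tuple is open on the left, so the added term is absent at
        s = 0, a null set.\<close>
      show "AE s in lborel.
ennreal (q_norm2 Q (simple_process ?ys s \<omega>)) * indicator {0..t} s
          = ennreal (q_norm2 Q (simple_process (xs n) s \<omega> - \<eta>)) * indicator {0..t} s"
        using AE_lborel_singleton[of 0]
        by eventually_elim (use \<omega> in \<open>auto simp: simple_process_def indicator_def\<close>)
    qed
    ultimately show ?thesis by simp
  qed
  have "(\<integral>\<^sup>+\<omega>. ennreal ((norm (Z \<omega> - ?D \<omega>))\<^sup>2) \<partial>M) \<le>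
    2 * (\<integral>\<^sup>+\<omega>. ennreal ((norm (?S n \<omega> - Z \<omega>))\<^sup>2) \<partial>M) + 2 * (\<integral>\<^sup>+\<omega>. ennreal ((norm (?S n \<omega> - ?D \<omega>))\<^sup>2) \<partial>M)" for n
  proof -
    have "(norm (Z \<omega> - ?D \<omega>))\<^sup>2 \<le> 2 * (norm (?S n \<omega> - Z \<omega>))\<^sup>2 + 2 * (norm (?S n \<omega> - ?D \<omega>))\<^sup>2" for \<omega>
    proof -
      have "norm (Z \<omega> - ?D \<omega>) \<le> norm (?S n \<omega> - Z \<omega>) + norm (?S n \<omega> - ?D \<omega>)"
        using norm_triangle_ineq4[of "?S n \<omega> - ?D \<omega>" "?S n \<omega> - Z \<omega>"] by simp
      then have "(norm (Z \<omega> - ?D \<omega>))\<^sup>2 \<le> (norm (?S n \<omega> - Z \<omega>) + norm (?S n \<omega> - ?D \<omega>))\<^sup>2"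
        by (intro power_mono) auto
      also note sum2_le
      finally show ?thesis by (simp only: distrib_left)
    qed
    then have "(\<integral>\<^sup>+\<omega>. ennreal ((norm (Z \<omega> - ?D \<omega>))\<^sup>2) \<partial>M) \<le>
      (\<integral>\<^sup>+\<omega>. 2 * ennreal ((norm (?S n \<omega> - Z \<omega>))\<^sup>2) + 2 * ennreal ((norm (?S n \<omega> - ?D \<omega>))\<^sup>2) \<partial>M)"
      by (intro nn_integral_mono) (simp add: ennreal_leI flip: ennreal_plus ennreal_mult' ennreal_numeral)
    then show ?thesis by (simp add: nn_integral_add nn_integral_cmult)
  qed
  moreover have "(\<lambda>n. 2 * (\<integral>\<^sup>+\<omega>. ennreal ((norm (?S n \<omega> - Z \<omega>))\<^sup>2) \<partial>M)
      + 2 * (\<integral>\<^sup>+\<omega>. ennreal ((norm (?S n \<omega> - ?D \<omega>))\<^sup>2) \<partial>M)) \<longlonglongrightarrow> 2 * 0 + 2 * 0"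
    unfolding iso by (intro tendsto_add ennreal_tendsto_cmult q lim) simp_all
  ultimately have "(\<integral>\<^sup>+\<omega>. ennreal ((norm (Z \<omega> - ?D \<omega>))\<^sup>2) \<partial>M) \<le> 2 * 0 + 2 * 0"
    by (intro LIMSEQ_le_const[of _ "2 * 0 + 2 * 0"]) auto
  then have "AE \<omega> in M. ennreal ((norm (Z \<omega> - ?D \<omega>))\<^sup>2) = 0"
    by (subst nn_integral_0_iff_AE[symmetric]) auto
  with W_0 show ?thesis by eventually_elim auto
qed

end

subsection \<open>Pathwise estimates\<close>

text \<open>The integral of (f - c)^2 is nonnegative for each c; the inequality is the case of the
  minimising c, the average of f.\<close>

lemma (in finite_measure) integral_power2_le:
  fixes f :: "'a \<Rightarrow> real"
  assumes [measurable]: "f \<in> borel_measurable M" and f2: "integrable M (\<lambda>x. (f x)\<^sup>2)"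
  shows "integrable M f" "(\<integral>x. f x \<partial>M)\<^sup>2 \<le> measure M (space M) * (\<integral>x. (f x)\<^sup>2 \<partial>M)"
proof -
  show f: "integrable M f"
  proof (rule Bochner_Integration.integrable_bound)
    show "integrable M (\<lambda>x. 1 + (f x)\<^sup>2)" using f2 by simp
    have "\<bar>f x\<bar> \<le> 1 + (f x)\<^sup>2" for x
      using sum_squares_bound[of 1 "\<bar>f x\<bar>"] by simp
    then show "AE x in M. norm (f x) \<le> norm (1 + (f x)\<^sup>2)" by auto
  qed simp
  let ?m = "measure M (space M)" and ?I = "\<integral>x. f x \<partial>M" and ?J = "\<integral>x. (f x)\<^sup>2 \<partial>M"
  have pos: "0 \<le> ?J - 2 * c * ?I + c\<^sup>2 * ?m" for c
  proof -
    have "0 \<le> (\<integral>x. (f x - c)\<^sup>2 \<partial>M)" by simp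
    also have "(\<lambda>x. (f x - c)\<^sup>2) = (\<lambda>x. (f x)\<^sup>2 - 2 * c * f x + c\<^sup>2)"
      by (simp add: power2_eq_square algebra_simps fun_eq_iff)
    also have "(\<integral>x. (f x)\<^sup>2 - 2 * c * f x + c\<^sup>2 \<partial>M) = ?J - 2 * c * ?I + c\<^sup>2 * ?m"
      using f f2 by simp
    finally show ?thesis .
  qed
  show "?I\<^sup>2 \<le> ?m * ?J"
  proof (cases "?m = 0")
    case True
    then have "emeasure M (space M) = 0" by (simp add: emeasure_eq_measure)
    then have "AE x in M. f x = 0" by (intro AE_I[of _ _ "space M"]) auto
    then have "?I = 0" by (rule integral_eq_zero_AE)
    then show ?thesis using True by simp
  next
    case False
    then have m: "0 < ?m" using measure_nonneg[of M "space M"] by linarith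
    show ?thesis using pos[of "?I / ?m"] m by (simp add: field_simps power2_eq_square)
  qed
qed

text \<open>The preceding inequality twice, for f and for its square.\<close>

lemma (in finite_measure) integral_power4_le:
  fixes f :: "'a \<Rightarrow> real"
  assumes [measurable]: "f \<in> borel_measurable M" and f4: "integrable M (\<lambda>x. f x ^ 4)"
  shows "integrable M f" "integrable M (\<lambda>x. (f x)\<^sup>2)"
    and "(\<integral>x. f x \<partial>M) ^ 4 \<le> measure M (space M) ^ 3 * (\<integral>x. f x ^ 4 \<partial>M)"
proof -
  have e: "((f x)\<^sup>2)\<^sup>2 = f x ^ 4" for x by (simp flip: power_mult)
  show f2: "integrable M (\<lambda>x. (f x)\<^sup>2)"
    by (rule integral_power2_le(1)) (use f4 e in simp_all)
  show "integrable M f" by (rule integral_power2_le(1)[OF _ f2]) simp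
  let ?m = "measure M (space M)"
  have "(\<integral>x. f x \<partial>M) ^ 4 = ((\<integral>x. f x \<partial>M)\<^sup>2)\<^sup>2" by (simp flip: power_mult)
  also have "\<dots> \<le> (?m * (\<integral>x. (f x)\<^sup>2 \<partial>M))\<^sup>2"
    by (intro power_mono integral_power2_le(2)[OF _ f2]) auto
  also have "\<dots> = ?m\<^sup>2 * (\<integral>x. (f x)\<^sup>2 \<partial>M)\<^sup>2" by (simp add: power_mult_distrib)
  also have "\<dots> \<le> ?m\<^sup>2 * (?m * (\<integral>x. ((f x)\<^sup>2)\<^sup>2 \<partial>M))"
    by (intro mult_left_mono integral_power2_le(2)) (use f4 e in simp_all)
  also have "\<dots> = ?m ^ 3 * (\<integral>x. f x ^ 4 \<partial>M)"
    unfolding e by (simp add: power2_eq_square power3_eq_cube)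
  finally show "(\<integral>x. f x \<partial>M) ^ 4 \<le> ?m ^ 3 * (\<integral>x. f x ^ 4 \<partial>M)" .
qed

interpretation tensor: bounded_bilinear "hs_tensor :: 'a::{real_inner,banach} \<Rightarrow> 'a \<Rightarrow> 'a hs"
  by (rule bounded_bilinear_hs_tensor)

lemma borel_measurable_hs_tensor [measurable (raw)]:
  fixes g h :: "'b \<Rightarrow> 'a::{real_inner,banach,second_countable_topology}"
  assumes "g \<in> borel_measurable M" "h \<in> borel_measurable M"
  shows "(\<lambda>x. g x \<otimes> h x) \<in> borel_measurable M"
  using assms by (rule borel_measurable_continuous_Pair)
    (intro tensor.continuous_on continuous_intros)

text \<open>On a time interval of length m this bounds the drift part of an increment: its fourth
  power gains the factor m^3.\<close>

lemma (in finite_measure) norm4_integral_blinfun_le: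
  fixes A :: "'h::{real_inner,banach,second_countable_topology} \<Rightarrow>\<^sub>L 'h"
  assumes [measurable]: "y \<in> borel_measurable M" and y4: "integrable M (\<lambda>u. norm (y u) ^ 4)"
  shows "integrable M (\<lambda>u. A (y u))"
    and "norm (\<integral>u. A (y u) \<partial>M) ^ 4
      \<le> norm A ^ 4 * (measure M (space M) ^ 3 * (\<integral>u. norm (y u) ^ 4 \<partial>M))"
proof -
  have [measurable]: "(\<lambda>u. A (y u)) \<in> borel_measurable M"
    by (rule borel_measurable_continuous_on[of "blinfun_apply A"]) (auto intro!: continuous_intros)
  have y1: "integrable M (\<lambda>u. norm (y u))"
    by (rule integral_power4_le[OF _ y4]) simp
  show Ay: "integrable M (\<lambda>u. A (y u))"
    by (rule Bochner_Integration.integrable_bound[OF integrable_mult_right[OF y1, of "norm A"]])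
      (auto intro!: AE_I2 norm_blinfun)
  have "norm (\<integral>u. A (y u) \<partial>M) \<le> (\<integral>u. norm (A (y u)) \<partial>M)" by (rule integral_norm_bound)
  also have "\<dots> \<le> (\<integral>u. norm A * norm (y u) \<partial>M)"
    using Ay y1 by (intro integral_mono norm_blinfun) auto
  also have "\<dots> = norm A * (\<integral>u. norm (y u) \<partial>M)" by simp
  finally have "norm (\<integral>u. A (y u) \<partial>M) ^ 4 \<le> (norm A * (\<integral>u. norm (y u) \<partial>M)) ^ 4"
    by (intro power_mono) auto
  also have "\<dots> = norm A ^ 4 * (\<integral>u. norm (y u) \<partial>M) ^ 4" by (simp add: power_mult_distrib)
  also have "\<dots> \<le> norm A ^ 4 * (measure M (space M) ^ 3 * (\<integral>u. norm (y u) ^ 4 \<partial>M))"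
    by (intro mult_left_mono integral_power4_le[OF _ y4]) auto
  finally show "norm (\<integral>u. A (y u) \<partial>M) ^ 4
      \<le> norm A ^ 4 * (measure M (space M) ^ 3 * (\<integral>u. norm (y u) ^ 4 \<partial>M))" .
qed

lemma (in finite_measure) symmetrized_tensor_integrable:
  fixes A :: "'h::{real_inner,banach,second_countable_topology} \<Rightarrow>\<^sub>L 'h"
  assumes [measurable]: "y \<in> borel_measurable M" and y4: "integrable M (\<lambda>u. norm (y u) ^ 4)"
  shows "integrable M (\<lambda>u. A (y u) \<otimes> y u + y u \<otimes> A (y u))"
proof -
  have [measurable]: "(\<lambda>u. A (y u)) \<in> borel_measurable M"
    by (rule borel_measurable_continuous_on[of "blinfun_apply A"]) (auto intro!: continuous_intros)
  have y2: "integrable M (\<lambda>u. (norm (y u))\<^sup>2)"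
    by (rule integral_power4_le[OF _ y4]) simp
  show ?thesis
  proof (rule Bochner_Integration.integrable_bound)
    show "integrable M (\<lambda>u. 2 * (norm A * (norm (y u))\<^sup>2))" using y2 by simp
    have "norm (A (y u) \<otimes> y u + y u \<otimes> A (y u)) \<le> 2 * (norm A * (norm (y u))\<^sup>2)" for u
    proof -
      have "norm (A (y u) \<otimes> y u + y u \<otimes> A (y u)) \<le> 2 * (norm (A (y u)) * norm (y u))"
        by (rule norm_triangle_le) (simp add: norm_hs_tensor mult.commute)
      also have "\<dots> \<le> 2 * (norm A * norm (y u) * norm (y u))"
        by (intro mult_left_mono mult_right_mono norm_blinfun) auto
      finally show ?thesis by (simp add: power2_eq_square mult.assoc)
    qed
    then show "AE u in M. norm (A (y u) \<otimes> y u + y u \<otimes> A (y u)) \<le> norm (2 * (norm A * (norm (y u))\<^sup>2))"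
      by (auto intro: order_trans[OF _ abs_ge_self])
  qed simp
qed

text \<open>In the application the measure is Lebesgue measure on a cell of length m, c = Y(r), G is
  the drift increment and w the noise increment. Expanding the product leaves three errors: G
  \<otimes> G, the mixed terms of G and w, and the replacement of y by c in the drift. The weights m
  are chosen so that each term on the right is O(m^3) in expectation: the integral of |y|^4 is O(m),
  that of |y - c|^4 is O(m^3), and |w|^4 is O(m^2).\<close>

lemma (in finite_measure) product_remainder_bound:
  fixes A :: "'h::{real_inner,banach,second_countable_topology} \<Rightarrow>\<^sub>L 'h"
  assumes [measurable]: "y \<in> borel_measurable M" and y4: "integrable M (\<lambda>u. norm (y u) ^ 4)"
    and m: "m = measure M (space M)" "0 < m"
    and G: "G = (\<integral>u. A (y u) \<partial>M)"
  shows "(norm ((c + G + w) \<otimes> (c + G + w) - c \<otimes> c - (\<integral>u. A (y u) \<otimes> y u + y u \<otimes> A (y u) \<partial>M)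
      - (w \<otimes> c + c \<otimes> w) - w \<otimes> w))\<^sup>2
    \<le> (6 * (norm A)\<^sup>2 + 6 * norm A ^ 4) * (m\<^sup>2 * (\<integral>u. norm (y u) ^ 4 \<partial>M))
      + 3 * norm A ^ 4 * (m ^ 3 * (\<integral>u. norm (y u) ^ 4 \<partial>M))
      + 6 * (norm A)\<^sup>2 * (\<integral>u. norm (y u - c) ^ 4 \<partial>M) + 6 * (m * norm w ^ 4)"
proof -
  let ?b = "norm A" and ?P = "\<integral>u. norm (y u) ^ 4 \<partial>M" and ?R = "\<integral>u. norm (y u - c) ^ 4 \<partial>M"
  have [measurable]: "(\<lambda>u. A (y u)) \<in> borel_measurable M"
    by (rule borel_measurable_continuous_on[of "blinfun_apply A"]) (auto intro!: continuous_intros)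
  have R4: "integrable M (\<lambda>u. norm (y u - c) ^ 4)"
  proof (rule Bochner_Integration.integrable_bound)
    show "integrable M (\<lambda>u. 8 * (norm (y u) ^ 4 + norm c ^ 4))" using y4 by simp
    have "norm (y u - c) ^ 4 \<le> 8 * (norm (y u) ^ 4 + norm c ^ 4)" for u
      by (rule order_trans[OF power_mono[OF norm_triangle_ineq4] sum4_le]) auto
    then show "AE u in M. norm (norm (y u - c) ^ 4) \<le> norm (8 * (norm (y u) ^ 4 + norm c ^ 4))" by auto
  qed simp
  have Ay: "integrable M (\<lambda>u. A (y u))"
    by (rule norm4_integral_blinfun_le[OF _ y4]) simp
  have Phi: "integrable M (\<lambda>u. A (y u) \<otimes> y u + y u \<otimes> A (y u))"
    by (rule symmetrized_tensor_integrable[OF _ y4]) simp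
  define I where "I = (\<integral>u. norm (y u) * norm (y u - c) \<partial>M)"
  \<comment> \<open>Young's inequality weighted by m, because |y - c|^2 will have order m.\<close>
  have amgm: "(norm (y u) * norm (y u - c))\<^sup>2 \<le> (m * norm (y u) ^ 4 + norm (y u - c) ^ 4 / m) / 2" for u
  proof -
    have "0 \<le> (m * (norm (y u))\<^sup>2 - (norm (y u - c))\<^sup>2)\<^sup>2" by simp
    also have "\<dots> = m\<^sup>2 * norm (y u) ^ 4 + norm (y u - c) ^ 4 - 2 * m * (norm (y u) * norm (y u - c))\<^sup>2"
      by (simp add: power2_diff power_mult_distrib flip: power_mult)
    finally show ?thesis using m by (simp add: field_simps power2_eq_square)
  qed
  have I2: "integrable M (\<lambda>u. (norm (y u) * norm (y u - c))\<^sup>2)"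
  proof (rule Bochner_Integration.integrable_bound)
    show "integrable M (\<lambda>u. (m * norm (y u) ^ 4 + norm (y u - c) ^ 4 / m) / 2)" using y4 R4 by simp
    show "AE u in M. norm ((norm (y u) * norm (y u - c))\<^sup>2) \<le> norm ((m * norm (y u) ^ 4 + norm (y u - c) ^ 4 / m) / 2)"
      using amgm by (auto intro: order_trans[OF _ abs_ge_self])
  qed simp
  have I1: "integrable M (\<lambda>u. norm (y u) * norm (y u - c))" and I: "I\<^sup>2 \<le> (m\<^sup>2 * ?P + ?R) / 2"
  proof -
    show "integrable M (\<lambda>u. norm (y u) * norm (y u - c))" by (rule integral_power2_le(1)[OF _ I2]) simp
    have "I\<^sup>2 \<le> m * (\<integral>u. (norm (y u) * norm (y u - c))\<^sup>2 \<partial>M)"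
      unfolding I_def m by (rule integral_power2_le(2)[OF _ I2]) simp
    also have "\<dots> \<le> m * (\<integral>u. (m * norm (y u) ^ 4 + norm (y u - c) ^ 4 / m) / 2 \<partial>M)"
      using m y4 R4 by (intro mult_left_mono integral_mono I2 amgm) auto
    also have "\<dots> = (m\<^sup>2 * ?P + ?R) / 2"
      using m y4 R4 by (simp add: field_simps power2_eq_square)
    finally show "I\<^sup>2 \<le> (m\<^sup>2 * ?P + ?R) / 2" .
  qed
  have G4: "norm G ^ 4 \<le> ?b ^ 4 * (m ^ 3 * ?P)"
    unfolding G m by (rule norm4_integral_blinfun_le[OF _ y4]) simp
  \<comment> \<open>The same weighting: |G|^2 and m |w|^2 will both have order m^2.\<close>
  have Gw: "(norm G)\<^sup>2 * (norm w)\<^sup>2 \<le> (?b ^ 4 * (m\<^sup>2 * ?P) + m * norm w ^ 4) / 2"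
  proof -
    have "0 \<le> ((norm G)\<^sup>2 - m * (norm w)\<^sup>2)\<^sup>2" by simp
    also have "\<dots> = norm G ^ 4 + m\<^sup>2 * norm w ^ 4 - 2 * m * ((norm G)\<^sup>2 * (norm w)\<^sup>2)"
      by (simp add: power2_diff power_mult_distrib flip: power_mult)
    also have "\<dots> \<le> m * (?b ^ 4 * (m\<^sup>2 * ?P) + m * norm w ^ 4 - 2 * ((norm G)\<^sup>2 * (norm w)\<^sup>2))"
      using G4 by (simp add: algebra_simps power2_eq_square power3_eq_cube)
    finally show ?thesis using m by (simp add: zero_le_mult_iff)
  qed
  let ?E = "G \<otimes> c + c \<otimes> G - (\<integral>u. A (y u) \<otimes> y u + y u \<otimes> A (y u) \<partial>M)"
  have E: "norm ?E \<le> 2 * ?b * I"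
  proof -
    have 1: "integrable M (\<lambda>u. A (y u) \<otimes> c)" "(\<integral>u. A (y u) \<otimes> c \<partial>M) = G \<otimes> c"
      "integrable M (\<lambda>u. c \<otimes> A (y u))" "(\<integral>u. c \<otimes> A (y u) \<partial>M) = c \<otimes> G"
      unfolding G using Ay
      by (auto intro!: integrable_bounded_linear[OF tensor.bounded_linear_left]
          integrable_bounded_linear[OF tensor.bounded_linear_right]
          integral_bounded_linear[OF tensor.bounded_linear_left]
          integral_bounded_linear[OF tensor.bounded_linear_right])
    have "?E = (\<integral>u. (A (y u) \<otimes> c + c \<otimes> A (y u)) - (A (y u) \<otimes> y u + y u \<otimes> A (y u)) \<partial>M)"
      using 1 Phi by simp
    then have "norm ?E \<le> (\<integral>u. norm ((A (y u) \<otimes> c + c \<otimes> A (y u)) - (A (y u) \<otimes> y u + y u \<otimes> A (y u))) \<partial>M)"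
      by (simp only: integral_norm_bound)
    also have "\<dots> \<le> (\<integral>u. 2 * ?b * (norm (y u) * norm (y u - c)) \<partial>M)"
    proof (rule integral_mono)
      show "integrable M (\<lambda>u. norm ((A (y u) \<otimes> c + c \<otimes> A (y u)) - (A (y u) \<otimes> y u + y u \<otimes> A (y u))))"
        using 1 Phi by (intro integrable_norm) simp
      show "integrable M (\<lambda>u. 2 * ?b * (norm (y u) * norm (y u - c)))" using I1 by simp
      fix u
      \<comment> \<open>Bilinearity leaves only the difference c - y, paired with A y.\<close>
      have "(A (y u) \<otimes> c + c \<otimes> A (y u)) - (A (y u) \<otimes> y u + y u \<otimes> A (y u))
          = A (y u) \<otimes> (c - y u) + (c - y u) \<otimes> A (y u)"
        by (simp add: tensor.diff_left tensor.diff_right)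
      then have "norm ((A (y u) \<otimes> c + c \<otimes> A (y u)) - (A (y u) \<otimes> y u + y u \<otimes> A (y u)))
          \<le> 2 * (norm (A (y u)) * norm (y u - c))"
        by simp (rule norm_triangle_le, simp add: norm_hs_tensor norm_minus_commute mult.commute)
      also have "\<dots> \<le> 2 * (?b * norm (y u) * norm (y u - c))"
        by (intro mult_left_mono mult_right_mono norm_blinfun) auto
      finally show "norm ((A (y u) \<otimes> c + c \<otimes> A (y u)) - (A (y u) \<otimes> y u + y u \<otimes> A (y u)))
          \<le> 2 * ?b * (norm (y u) * norm (y u - c))" by (simp add: mult.assoc)
    qed
    also have "\<dots> = 2 * ?b * I" by (simp add: I_def)
    finally show ?thesis .
  qed
  have split: "(c + G + w) \<otimes> (c + G + w) - c \<otimes> c - (\<integral>u. A (y u) \<otimes> y u + y u \<otimes> A (y u) \<partial>M)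
      - (w \<otimes> c + c \<otimes> w) - w \<otimes> w = ?E + G \<otimes> G + (G \<otimes> w + w \<otimes> G)"
    by (simp add: tensor.add_left tensor.add_right algebra_simps)
  have "norm (?E + G \<otimes> G + (G \<otimes> w + w \<otimes> G)) \<le> 2 * ?b * I + (norm G)\<^sup>2 + 2 * (norm G * norm w)"
    by (intro norm_triangle_mono E) (auto intro!: norm_triangle_le simp: norm_hs_tensor power2_eq_square mult.commute)
  then have "(norm (?E + G \<otimes> G + (G \<otimes> w + w \<otimes> G)))\<^sup>2 \<le> (2 * ?b * I + (norm G)\<^sup>2 + 2 * (norm G * norm w))\<^sup>2"
    by (intro power_mono) auto
  also have "\<dots> \<le> 3 * ((2 * ?b * I)\<^sup>2 + ((norm G)\<^sup>2)\<^sup>2 + (2 * (norm G * norm w))\<^sup>2)"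
  proof -
    have "(p + q + r)\<^sup>2 \<le> 3 * (p\<^sup>2 + q\<^sup>2 + r\<^sup>2)" for p q r :: real
      using sum_squares_bound[of p q] sum_squares_bound[of p r] sum_squares_bound[of q r]
      by (simp add: power2_eq_square algebra_simps)
    then show ?thesis .
  qed
  also have "\<dots> = 12 * (?b\<^sup>2 * I\<^sup>2) + 3 * norm G ^ 4 + 12 * ((norm G)\<^sup>2 * (norm w)\<^sup>2)"
    by (simp add: power_mult_distrib flip: power_mult)
  also have "\<dots> \<le> 12 * (?b\<^sup>2 * ((m\<^sup>2 * ?P + ?R) / 2)) + 3 * (?b ^ 4 * (m ^ 3 * ?P))
      + 12 * ((?b ^ 4 * (m\<^sup>2 * ?P) + m * norm w ^ 4) / 2)"
    by (intro add_mono mult_left_mono I G4 Gw) auto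
  also have "\<dots> = (6 * (norm A)\<^sup>2 + 6 * norm A ^ 4) * (m\<^sup>2 * ?P) + 3 * norm A ^ 4 * (m ^ 3 * ?P)
      + 6 * (norm A)\<^sup>2 * ?R + 6 * (m * norm w ^ 4)"
    by (simp add: field_simps)
  finally show "(norm ((c + G + w) \<otimes> (c + G + w) - c \<otimes> c - (\<integral>u. A (y u) \<otimes> y u + y u \<otimes> A (y u) \<partial>M)
      - (w \<otimes> c + c \<otimes> w) - w \<otimes> w))\<^sup>2
    \<le> (6 * (norm A)\<^sup>2 + 6 * norm A ^ 4) * (m\<^sup>2 * ?P) + 3 * norm A ^ 4 * (m ^ 3 * ?P)
      + 6 * (norm A)\<^sup>2 * ?R + 6 * (m * norm w ^ 4)"
    unfolding split .
qed

lemma LINT_singleton: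
  fixes f :: "real \<Rightarrow> 'a::{banach,second_countable_topology}"
  shows "(LINT u:{r..r}|lborel. f u) = 0"
  unfolding set_lebesgue_integral_def
  by (rule integral_eq_zero_AE) (use AE_lborel_singleton[of r] in eventually_elim, auto)

text \<open>No continuity of \<open>\<phi>\<close> is needed: the supremum \<open>m\<close> of \<open>e\<^bsup>-2\<kappa>t\<^esup> \<phi>(t)\<close> satisfies \<open>m \<le> a + m / 2\<close>.\<close>

lemma gronwall_bounded:
  fixes \<phi> :: "real \<Rightarrow> real"
  assumes [measurable]: "\<phi> \<in> borel_measurable borel"
    and bound: "\<And>t. 0 \<le> t \<Longrightarrow> t \<le> T \<Longrightarrow> 0 \<le> \<phi> t \<and> \<phi> t \<le> B"
    and le: "\<And>t. 0 \<le> t \<Longrightarrow> t \<le> T \<Longrightarrow> \<phi> t \<le> a + \<kappa> * (LINT s:{0..t}|lborel. \<phi> s)"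
    and \<kappa>: "0 < \<kappa>" and t: "0 \<le> t" "t \<le> T"
  shows "\<phi> t \<le> 2 * a * exp (2 * \<kappa> * t)"
proof -
  let ?g = "\<lambda>t. exp (- (2 * \<kappa> * t)) * \<phi> t"
  \<comment> \<open>\<open>B\<close> makes this supremum finite and does not reach the conclusion.
    The rate is twice \<kappa> so that \<kappa> times the integral of exp(2 \<kappa> s) is at most
    exp(2 \<kappa> t) / 2.\<close>
  define m where "m = (SUP t\<in>{0..T}. ?g t)"
  have bdd: "bdd_above (?g ` {0..T})"
  proof (rule bdd_aboveI2)
    fix t assume t: "t \<in> {0..T}"
    have "?g t \<le> 1 * \<phi> t" using bound t \<kappa> by (intro mult_right_mono) auto
    then show "?g t \<le> B" using bound[of t] t by simp
  qed
  have g: "?g s \<le> m" if "s \<in> {0..T}" for s unfolding m_def by (rule cSUP_upper[OF that bdd])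
  have m0: "0 \<le> m" using g[of t] bound[OF t] t by (auto intro: order_trans[rotated])
  have \<phi>: "\<phi> s \<le> m * exp (2 * \<kappa> * s)" if "s \<in> {0..T}" for s
    using g[OF that] by (simp add: exp_minus field_simps)
  have "?g t \<le> a + m / 2" if t: "t \<in> {0..T}" for t
  proof -
    have "has_bochner_integral lborel (\<lambda>s. (m * exp (2 * \<kappa> * s)) * indicator {0..t} s)
      (m * exp (2 * \<kappa> * t) / (2 * \<kappa>) - m * exp (2 * \<kappa> * 0) / (2 * \<kappa>))"
      using t \<kappa> by (intro has_bochner_integral_FTC_Icc_real) (auto intro!: derivative_eq_intros continuous_intros)
    then have ex: "set_integrable lborel {0..t} (\<lambda>s. m * exp (2 * \<kappa> * s))"
      and exI: "(LINT s:{0..t}|lborel. m * exp (2 * \<kappa> * s)) = m * exp (2 * \<kappa> * t) / (2 * \<kappa>) - m / (2 * \<kappa>)"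
      unfolding has_bochner_integral_iff set_integrable_def set_lebesgue_integral_def
      by (simp_all only: real_scaleR_def mult.commute[of _ "indicator _ _"]) simp
    have "(LINT s:{0..t}|lborel. \<phi> s) \<le> (LINT s:{0..t}|lborel. m * exp (2 * \<kappa> * s))"
    proof (rule set_integral_mono[OF _ ex])
      show "set_integrable lborel {0..t} \<phi>"
        using ex by (rule set_integrable_bound)
          (use t \<phi> bound in \<open>auto simp: set_borel_measurable_def intro!: order_trans[OF _ abs_ge_self]\<close>)
      show "\<phi> s \<le> m * exp (2 * \<kappa> * s)" if "s \<in> {0..t}" for s using \<phi>[of s] that t by auto
    qed
    also have "\<dots> \<le> m * exp (2 * \<kappa> * t) / (2 * \<kappa>)" unfolding exI using m0 \<kappa> by simp
    finally have "\<kappa> * (LINT s:{0..t}|lborel. \<phi> s) \<le> \<kappa> * (m * exp (2 * \<kappa> * t) / (2 * \<kappa>))"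
      using \<kappa> by (intro mult_left_mono) auto
    then have 1: "\<phi> t \<le> a + m * exp (2 * \<kappa> * t) / 2" using le[of t] t \<kappa> by simp
    have "?g t \<le> exp (- (2 * \<kappa> * t)) * (a + m * exp (2 * \<kappa> * t) / 2)"
      using 1 by (rule mult_left_mono) simp
    also have "\<dots> = exp (- (2 * \<kappa> * t)) * a + m / 2" by (simp add: exp_minus field_simps)
    also have "\<dots> \<le> 1 * a + m / 2"
    proof -
      \<comment> \<open>At time 0 the integral vanishes, so the hypothesis itself yields the sign of
        \<open>a\<close>.\<close>
      have "0 \<le> a" using le[of 0] bound[of 0] t unfolding LINT_singleton by simp
      then show ?thesis using \<kappa> t by (intro add_right_mono mult_right_mono) auto
    qed
    finally show ?thesis by simp
  qed
  then have "m \<le> a + m / 2" unfolding m_def using t by (intro cSUP_least) auto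
  then have "m \<le> 2 * a" by simp
  have "\<phi> t \<le> m * exp (2 * \<kappa> * t)" using \<phi> t by simp
  also have "\<dots> \<le> 2 * a * exp (2 * \<kappa> * t)" using \<open>m \<le> 2 * a\<close> by (intro mult_right_mono) auto
  finally show ?thesis .
qed

subsection \<open>Moments of the solution\<close>

text \<open>The time interval as a finite measure space, to which the preceding moment inequalities
  apply path by path.\<close>

abbreviation lborel_on :: "real \<Rightarrow> real \<Rightarrow> real measure" where
  "lborel_on r s \<equiv> restrict_space lborel {r..s}"

lemma finite_measure_lborel_on: "finite_measure (lborel_on r s)"
  by (rule finite_measureI) (simp add: space_restrict_space emeasure_restrict_space emeasure_lborel_Icc_eq)

lemma measure_lborel_on: "r \<le> s \<Longrightarrow> measure (lborel_on r s) (space (lborel_on r s)) = s - r"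
  by (simp add: space_restrict_space measure_restrict_space)

lemma set_integrable_eq_lborel_on:
  fixes f :: "real \<Rightarrow> 'a::{banach,second_countable_topology}"
  shows "set_integrable lborel {r..s} f \<longleftrightarrow> integrable (lborel_on r s) f"
  by (simp add: set_integrable_def integrable_restrict_space)

lemma LINT_eq_lborel_on:
  fixes f :: "real \<Rightarrow> 'a::{banach,second_countable_topology}"
  shows "(LINT u:{r..s}|lborel. f u) = (\<integral>u. f u \<partial>lborel_on r s)"
  by (simp add: set_lebesgue_integral_def integral_restrict_space)

lemma LINT_split:
  fixes f :: "real \<Rightarrow> 'a::{banach,second_countable_topology}"
  assumes "q \<le> r" "r \<le> s" and f: "set_integrable lborel {q..s} f"
  shows "(LINT u:{q..s}|lborel. f u) = (LINT u:{q..r}|lborel. f u) + (LINT u:{r..s}|lborel. f u)"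
proof -
  have U: "{q..s} = {q..r} \<union> {r..s}" using assms by auto
  have i: "set_integrable lborel {q..r} f" "set_integrable lborel {r..s} f"
    using assms by (auto intro: set_integrable_subset[OF f])
  show ?thesis
    unfolding U
  proof (rule set_integral_Un_AE[OF _ _ _ i])
    show "AE u in lborel. \<not> (u \<in> {q..r} \<and> u \<in> {r..s})"
      using AE_lborel_singleton[of r] by eventually_elim auto
  qed auto
qed

lemma LINT_mono_interval:
  fixes f :: "real \<Rightarrow> real"
  assumes "q \<le> r" "r \<le> s" and f: "set_integrable lborel {q..s} f" "\<And>u. 0 \<le> f u"
  shows "(LINT u:{q..r}|lborel. f u) \<le> (LINT u:{q..s}|lborel. f u)"
proof -
  have "0 \<le> (LINT u:{r..s}|lborel. f u)"
    unfolding set_lebesgue_integral_def using f(2) by (intro Bochner_Integration.integral_nonneg) simp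
  then show ?thesis using LINT_split[OF assms(1,2) f(1)] by simp
qed

text \<open>Tonelli's theorem: a bound on the expectations that is uniform over [r, s] bounds the
  expected time integral, whose finiteness makes almost every path integrable. The last two
  conclusions are the same bound for the Bochner and for the nonnegative integral in time.\<close>

lemma (in prob_space) expectation_time_integral:
  fixes g :: "real \<Rightarrow> 'a \<Rightarrow> real"
  assumes g: "case_prod g \<in> borel_measurable (lborel \<Otimes>\<^sub>M M)" and nn: "\<And>u \<omega>. 0 \<le> g u \<omega>"
    and le: "\<And>u. r \<le> u \<Longrightarrow> u \<le> s \<Longrightarrow> (\<integral>\<^sup>+\<omega>. ennreal (g u \<omega>) \<partial>M) \<le> ennreal c"
    and c: "0 \<le> c" and rs: "r \<le> s"
  shows "AE \<omega> in M. integrable (lborel_on r s) (\<lambda>u. g u \<omega>)"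
    and "(\<lambda>\<omega>. \<integral>u. g u \<omega> \<partial>lborel_on r s) \<in> borel_measurable M"
    and "(\<integral>\<^sup>+\<omega>. ennreal (\<integral>u. g u \<omega> \<partial>lborel_on r s) \<partial>M) \<le> ennreal (c * (s - r))"
    and "(\<integral>\<^sup>+\<omega>. (\<integral>\<^sup>+u\<in>{r..s}. ennreal (g u \<omega>) \<partial>lborel) \<partial>M) \<le> ennreal (c * (s - r))"
proof -
  interpret P: pair_sigma_finite lborel M ..
  note [measurable] = g
  have g2 [measurable]: "(\<lambda>(\<omega>, u). g u \<omega>) \<in> borel_measurable (M \<Otimes>\<^sub>M lborel)"
    using measurable_pair_swap[OF g] by (simp add: case_prod_unfold)
  have sec [measurable]: "(\<lambda>u. g u \<omega>) \<in> borel_measurable lborel" if "\<omega> \<in> space M" for \<omega>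
    using measurable_Pair1[OF g that] by simp
  show meas: "(\<lambda>\<omega>. \<integral>u. g u \<omega> \<partial>lborel_on r s) \<in> borel_measurable M"
    by (simp add: integral_restrict_space) measurable
  have "(\<integral>\<^sup>+\<omega>. (\<integral>\<^sup>+u. ennreal (g u \<omega>) * indicator {r..s} u \<partial>lborel) \<partial>M)
      = (\<integral>\<^sup>+u. (\<integral>\<^sup>+\<omega>. ennreal (g u \<omega>) * indicator {r..s} u \<partial>M) \<partial>lborel)"
    by (rule P.Fubini') measurable
  also have "\<dots> \<le> (\<integral>\<^sup>+u. ennreal c * indicator {r..s} u \<partial>lborel)"
    using le by (intro nn_integral_mono) (auto simp: indicator_def)
  also have "\<dots> = ennreal (c * (s - r))"
    using c rs by (simp add: nn_integral_cmult_indicator ennreal_mult)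
  finally show fub: "(\<integral>\<^sup>+\<omega>. (\<integral>\<^sup>+u\<in>{r..s}. ennreal (g u \<omega>) \<partial>lborel) \<partial>M) \<le> ennreal (c * (s - r))" .
  have fin: "AE \<omega> in M. (\<integral>\<^sup>+u. ennreal (g u \<omega>) * indicator {r..s} u \<partial>lborel) \<noteq> \<infinity>"
  proof (rule nn_integral_noteq_infinite)
    show "(\<lambda>\<omega>. \<integral>\<^sup>+u. ennreal (g u \<omega>) * indicator {r..s} u \<partial>lborel) \<in> borel_measurable M" by measurable
    show "(\<integral>\<^sup>+\<omega>. (\<integral>\<^sup>+u. ennreal (g u \<omega>) * indicator {r..s} u \<partial>lborel) \<partial>M) \<noteq> \<infinity>"
      using fub by (auto simp: top_unique)
  qed
  have res: "(\<integral>\<^sup>+u. ennreal (g u \<omega>) \<partial>lborel_on r s) = (\<integral>\<^sup>+u. ennreal (g u \<omega>) * indicator {r..s} u \<partial>lborel)" for \<omega>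
    by (simp add: nn_integral_restrict_space)
  have int: "AE \<omega> in M. integrable (lborel_on r s) (\<lambda>u. g u \<omega>)"
    using fin AE_space
  proof eventually_elim
    case (elim \<omega>)
    then show ?case
      using nn by (intro integrableI_nonneg measurable_restrict_space1 sec) (auto simp: res less_top)
  qed
  then show "AE \<omega> in M. integrable (lborel_on r s) (\<lambda>u. g u \<omega>)" .
  have "(\<integral>\<^sup>+\<omega>. ennreal (\<integral>u. g u \<omega> \<partial>lborel_on r s) \<partial>M)
      = (\<integral>\<^sup>+\<omega>. (\<integral>\<^sup>+u. ennreal (g u \<omega>) * indicator {r..s} u \<partial>lborel) \<partial>M)"
  proof (rule nn_integral_cong_AE)
    show "AE \<omega> in M. ennreal (\<integral>u. g u \<omega> \<partial>lborel_on r s) = (\<integral>\<^sup>+u. ennreal (g u \<omega>) * indicator {r..s} u \<partial>lborel)"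
      using int by eventually_elim (use nn in \<open>simp add: nn_integral_eq_integral flip: res\<close>)
  qed
  with fub show "(\<integral>\<^sup>+\<omega>. ennreal (\<integral>u. g u \<omega> \<partial>lborel_on r s) \<partial>M) \<le> ennreal (c * (s - r))" by simp
qed

text \<open>The nonnegative integral lets moment bounds be combined before any integrability is
  established.\<close>

lemma nn_integral_linear_bound:
  fixes f g h :: "'a \<Rightarrow> real"
  assumes [measurable]: "g \<in> borel_measurable M" "h \<in> borel_measurable M"
    and f: "AE x in M. f x \<le> \<alpha> * g x + \<beta> * h x"
    and nn: "0 \<le> \<alpha>" "0 \<le> \<beta>" "\<And>x. 0 \<le> g x" "\<And>x. 0 \<le> h x" "0 \<le> c" "0 \<le> d"
    and g: "(\<integral>\<^sup>+x. ennreal (g x) \<partial>M) \<le> ennreal c" and h: "(\<integral>\<^sup>+x. ennreal (h x) \<partial>M) \<le> ennreal d"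
  shows "(\<integral>\<^sup>+x. ennreal (f x) \<partial>M) \<le> ennreal (\<alpha> * c + \<beta> * d)"
proof -
  have "(\<integral>\<^sup>+x. ennreal (f x) \<partial>M) \<le> (\<integral>\<^sup>+x. ennreal \<alpha> * ennreal (g x) + ennreal \<beta> * ennreal (h x) \<partial>M)"
  proof (rule nn_integral_mono_AE)
    show "AE x in M. ennreal (f x) \<le> ennreal \<alpha> * ennreal (g x) + ennreal \<beta> * ennreal (h x)"
      using f by eventually_elim (use nn in \<open>simp add: ennreal_leI flip: ennreal_plus ennreal_mult'\<close>)
  qed
  also have "\<dots> = ennreal \<alpha> * (\<integral>\<^sup>+x. ennreal (g x) \<partial>M) + ennreal \<beta> * (\<integral>\<^sup>+x. ennreal (h x) \<partial>M)"
    by (simp add: nn_integral_add nn_integral_cmult)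
  also have "\<dots> \<le> ennreal \<alpha> * ennreal c + ennreal \<beta> * ennreal d"
    by (intro add_mono mult_left_mono g h) auto
  also have "\<dots> = ennreal (\<alpha> * c + \<beta> * d)"
    using nn by (simp add: ennreal_mult' ennreal_plus)
  finally show ?thesis .
qed

lemma nn_integral_mult_bound:
  fixes f g :: "'a \<Rightarrow> real"
  assumes "g \<in> borel_measurable M" "AE x in M. f x \<le> \<alpha> * g x" "0 \<le> \<alpha>" "\<And>x. 0 \<le> g x" "0 \<le> c"
    and "(\<integral>\<^sup>+x. ennreal (g x) \<partial>M) \<le> ennreal c"
  shows "(\<integral>\<^sup>+x. ennreal (f x) \<partial>M) \<le> ennreal (\<alpha> * c)"
  using nn_integral_linear_bound[of g M "\<lambda>_. 0" f \<alpha> 0 c 0] assms by simp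

section \<open>The solution on a fixed time horizon\<close>

locale linear_sde = hilbert_wiener M F Q W
  for M :: "'w measure" and F Q and W :: "real \<Rightarrow> 'w \<Rightarrow> 'h::{real_inner,banach,second_countable_topology}" +
  fixes A \<eta> :: "'h \<Rightarrow>\<^sub>L 'h" and Y\<^sub>0 :: 'h and Y :: "real \<Rightarrow> 'w \<Rightarrow> 'h" and T :: real
  assumes solution: "strong_solution M F Q W A \<eta> Y\<^sub>0 Y" and T: "0 \<le> T"
begin

text \<open>Freezing the time outside \<open>[0, T]\<close> makes the solution jointly measurable on the whole line.\<close>

definition y :: "real \<Rightarrow> 'w \<Rightarrow> 'h" where "y s = Y (max 0 (min s T))"

lemma y_eq: "0 \<le> s \<Longrightarrow> s \<le> T \<Longrightarrow> y s = Y s" by (simp add: y_def)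

lemma Y_measurable_F: assumes "0 \<le> t" shows "Y t \<in> borel_measurable (F t)"
proof -
  have "(\<lambda>(s, \<omega>). Y s \<omega>) \<in> borel_measurable (restrict_space borel {0..t} \<Otimes>\<^sub>M F t)"
    using solution assms by (auto simp: strong_solution_def progressively_measurable_def)
  from measurable_compose[OF measurable_Pair1' this, of t]
  show ?thesis using assms by (simp add: space_restrict_space)
qed

lemma Y_measurable: "0 \<le> t \<Longrightarrow> Y t \<in> borel_measurable M"
  by (rule measurable_F[OF _ Y_measurable_F])

lemma y_measurable [measurable]: "case_prod y \<in> borel_measurable (lborel \<Otimes>\<^sub>M M)"
proof -
  have Y: "(\<lambda>(s, \<omega>). Y s \<omega>) \<in> borel_measurable (restrict_space borel {0..T} \<Otimes>\<^sub>M F T)"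
    using solution T by (auto simp: strong_solution_def progressively_measurable_def)
  have id: "(\<lambda>\<omega>. \<omega>) \<in> measurable M (F T)" by (rule measurable_F[OF T]) simp
  have "(\<lambda>p. (max 0 (min (fst p) T), snd p)) \<in> measurable (lborel \<Otimes>\<^sub>M M) (restrict_space borel {0..T} \<Otimes>\<^sub>M F T)"
  proof (rule measurable_Pair)
    show "(\<lambda>p. max 0 (min (fst p) T)) \<in> measurable (lborel \<Otimes>\<^sub>M M) (restrict_space borel {0..T})"
      using T by (intro measurable_restrict_space2) auto
    show "(\<lambda>p. snd p) \<in> measurable (lborel \<Otimes>\<^sub>M M) (F T)"
      by (rule measurable_compose[OF measurable_snd id])
  qed
  from measurable_compose[OF this Y] show ?thesis by (simp add: y_def case_prod_unfold)
qed

definition X :: "real \<Rightarrow> 'w \<Rightarrow> 'h" where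
  "X t \<omega> = Y\<^sub>0 + (LINT s:{0..t}|lborel. A (y s \<omega>))"

lemma Ay_measurable [measurable]: "(\<lambda>(s, \<omega>). A (y s \<omega>)) \<in> borel_measurable (lborel \<Otimes>\<^sub>M M)"
  using borel_measurable_blinfun[OF y_measurable, of A] by (simp add: case_prod_unfold)

text \<open>Joint measurability permits time integrals of \<open>y - X\<close> under the
  expectation. The moving end point is put into an indicator, and the time integral is taken with
  (t, \<omega>) as parameter.\<close>

lemma X_measurable [measurable]: "case_prod X \<in> borel_measurable (lborel \<Otimes>\<^sub>M M)"
proof -
  have [measurable]: "(\<lambda>p. A (y (snd p) (snd (fst p)))) \<in> borel_measurable ((lborel \<Otimes>\<^sub>M M) \<Otimes>\<^sub>M lborel)"
    using measurable_compose[of "\<lambda>p. (snd p, snd (fst p))" "(lborel \<Otimes>\<^sub>M M) \<Otimes>\<^sub>M lborel", OF _ Ay_measurable]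
    by simp
  have "(\<lambda>p. if 0 \<le> snd p \<and> snd p \<le> fst (fst p) then A (y (snd p) (snd (fst p))) else 0)
      \<in> borel_measurable ((lborel \<Otimes>\<^sub>M M) \<Otimes>\<^sub>M lborel)"
    by measurable
  then have "(\<lambda>(p, s). indicator {0..fst p} s *\<^sub>R A (y s (snd p))) \<in> borel_measurable ((lborel \<Otimes>\<^sub>M M) \<Otimes>\<^sub>M lborel)"
    by (rule back_subst[where P="\<lambda>f. f \<in> borel_measurable ((lborel \<Otimes>\<^sub>M M) \<Otimes>\<^sub>M lborel)"])
      (auto simp: fun_eq_iff indicator_def)
  from lborel.borel_measurable_lebesgue_integral[OF this]
  have "(\<lambda>p. \<integral>s. indicator {0..fst p} s *\<^sub>R A (y s (snd p)) \<partial>lborel) \<in> borel_measurable (lborel \<Otimes>\<^sub>M M)" .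
  then show ?thesis
    unfolding X_def set_lebesgue_integral_def case_prod_unfold by measurable
qed

lemma Ay_integrable: "AE \<omega> in M. set_integrable lborel {0..T} (\<lambda>s. A (y s \<omega>))"
proof -
  have "AE \<omega> in M. set_integrable lborel {0..T} (\<lambda>s. A (Y s \<omega>))"
    using solution T unfolding strong_solution_def by (auto elim!: AE_mp)
  then show ?thesis
    by eventually_elim (subst set_integrable_cong[OF refl refl], auto simp: y_eq)
qed

text \<open>The null set depends on t. A single path thus cannot be compared with \<eta> W at all
  times, and estimates on whole paths use \<open>y - X\<close> in its place.\<close>

lemma solution_eq:
  assumes t: "0 \<le> t" "t \<le> T"
  shows "AE \<omega> in M. Y t \<omega> = X t \<omega> + \<eta> (W t \<omega>)"
proof -
  obtain Z where Z: "has_stoch_integral M F Q W (\<lambda>s \<omega>. \<eta>) t (Z t)"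
    and eq: "AE \<omega> in M. set_integrable lborel {0..t} (\<lambda>s. A (Y s \<omega>)) \<and>
           Y t \<omega> = Y\<^sub>0 + (LINT s:{0..t}|lborel. A (Y s \<omega>)) + Z t \<omega>"
    using solution t unfolding strong_solution_def by blast
  have Yy: "(LINT s:{0..t}|lborel. A (Y s \<omega>)) = (LINT s:{0..t}|lborel. A (y s \<omega>))" for \<omega>
    using t by (intro set_lebesgue_integral_cong) (auto simp: y_eq)
  from eq stoch_integral_const[OF Z t(1)] show ?thesis
    unfolding X_def by eventually_elim (simp add: Yy)
qed

lemma increment_eq:
  assumes rs: "0 \<le> r" "r \<le> s" "s \<le> T"
  shows "AE \<omega> in M. Y s \<omega> = Y r \<omega> + (\<integral>u. A (y u \<omega>) \<partial>lborel_on r s) + \<eta> (W s \<omega> - W r \<omega>)"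
proof -
  have r: "0 \<le> s" "r \<le> T" using rs by auto
  show ?thesis
    using solution_eq[OF rs(1) r(2)] solution_eq[OF r(1) rs(3)] Ay_integrable
  proof eventually_elim
    case (elim \<omega>)
    have "set_integrable lborel {0..s} (\<lambda>u. A (y u \<omega>))"
      using rs by (intro set_integrable_subset[OF elim(3)]) auto
    from LINT_split[OF rs(1,2) this] show ?case
      using elim by (simp add: X_def LINT_eq_lborel_on blinfun.diff_right)
  qed
qed

lemma section_measurable:
  fixes f :: "real \<Rightarrow> 'w \<Rightarrow> 'b::topological_space"
  assumes "case_prod f \<in> borel_measurable (lborel \<Otimes>\<^sub>M M)"
  shows "\<omega> \<in> space M \<Longrightarrow> (\<lambda>u. f u \<omega>) \<in> borel_measurable lborel"
    and "f u \<in> borel_measurable M"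
  using measurable_Pair1[OF assms, of \<omega>] measurable_Pair2[OF assms, of u] by simp_all

lemma norm4_W:
  assumes K: "\<forall>s t. 0 \<le> s \<and> s \<le> t \<longrightarrow> (\<integral>\<^sup>+\<omega>. ennreal (norm (W t \<omega> - W s \<omega>) ^ 4) \<partial>M) \<le> ennreal (K * (t - s)\<^sup>2)"
    and t: "0 \<le> t"
  shows "(\<integral>\<^sup>+\<omega>. ennreal (norm (W t \<omega>) ^ 4) \<partial>M) \<le> ennreal (K * t\<^sup>2)"
proof -
  have "(\<integral>\<^sup>+\<omega>. ennreal (norm (W t \<omega>) ^ 4) \<partial>M) = (\<integral>\<^sup>+\<omega>. ennreal (norm (W t \<omega> - W 0 \<omega>) ^ 4) \<partial>M)"
    by (rule nn_integral_cong_AE) (use W_0 in eventually_elim, simp)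
  with K[rule_format, of 0 t] t show ?thesis by simp
qed

text \<open>The solution splits into the absolutely continuous part \<open>X\<close>, to which Gronwall's lemma applies
  path by path, and \<open>Y - X\<close>, a version of \<open>\<eta> W\<close>.\<close>

lemma X_pathwise_bound:
  assumes \<omega>: "\<omega> \<in> space M"
    and Ay: "set_integrable lborel {0..T} (\<lambda>s. A (y s \<omega>))"
    and U4: "integrable (lborel_on 0 T) (\<lambda>u. norm (y u \<omega> - X u \<omega>) ^ 4)"
    and t: "0 \<le> t" "t \<le> T" and \<kappa>: "\<kappa> = norm A + 1"
  shows "norm (X t \<omega>) ^ 4 \<le> (2 * exp (2 * \<kappa> * T)) ^ 4 * (8 * (norm Y\<^sub>0 ^ 4
    + \<kappa> ^ 4 * (T ^ 3 * (\<integral>u. norm (y u \<omega> - X u \<omega>) ^ 4 \<partial>lborel_on 0 T))))"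
proof -
  interpret N: finite_measure "lborel_on 0 T" by (rule finite_measure_lborel_on)
  have [measurable]: "(\<lambda>u. y u \<omega>) \<in> borel_measurable lborel" "(\<lambda>u. X u \<omega>) \<in> borel_measurable lborel"
    using \<omega> by (auto intro!: section_measurable)
  have [measurable]: "(\<lambda>u. y u \<omega> - X u \<omega>) \<in> borel_measurable (lborel_on 0 T)"
    by (intro measurable_restrict_space1) measurable
  let ?U = "\<lambda>u. norm (y u \<omega> - X u \<omega>)"
  \<comment> \<open>The summand 1 keeps the rate positive when A = 0, as
    \<open>gronwall_bounded\<close> requires.\<close>
  have \<kappa>0: "0 < \<kappa>" "norm A \<le> \<kappa>" using \<kappa> norm_ge_zero[of A] by linarith+
  have U1: "integrable (lborel_on 0 T) ?U"
    by (rule N.integral_power4_le(1)[OF _ U4]) measurable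
  define J where "J = (\<integral>u. ?U u \<partial>lborel_on 0 T)"
  have J0: "0 \<le> J" unfolding J_def by simp
  have J4: "J ^ 4 \<le> T ^ 3 * (\<integral>u. ?U u ^ 4 \<partial>lborel_on 0 T)"
    using N.integral_power4_le(3)[OF _ U4] measure_lborel_on[OF T] unfolding J_def by simp
  \<comment> \<open>A bound for this one path; it varies with \<omega>, but only its existence
    matters for Gronwall's lemma.\<close>
  define B where "B = norm Y\<^sub>0 + (LINT s:{0..T}|lborel. norm (A (y s \<omega>)))"
  have nAy: "set_integrable lborel {0..T} (\<lambda>s. norm (A (y s \<omega>)))"
    using Ay by (rule set_integrable_norm)
  have XB: "norm (X t \<omega>) \<le> norm Y\<^sub>0 + (LINT s:{0..t}|lborel. norm (A (y s \<omega>)))" if t: "0 \<le> t" "t \<le> T" for t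
  proof -
    have "norm (LINT s:{0..t}|lborel. A (y s \<omega>)) \<le> (LINT s:{0..t}|lborel. norm (A (y s \<omega>)))"
      using t by (intro set_integral_norm_bound set_integrable_subset[OF Ay]) auto
    then show ?thesis unfolding X_def by (intro norm_triangle_le) simp
  qed
  have bound: "0 \<le> norm (X t \<omega>) \<and> norm (X t \<omega>) \<le> B" if t: "0 \<le> t" "t \<le> T" for t
  proof -
    have "(LINT s:{0..t}|lborel. norm (A (y s \<omega>))) \<le> (LINT s:{0..T}|lborel. norm (A (y s \<omega>)))"
      using t by (intro LINT_mono_interval nAy) auto
    then show ?thesis using XB[OF t] unfolding B_def by simp
  qed
  have Xint: "set_integrable lborel {0..t} (\<lambda>s. norm (X s \<omega>))" if "0 \<le> t" "t \<le> T" for t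
  proof (rule set_integrable_bound)
    show "set_integrable lborel {0..t} (\<lambda>_. B)"
      unfolding set_integrable_eq_lborel_on by (rule finite_measure.integrable_const[OF finite_measure_lborel_on])
    show "set_borel_measurable lborel {0..t} (\<lambda>s. norm (X s \<omega>))"
      unfolding set_borel_measurable_def by measurable
    have "norm (norm (X s \<omega>)) \<le> norm B" if "s \<in> {0..t}" for s
      using bound[of s] that \<open>t \<le> T\<close> abs_ge_self[of B] by simp
    then show "AE s in lborel. s \<in> {0..t} \<longrightarrow> norm (norm (X s \<omega>)) \<le> norm B" by simp
  qed
  have UT: "set_integrable lborel {0..T} ?U"
    using U1 by (simp only: set_integrable_eq_lborel_on)
  have Uint: "set_integrable lborel {0..t} ?U" if "0 \<le> t" "t \<le> T" for t
    using that by (intro set_integrable_subset[OF UT]) auto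
  \<comment> \<open>The integral of |y - X| up to t is replaced by its value J up to T, which makes
    the inhomogeneous term in Gronwall's lemma constant.\<close>
  have "norm (X t \<omega>) \<le> 2 * (norm Y\<^sub>0 + \<kappa> * J) * exp (2 * \<kappa> * t)"
  proof (rule gronwall_bounded[where T=T and B=B, OF _ bound _ \<kappa>0(1) t])
    show "(\<lambda>t. norm (X t \<omega>)) \<in> borel_measurable borel" by measurable
    fix t assume t: "0 \<le> t" "t \<le> T"
    have "(LINT s:{0..t}|lborel. norm (A (y s \<omega>))) \<le> (LINT s:{0..t}|lborel. \<kappa> * (norm (X s \<omega>) + ?U s))"
    proof (rule set_integral_mono)
      show "set_integrable lborel {0..t} (\<lambda>s. norm (A (y s \<omega>)))"
        using t by (intro set_integrable_subset[OF nAy]) auto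
      show "set_integrable lborel {0..t} (\<lambda>s. \<kappa> * (norm (X s \<omega>) + ?U s))"
        by (intro set_integrable_mult_right set_integral_add Xint Uint t)
      fix s
      have "norm (A (y s \<omega>)) \<le> norm A * norm (y s \<omega>)" by (rule norm_blinfun)
      also have "\<dots> \<le> \<kappa> * (norm (X s \<omega>) + ?U s)"
        using \<kappa>0 norm_triangle_ineq[of "X s \<omega>" "y s \<omega> - X s \<omega>"] by (intro mult_mono) auto
      finally show "norm (A (y s \<omega>)) \<le> \<kappa> * (norm (X s \<omega>) + ?U s)" .
    qed
    also have "\<dots> = \<kappa> * ((LINT s:{0..t}|lborel. norm (X s \<omega>)) + (LINT s:{0..t}|lborel. ?U s))"
      using set_integral_add(2)[OF Xint[OF t] Uint[OF t]] by simp
    also have "\<dots> \<le> \<kappa> * ((LINT s:{0..t}|lborel. norm (X s \<omega>)) + J)"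
    proof -
      have "(LINT s:{0..t}|lborel. ?U s) \<le> (LINT s:{0..T}|lborel. ?U s)"
        using t T by (intro LINT_mono_interval Uint) auto
      then show ?thesis using \<kappa>0 unfolding J_def LINT_eq_lborel_on[of 0 T ?U] by (intro mult_left_mono) auto
    qed
    finally show "norm (X t \<omega>) \<le> norm Y\<^sub>0 + \<kappa> * J + \<kappa> * (LINT s:{0..t}|lborel. norm (X s \<omega>))"
      using XB[OF t] by (simp add: algebra_simps)
  qed
  also have "\<dots> \<le> 2 * (norm Y\<^sub>0 + \<kappa> * J) * exp (2 * \<kappa> * T)"
    using t \<kappa>0 J0 by (intro mult_left_mono) auto
  finally have "norm (X t \<omega>) ^ 4 \<le> (2 * exp (2 * \<kappa> * T) * (norm Y\<^sub>0 + \<kappa> * J)) ^ 4"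
    by (intro power_mono) (auto simp: algebra_simps)
  also have "\<dots> = (2 * exp (2 * \<kappa> * T)) ^ 4 * (norm Y\<^sub>0 + \<kappa> * J) ^ 4" by (rule power_mult_distrib)
  also have "\<dots> \<le> (2 * exp (2 * \<kappa> * T)) ^ 4 * (8 * (norm Y\<^sub>0 ^ 4 + (\<kappa> * J) ^ 4))"
    using \<kappa>0 J0 by (intro mult_left_mono sum4_le) auto
  also have "\<dots> \<le> (2 * exp (2 * \<kappa> * T)) ^ 4 * (8 * (norm Y\<^sub>0 ^ 4
    + \<kappa> ^ 4 * (T ^ 3 * (\<integral>u. norm (y u \<omega> - X u \<omega>) ^ 4 \<partial>lborel_on 0 T))))"
    unfolding power_mult_distrib[of \<kappa> J] using \<kappa>0
    by (intro mult_left_mono add_left_mono J4) auto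
  finally show ?thesis .
qed

text \<open>At a fixed time Y - X is \<eta> W almost surely, so its fourth moment is at most
  |\<eta>|^4 K T^2. Integrated over [0, T], this controls the expectation of the pathwise bound for
  |X|^4; then |Y|^4 <= 8 |X|^4 + 8 |Y - X|^4.\<close>

lemma norm4_Y: "\<exists>K\<ge>0. \<forall>t\<in>{0..T}. (\<integral>\<^sup>+\<omega>. ennreal (norm (Y t \<omega>) ^ 4) \<partial>M) \<le> ennreal K"
proof -
  obtain K where K0: "0 \<le> K" and K: "\<forall>s t. 0 \<le> s \<and> s \<le> t \<longrightarrow>
      (\<integral>\<^sup>+\<omega>. ennreal (norm (W t \<omega> - W s \<omega>) ^ 4) \<partial>M) \<le> ennreal (K * (t - s)\<^sup>2)"
    using increment_norm4 by blast
  define b where "b = norm \<eta> ^ 4"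
  define c where "c = b * (K * T\<^sup>2)"
  have b0: "0 \<le> b" and c0: "0 \<le> c" unfolding b_def c_def using K0 by auto
  note [measurable] = section_measurable(2)[OF y_measurable] section_measurable(2)[OF X_measurable] W_measurable
  have \<eta>W: "norm (\<eta> (W t \<omega>)) ^ 4 \<le> b * norm (W t \<omega>) ^ 4" for t \<omega>
    unfolding b_def power_mult_distrib[symmetric] by (intro power_mono norm_blinfun) auto
  have U: "(\<integral>\<^sup>+\<omega>. ennreal (norm (y t \<omega> - X t \<omega>) ^ 4) \<partial>M) \<le> ennreal c" if t: "0 \<le> t" "t \<le> T" for t
  proof -
    have [measurable]: "W t \<in> borel_measurable M" using t by (intro W_measurable)
    have "(\<integral>\<^sup>+\<omega>. ennreal (norm (y t \<omega> - X t \<omega>) ^ 4) \<partial>M) \<le> ennreal (b * (K * t\<^sup>2))"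
    proof (rule nn_integral_mult_bound[OF _ _ b0 _ _ norm4_W[OF K t(1)]])
      show "AE \<omega> in M. norm (y t \<omega> - X t \<omega>) ^ 4 \<le> b * norm (W t \<omega>) ^ 4"
        using solution_eq[OF t] by eventually_elim (use \<eta>W t in \<open>simp add: y_eq\<close>)
    qed (use K0 in auto)
    also have "\<dots> \<le> ennreal c"
      unfolding c_def using b0 K0 t by (intro ennreal_leI mult_left_mono power_mono) auto
    finally show ?thesis .
  qed
  define \<kappa> where "\<kappa> = norm A + 1"
  have \<kappa>0: "0 \<le> \<kappa>" unfolding \<kappa>_def by (simp add: add_nonneg_nonneg)
  have g: "(\<lambda>(u, \<omega>). norm (y u \<omega> - X u \<omega>) ^ 4) \<in> borel_measurable (lborel \<Otimes>\<^sub>M M)"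
    using y_measurable X_measurable unfolding case_prod_unfold by measurable
  note G = expectation_time_integral[where g="\<lambda>u \<omega>. norm (y u \<omega> - X u \<omega>) ^ 4", OF g _ U c0 T, simplified]
  define e where "e = (2 * exp (2 * \<kappa> * T)) ^ 4 * 8"
  define d where "d = e * norm Y\<^sub>0 ^ 4 + e * \<kappa> ^ 4 * T ^ 3 * (c * T)"
  have e0: "0 \<le> e" unfolding e_def by simp
  have d0: "0 \<le> d" unfolding d_def using e0 \<kappa>0 T c0 by simp
  have X4: "(\<integral>\<^sup>+\<omega>. ennreal (norm (X t \<omega>) ^ 4) \<partial>M) \<le> ennreal d" if t: "0 \<le> t" "t \<le> T" for t
    unfolding d_def
  proof (rule nn_integral_linear_bound[where g="\<lambda>_. norm Y\<^sub>0 ^ 4"])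
    show "AE \<omega> in M. norm (X t \<omega>) ^ 4 \<le> e * norm Y\<^sub>0 ^ 4
        + e * \<kappa> ^ 4 * T ^ 3 * (\<integral>u. norm (y u \<omega> - X u \<omega>) ^ 4 \<partial>lborel_on 0 T)"
      using AE_space Ay_integrable G(1)
    proof eventually_elim
      case (elim \<omega>)
      from X_pathwise_bound[OF this t \<kappa>_def] show ?case unfolding e_def by (simp add: algebra_simps)
    qed
  qed (use G e0 c0 \<kappa>0 T in \<open>auto simp: emeasure_space_1\<close>)
  have "(\<integral>\<^sup>+\<omega>. ennreal (norm (Y t \<omega>) ^ 4) \<partial>M) \<le> ennreal (8 * d + 8 * c)" if "t \<in> {0..T}" for t
  proof -
    have t: "0 \<le> t" "t \<le> T" using that by auto
    show ?thesis
    proof (rule nn_integral_linear_bound[OF _ _ _ _ _ _ _ d0 c0 X4[OF t] U[OF t]])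
      have "norm (Y t \<omega>) ^ 4 \<le> 8 * norm (X t \<omega>) ^ 4 + 8 * norm (y t \<omega> - X t \<omega>) ^ 4" for \<omega>
      proof -
        have "norm (Y t \<omega>) ^ 4 \<le> (norm (X t \<omega>) + norm (y t \<omega> - X t \<omega>)) ^ 4"
          using norm_triangle_ineq[of "X t \<omega>" "y t \<omega> - X t \<omega>"] t
          by (intro power_mono) (auto simp: y_eq)
        also have "\<dots> \<le> 8 * (norm (X t \<omega>) ^ 4 + norm (y t \<omega> - X t \<omega>) ^ 4)"
          by (rule sum4_le)
        finally show ?thesis by simp
      qed
      then show "AE \<omega> in M. norm (Y t \<omega>) ^ 4 \<le> 8 * norm (X t \<omega>) ^ 4 + 8 * norm (y t \<omega> - X t \<omega>) ^ 4" by simp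
    qed auto
  qed
  then show ?thesis using d0 c0 by (intro exI[of _ "8 * d + 8 * c"]) auto
qed

lemma norm4_y_measurable:
  "(\<lambda>(u, \<omega>). norm (y u \<omega>) ^ 4) \<in> borel_measurable (lborel \<Otimes>\<^sub>M M)"
  "(\<lambda>(u, \<omega>). norm (y u \<omega> - Y r \<omega>) ^ 4) \<in> borel_measurable (lborel \<Otimes>\<^sub>M M)" if "0 \<le> r"
proof -
  note [measurable] = Y_measurable[OF that]
  show "(\<lambda>(u, \<omega>). norm (y u \<omega>) ^ 4) \<in> borel_measurable (lborel \<Otimes>\<^sub>M M)"
    "(\<lambda>(u, \<omega>). norm (y u \<omega> - Y r \<omega>) ^ 4) \<in> borel_measurable (lborel \<Otimes>\<^sub>M M)"
    using y_measurable unfolding case_prod_unfold by measurable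
qed

text \<open>The noise gives the order (u - r)^2. The drift gives (u - r)^4, of which one factor (u -
  r)^2 is estimated by T^2.\<close>

lemma norm4_Y_increment:
  "\<exists>K\<ge>0. \<forall>r u. 0 \<le> r \<and> r \<le> u \<and> u \<le> T \<longrightarrow>
    (\<integral>\<^sup>+\<omega>. ennreal (norm (Y u \<omega> - Y r \<omega>) ^ 4) \<partial>M) \<le> ennreal (K * (u - r)\<^sup>2)"
proof -
  obtain K where K0: "0 \<le> K" and K: "\<And>s t. 0 \<le> s \<Longrightarrow> s \<le> t \<Longrightarrow>
      (\<integral>\<^sup>+\<omega>. ennreal (norm (W t \<omega> - W s \<omega>) ^ 4) \<partial>M) \<le> ennreal (K * (t - s)\<^sup>2)"
    using increment_norm4 by blast
  obtain C where C0: "0 \<le> C" and C: "\<And>t. t \<in> {0..T} \<Longrightarrow> (\<integral>\<^sup>+\<omega>. ennreal (norm (Y t \<omega>) ^ 4) \<partial>M) \<le> ennreal C"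
    using norm4_Y by blast
  define D where "D = 8 * norm A ^ 4 * T\<^sup>2 * C + 8 * norm \<eta> ^ 4 * K"
  have "(\<integral>\<^sup>+\<omega>. ennreal (norm (Y u \<omega> - Y r \<omega>) ^ 4) \<partial>M) \<le> ennreal (D * (u - r)\<^sup>2)"
    if ru: "0 \<le> r" "r \<le> u" "u \<le> T" for r u
  proof -
    interpret N: finite_measure "lborel_on r u" by (rule finite_measure_lborel_on)
    note [measurable] = increment_measurable[OF ru(1,2)]
    have Yb: "(\<integral>\<^sup>+\<omega>. ennreal (norm (y v \<omega>) ^ 4) \<partial>M) \<le> ennreal C" if "r \<le> v" "v \<le> u" for v
      using C[of v] ru that by (simp add: y_eq)
    note G = expectation_time_integral[where g="\<lambda>u \<omega>. norm (y u \<omega>) ^ 4",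
        OF norm4_y_measurable(1)[OF order_refl] _ Yb C0 ru(2), simplified]
    have "AE \<omega> in M. norm (Y u \<omega> - Y r \<omega>) ^ 4 \<le> 8 * norm A ^ 4 * (u - r) ^ 3 * (\<integral>v. norm (y v \<omega>) ^ 4 \<partial>lborel_on r u)
        + 8 * norm \<eta> ^ 4 * norm (W u \<omega> - W r \<omega>) ^ 4"
      using increment_eq[OF ru] G(1) AE_space
    proof eventually_elim
      case (elim \<omega>)
      let ?G = "\<integral>v. A (y v \<omega>) \<partial>lborel_on r u" and ?w = "\<eta> (W u \<omega> - W r \<omega>)"
      have [measurable]: "(\<lambda>v. y v \<omega>) \<in> borel_measurable (lborel_on r u)"
        by (intro measurable_restrict_space1 section_measurable(1)[OF y_measurable] elim)
      have G4: "norm ?G ^ 4 \<le> norm A ^ 4 * ((u - r) ^ 3 * (\<integral>v. norm (y v \<omega>) ^ 4 \<partial>lborel_on r u))"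
        using N.norm4_integral_blinfun_le(2)[OF _ elim(2), of A] unfolding measure_lborel_on[OF ru(2)] by simp
      have w4: "norm ?w ^ 4 \<le> norm \<eta> ^ 4 * norm (W u \<omega> - W r \<omega>) ^ 4"
        unfolding power_mult_distrib[symmetric] by (intro power_mono norm_blinfun) auto
      have "norm (Y u \<omega> - Y r \<omega>) ^ 4 \<le> (norm ?G + norm ?w) ^ 4"
        using elim(1) by (intro power_mono) (auto simp: add.assoc norm_triangle_ineq)
      also have "\<dots> \<le> 8 * (norm ?G ^ 4 + norm ?w ^ 4)" by (rule sum4_le)
      also have "\<dots> \<le> 8 * (norm A ^ 4 * ((u - r) ^ 3 * (\<integral>v. norm (y v \<omega>) ^ 4 \<partial>lborel_on r u))
          + norm \<eta> ^ 4 * norm (W u \<omega> - W r \<omega>) ^ 4)"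
        by (intro mult_left_mono add_mono G4 w4) auto
      finally show ?case by (simp add: algebra_simps)
    qed
    then have "(\<integral>\<^sup>+\<omega>. ennreal (norm (Y u \<omega> - Y r \<omega>) ^ 4) \<partial>M)
        \<le> ennreal (8 * norm A ^ 4 * (u - r) ^ 3 * (C * (u - r)) + 8 * norm \<eta> ^ 4 * (K * (u - r)\<^sup>2))"
      by (rule nn_integral_linear_bound[rotated 2]) (use G K ru C0 K0 in auto)
    also have "\<dots> \<le> ennreal (D * (u - r)\<^sup>2)"
    proof (rule ennreal_leI)
      have "8 * norm A ^ 4 * (u - r) ^ 3 * (C * (u - r)) = 8 * norm A ^ 4 * (u - r)\<^sup>2 * C * (u - r)\<^sup>2"
        by (simp add: power2_eq_square power3_eq_cube)
      also have "\<dots> \<le> 8 * norm A ^ 4 * T\<^sup>2 * C * (u - r)\<^sup>2"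
        using ru C0 by (intro mult_right_mono mult_left_mono power_mono) auto
      finally show "8 * norm A ^ 4 * (u - r) ^ 3 * (C * (u - r)) + 8 * norm \<eta> ^ 4 * (K * (u - r)\<^sup>2) \<le> D * (u - r)\<^sup>2"
        by (simp add: D_def algebra_simps)
    qed
    finally show ?thesis .
  qed
  moreover have "0 \<le> D" unfolding D_def using C0 K0 by simp
  ultimately show ?thesis by blast
qed

definition drift :: "real \<Rightarrow> 'w \<Rightarrow> 'h hs" where
  "drift u \<omega> = A (y u \<omega>) \<otimes> y u \<omega> + y u \<omega> \<otimes> A (y u \<omega>)"

lemma drift_integral_measurable: "(\<lambda>\<omega>. \<integral>u. drift u \<omega> \<partial>lborel_on r s) \<in> borel_measurable M"
proof -
  have d: "(\<lambda>(u, \<omega>). drift u \<omega>) \<in> borel_measurable (lborel \<Otimes>\<^sub>M M)"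
    using y_measurable Ay_measurable unfolding drift_def case_prod_unfold by measurable
  have "(\<lambda>(\<omega>, u). drift u \<omega>) \<in> borel_measurable (M \<Otimes>\<^sub>M lborel)"
    using measurable_pair_swap[OF d] by (simp add: case_prod_unfold)
  then show ?thesis
    by (simp add: integral_restrict_space) measurable
qed

text \<open>The part of the increment of \<open>Y \<otimes> Y\<close> that is of order \<open>(s - r)\<^bsup>3/2\<^esup>\<close> in mean square.\<close>

definition remainder :: "real \<Rightarrow> real \<Rightarrow> 'w \<Rightarrow> 'h hs" where
  "remainder r s \<omega> = Y s \<omega> \<otimes> Y s \<omega> - Y r \<omega> \<otimes> Y r \<omega> - (\<integral>u. drift u \<omega> \<partial>lborel_on r s)
     - (\<eta> (W s \<omega> - W r \<omega>) \<otimes> Y r \<omega> + Y r \<omega> \<otimes> \<eta> (W s \<omega> - W r \<omega>))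
     - \<eta> (W s \<omega> - W r \<omega>) \<otimes> \<eta> (W s \<omega> - W r \<omega>)"

lemma drift_integrable: "AE \<omega> in M. integrable (lborel_on 0 T) (\<lambda>u. drift u \<omega>)"
proof -
  interpret N: finite_measure "lborel_on 0 T" by (rule finite_measure_lborel_on)
  obtain C where C0: "0 \<le> C" and C: "\<And>t. t \<in> {0..T} \<Longrightarrow> (\<integral>\<^sup>+\<omega>. ennreal (norm (Y t \<omega>) ^ 4) \<partial>M) \<le> ennreal C"
    using norm4_Y by blast
  have Yb: "(\<integral>\<^sup>+\<omega>. ennreal (norm (y v \<omega>) ^ 4) \<partial>M) \<le> ennreal C" if "0 \<le> v" "v \<le> T" for v
    using C[of v] that by (simp add: y_eq)
  note G = expectation_time_integral[where g="\<lambda>u \<omega>. norm (y u \<omega>) ^ 4",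
      OF norm4_y_measurable(1)[OF order_refl] _ Yb C0 T, simplified]
  show ?thesis
    using G(1) AE_space
  proof eventually_elim
    case (elim \<omega>)
    have [measurable]: "(\<lambda>v. y v \<omega>) \<in> borel_measurable (lborel_on 0 T)"
      by (intro measurable_restrict_space1 section_measurable(1)[OF y_measurable] elim)
    show ?case unfolding drift_def
      by (rule N.symmetrized_tensor_integrable[OF _ elim(1)]) measurable
  qed
qed

lemma remainder_measurable:
  assumes rs: "0 \<le> r" "r \<le> s" "s \<le> T"
  shows "remainder r s \<in> borel_measurable M"
proof -
  note [measurable] = drift_integral_measurable
  have [measurable]: "Y r \<in> borel_measurable M" "Y s \<in> borel_measurable M"
    "(\<lambda>\<omega>. \<eta> (W s \<omega> - W r \<omega>)) \<in> borel_measurable M"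
    using rs by (auto intro!: Y_measurable borel_measurable_blinfun increment_measurable)
  show ?thesis unfolding remainder_def by measurable
qed

text \<open>Expectations in \<open>product_remainder_bound\<close>, with m = s - r: the fourth
  moments of Y, of its increments and of those of W yield C m, D m^3 and K m^2, so every term is at
  most a constant times m^3.\<close>

lemma remainder_bound:
  "\<exists>C\<ge>0. \<forall>r s. 0 \<le> r \<and> r \<le> s \<and> s \<le> T \<longrightarrow>
     (\<integral>\<^sup>+\<omega>. ennreal ((norm (remainder r s \<omega>))\<^sup>2) \<partial>M) \<le> ennreal (C * (s - r) ^ 3)"
proof -
  \<comment> \<open>The estimate with weight m needs a cell of positive length; for r = s the
    remainder is 0.\<close>
  have rem0: "remainder r r \<omega> = 0" for r \<omega>
  proof -
    have "(\<integral>u. drift u \<omega> \<partial>lborel_on r r) = 0"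
      unfolding LINT_eq_lborel_on[symmetric] by (rule LINT_singleton)
    moreover have "0 \<otimes> v = 0" "v \<otimes> 0 = 0" for v :: 'h
      by (simp_all add: bounded_bilinear.zero_left bounded_bilinear.zero_right bounded_bilinear_hs_tensor)
    ultimately show ?thesis by (simp add: remainder_def)
  qed
  obtain K where K0: "0 \<le> K" and K: "\<And>s t. 0 \<le> s \<Longrightarrow> s \<le> t \<Longrightarrow>
      (\<integral>\<^sup>+\<omega>. ennreal (norm (W t \<omega> - W s \<omega>) ^ 4) \<partial>M) \<le> ennreal (K * (t - s)\<^sup>2)"
    using increment_norm4 by blast
  obtain C where C0: "0 \<le> C" and C: "\<And>t. t \<in> {0..T} \<Longrightarrow> (\<integral>\<^sup>+\<omega>. ennreal (norm (Y t \<omega>) ^ 4) \<partial>M) \<le> ennreal C"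
    using norm4_Y by blast
  obtain D where D0: "0 \<le> D" and D: "\<And>r u. 0 \<le> r \<Longrightarrow> r \<le> u \<Longrightarrow> u \<le> T \<Longrightarrow>
    (\<integral>\<^sup>+\<omega>. ennreal (norm (Y u \<omega> - Y r \<omega>) ^ 4) \<partial>M) \<le> ennreal (D * (u - r)\<^sup>2)"
    using norm4_Y_increment by blast
  define b where "b = norm A"
  have b0: "0 \<le> b" unfolding b_def by simp
  \<comment> \<open>The factor T comes from m^3 <= T m^2.\<close>
  define k where "k = 6 * b\<^sup>2 + 6 * b ^ 4 + 3 * b ^ 4 * T"
  have k0: "0 \<le> k" unfolding k_def using b0 T by simp
  define E where "E = k * C + 6 * b\<^sup>2 * D + 6 * norm \<eta> ^ 4 * K"
  have "(\<integral>\<^sup>+\<omega>. ennreal ((norm (remainder r s \<omega>))\<^sup>2) \<partial>M) \<le> ennreal (E * (s - r) ^ 3)"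
    if rs: "0 \<le> r" "r < s" "s \<le> T" for r s
  proof -
    interpret N: finite_measure "lborel_on r s" by (rule finite_measure_lborel_on)
    define m where "m = s - r"
    have m: "0 < m" "m = measure (lborel_on r s) (space (lborel_on r s))" "m \<le> T"
      using rs unfolding m_def by (simp_all only: measure_lborel_on less_imp_le)
    have rs': "r \<le> s" using rs by simp
    note [measurable] = increment_measurable[OF rs(1) rs']
    have Yb: "(\<integral>\<^sup>+\<omega>. ennreal (norm (y v \<omega>) ^ 4) \<partial>M) \<le> ennreal C" if "r \<le> v" "v \<le> s" for v
      using C[of v] rs that by (simp add: y_eq)
    have Db: "(\<integral>\<^sup>+\<omega>. ennreal (norm (y v \<omega> - Y r \<omega>) ^ 4) \<partial>M) \<le> ennreal (D * m\<^sup>2)" if v: "r \<le> v" "v \<le> s" for v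
    proof -
      have "(\<integral>\<^sup>+\<omega>. ennreal (norm (y v \<omega> - Y r \<omega>) ^ 4) \<partial>M) \<le> ennreal (D * (v - r)\<^sup>2)"
        using D[of r v] rs v by (simp add: y_eq)
      also have "\<dots> \<le> ennreal (D * m\<^sup>2)"
        unfolding m_def using v D0 by (intro ennreal_leI mult_left_mono power_mono) auto
      finally show ?thesis .
    qed
    have Dm: "0 \<le> D * m\<^sup>2" using D0 by simp
    note P = expectation_time_integral[where g="\<lambda>u \<omega>. norm (y u \<omega>) ^ 4",
        OF norm4_y_measurable(1)[OF rs(1)] _ Yb C0 rs', simplified, folded m_def]
    note R = expectation_time_integral[where g="\<lambda>u \<omega>. norm (y u \<omega> - Y r \<omega>) ^ 4",
        OF norm4_y_measurable(2)[OF rs(1)] _ Db Dm rs', simplified, folded m_def]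
    let ?P = "\<lambda>\<omega>. \<integral>u. norm (y u \<omega>) ^ 4 \<partial>lborel_on r s"
    let ?R = "\<lambda>\<omega>. \<integral>u. norm (y u \<omega> - Y r \<omega>) ^ 4 \<partial>lborel_on r s"
    let ?w = "\<lambda>\<omega>. norm (W s \<omega> - W r \<omega>) ^ 4"
    have 1: "(\<integral>\<^sup>+\<omega>. ennreal (6 * b\<^sup>2 * ?R \<omega> + 6 * (m * norm \<eta> ^ 4) * ?w \<omega>) \<partial>M)
        \<le> ennreal (6 * b\<^sup>2 * (D * m\<^sup>2 * m) + 6 * (m * norm \<eta> ^ 4) * (K * m\<^sup>2))"
      by (rule nn_integral_linear_bound) (use R K[OF rs(1) rs'] K0 D0 m b0 in \<open>auto simp: m_def\<close>)
    have "AE \<omega> in M. (norm (remainder r s \<omega>))\<^sup>2 \<le> k * m\<^sup>2 * ?P \<omega>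
        + 1 * (6 * b\<^sup>2 * ?R \<omega> + 6 * (m * norm \<eta> ^ 4) * ?w \<omega>)"
      using increment_eq[OF rs(1) rs' rs(3)] P(1) AE_space
    proof eventually_elim
      case (elim \<omega>)
      have [measurable]: "(\<lambda>v. y v \<omega>) \<in> borel_measurable (lborel_on r s)"
        by (intro measurable_restrict_space1 section_measurable(1)[OF y_measurable] elim)
      let ?d = "\<eta> (W s \<omega> - W r \<omega>)"
      have d4: "norm ?d ^ 4 \<le> norm \<eta> ^ 4 * ?w \<omega>"
        unfolding power_mult_distrib[symmetric] by (intro power_mono norm_blinfun) auto
      have "(norm (remainder r s \<omega>))\<^sup>2 \<le> (6 * b\<^sup>2 + 6 * b ^ 4) * (m\<^sup>2 * ?P \<omega>)
        + 3 * b ^ 4 * (m ^ 3 * ?P \<omega>) + 6 * b\<^sup>2 * ?R \<omega> + 6 * (m * norm ?d ^ 4)"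
        using N.product_remainder_bound[OF _ elim(2) m(2,1) refl, where A=A and c="Y r \<omega>" and w="?d"]
        unfolding remainder_def drift_def b_def elim(1)[symmetric] by simp
      moreover have "3 * b ^ 4 * (m ^ 3 * ?P \<omega>) \<le> 3 * b ^ 4 * (T * m\<^sup>2 * ?P \<omega>)"
      proof (intro mult_left_mono mult_right_mono)
        show "m ^ 3 \<le> T * m\<^sup>2" using m by (simp add: power3_eq_cube power2_eq_square mult_right_mono)
      qed (use b0 in auto)
      moreover have "6 * (m * norm ?d ^ 4) \<le> 6 * (m * (norm \<eta> ^ 4 * ?w \<omega>))"
        using m d4 by (intro mult_left_mono) auto
      moreover have "k * m\<^sup>2 * ?P \<omega> = (6 * b\<^sup>2 + 6 * b ^ 4) * (m\<^sup>2 * ?P \<omega>) + 3 * b ^ 4 * (T * m\<^sup>2 * ?P \<omega>)"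
        by (simp add: k_def algebra_simps)
      moreover have "6 * (m * (norm \<eta> ^ 4 * ?w \<omega>)) = 6 * (m * norm \<eta> ^ 4) * ?w \<omega>" by simp
      \<comment> \<open>The estimates are added with the long terms abstracted to real variables;
        \<open>p\<close> stands for \<open>k * m\<^sup>2 * ?P \<omega>\<close>.\<close>
      moreover have "x \<le> p + 1 * (q + e)"
        if "x \<le> a1 + a2 + q + a4" "a2 \<le> b2" "a4 \<le> b4" "p = a1 + b2" "b4 = e"
        for x p q e a1 a2 a4 b2 b4 :: real using that by simp
      ultimately show ?case by blast
    qed
    then have "(\<integral>\<^sup>+\<omega>. ennreal ((norm (remainder r s \<omega>))\<^sup>2) \<partial>M)
        \<le> ennreal (k * m\<^sup>2 * (C * m) + 1 * (6 * b\<^sup>2 * (D * m\<^sup>2 * m) + 6 * (m * norm \<eta> ^ 4) * (K * m\<^sup>2)))"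
      by (rule nn_integral_linear_bound[rotated 2, OF _ _ _ _ _ _ _ _ 1]) (use P R m k0 b0 C0 D0 K0 in auto)
    also have "\<dots> = ennreal (E * m ^ 3)"
      by (simp add: E_def algebra_simps power2_eq_square power3_eq_cube)
    finally show ?thesis by (simp add: m_def)
  qed
  then have "(\<integral>\<^sup>+\<omega>. ennreal ((norm (remainder r s \<omega>))\<^sup>2) \<partial>M) \<le> ennreal (E * (s - r) ^ 3)"
    if "0 \<le> r" "r \<le> s" "s \<le> T" for r s
    using that rem0[of r] by (cases "r = s") auto
  moreover have "0 \<le> E" unfolding E_def using k0 C0 D0 K0 by simp
  ultimately show ?thesis by blast
qed

end

subsection \<open>Quadratic variation and simple approximation\<close>

context hilbert_wiener begin

text \<open>Polarisation of the second moments; the mixed terms combine because \<open>Q\<close> is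
  symmetric.\<close>

lemma increment_covariance:
  assumes st: "0 \<le> s" "s \<le> t"
  shows "has_bochner_integral M (\<lambda>\<omega>. ((W t \<omega> - W s \<omega>) \<bullet> h) * ((W t \<omega> - W s \<omega>) \<bullet> k)) ((t - s) * (Q h \<bullet> k))"
proof -
  have "has_bochner_integral M (\<lambda>\<omega>. (((W t \<omega> - W s \<omega>) \<bullet> (h + k))\<^sup>2 - ((W t \<omega> - W s \<omega>) \<bullet> (h - k))\<^sup>2) / 4)
      (((t - s) * (Q (h + k) \<bullet> (h + k)) - (t - s) * (Q (h - k) \<bullet> (h - k))) / 4)"
    by (intro has_bochner_integral_divide_zero has_bochner_integral_diff increment_moments(2) st)
  moreover have "((v \<bullet> (h + k))\<^sup>2 - (v \<bullet> (h - k))\<^sup>2) / 4 = (v \<bullet> h) * (v \<bullet> k)" for v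
    by (simp add: inner_add_right inner_diff_right power2_eq_square algebra_simps)
  moreover have "((t - s) * (Q (h + k) \<bullet> (h + k)) - (t - s) * (Q (h - k) \<bullet> (h - k))) / 4 = (t - s) * (Q h \<bullet> k)"
    using Q_symmetric[of k h]
    by (simp add: blinfun.add_right blinfun.diff_right inner_add inner_diff inner_commute field_simps)
  ultimately show ?thesis by simp
qed

text \<open>The deviation of the quadratic variation of \<open>\<eta> W\<close> over \<open>[s, t]\<close> from its mean.\<close>

definition qv_error :: "('h \<Rightarrow>\<^sub>L 'h) \<Rightarrow> real \<Rightarrow> 'h \<Rightarrow> 'h hs" where
  "qv_error \<eta> c v = \<eta> v \<otimes> \<eta> v - c *\<^sub>R hs_of_blinfun (\<eta> o\<^sub>L Q o\<^sub>L adj \<eta>)"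

lemma qv_error_measurable [measurable]: "qv_error \<eta> c \<in> borel_measurable borel"
proof -
  have [measurable]: "blinfun_apply \<eta> \<in> borel_measurable borel"
    by (intro borel_measurable_continuous_onI continuous_intros)
  show ?thesis unfolding qv_error_def[abs_def] by measurable
qed

text \<open>Matrix coefficients are bounded functionals of a Hilbert-Schmidt operator, so they pass
  through the Bochner integral in \<open>qv_error_mean\<close>.\<close>

lemma bounded_linear_blinfun_of_hs: "bounded_linear (\<lambda>S :: 'h hs. blinfun_of_hs S x \<bullet> z)"
proof (rule bounded_linear_intro)
  show "norm (blinfun_of_hs S x \<bullet> z) \<le> norm S * (norm x * norm z)" for S :: "'h hs"
  proof -
    have "\<bar>blinfun_of_hs S x \<bullet> z\<bar> \<le> norm (blinfun_of_hs S x) * norm z" by (rule Cauchy_Schwarz_ineq2)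
    also have "\<dots> \<le> norm (blinfun_of_hs S) * norm x * norm z" by (intro mult_right_mono norm_blinfun) auto
    also have "\<dots> \<le> norm S * norm x * norm z" by (intro mult_right_mono norm_blinfun_of_hs) auto
    finally show ?thesis by (simp add: mult.assoc)
  qed
qed (simp_all add: plus_hs.rep_eq scaleR_hs.rep_eq blinfun.add_left blinfun.scaleR_left inner_add_left)

text \<open>Tested against x and z, the mean of the tensor square of \<eta> (W t - W s) is the
  covariance of the projections of W t - W s on \<open>adj \<eta> x\<close> and
  \<open>adj \<eta> z\<close>, which is (t - s) times the coefficient of \<eta> Q \<eta>*.\<close>

lemma qv_error_mean:
  assumes st: "0 \<le> s" "s \<le> t"
  shows "(\<integral>\<omega>. qv_error \<eta> (t - s) (W t \<omega> - W s \<omega>) \<bullet> u \<partial>M) = 0"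
proof -
  let ?D = "\<lambda>\<omega>. \<eta> (W t \<omega> - W s \<omega>)" and ?H = "hs_of_blinfun (\<eta> o\<^sub>L Q o\<^sub>L adj \<eta>)"
  have [measurable]: "?D \<in> borel_measurable M"
    by (intro borel_measurable_blinfun increment_measurable st)
  have int: "integrable M (\<lambda>\<omega>. ?D \<omega> \<otimes> ?D \<omega>)"
  proof (rule Bochner_Integration.integrable_bound)
    show "integrable M (\<lambda>\<omega>. (norm (?D \<omega>))\<^sup>2)"
      using increment_q_norm2(1)[OF st, of \<eta>] by (simp add: has_bochner_integral_iff)
  qed (auto simp: norm_hs_tensor power2_eq_square)
  have "(\<integral>\<omega>. ?D \<omega> \<otimes> ?D \<omega> \<partial>M) = (t - s) *\<^sub>R ?H"
  proof (rule hs_eqI)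
    fix x
    have "blinfun_of_hs (\<integral>\<omega>. ?D \<omega> \<otimes> ?D \<omega> \<partial>M) x \<bullet> z = blinfun_of_hs ((t - s) *\<^sub>R ?H) x \<bullet> z" for z
    proof -
      have "blinfun_of_hs (\<integral>\<omega>. ?D \<omega> \<otimes> ?D \<omega> \<partial>M) x \<bullet> z = (\<integral>\<omega>. blinfun_of_hs (?D \<omega> \<otimes> ?D \<omega>) x \<bullet> z \<partial>M)"
        by (rule integral_bounded_linear[OF bounded_linear_blinfun_of_hs int, symmetric])
      also have "\<dots> = (\<integral>\<omega>. ((W t \<omega> - W s \<omega>) \<bullet> adj \<eta> x) * ((W t \<omega> - W s \<omega>) \<bullet> adj \<eta> z) \<partial>M)"
        by (simp add: hs_tensor_apply adj_works)
      also have "\<dots> = (t - s) * (Q (adj \<eta> x) \<bullet> adj \<eta> z)"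
        by (rule has_bochner_integral_integral_eq[OF increment_covariance[OF st]])
      also have "\<dots> = blinfun_of_hs ((t - s) *\<^sub>R ?H) x \<bullet> z"
        using hilbert_schmidt_sandwich[OF trace_class_Q, of \<eta>]
        by (simp add: scaleR_hs.rep_eq blinfun.scaleR_left hs_of_blinfun_inverse adj_works[of \<eta>])
      finally show ?thesis .
    qed
    then show "blinfun_of_hs (\<integral>\<omega>. ?D \<omega> \<otimes> ?D \<omega> \<partial>M) x = blinfun_of_hs ((t - s) *\<^sub>R ?H) x"
      using vector_eq_rdot by blast
  qed
  then have "(\<integral>\<omega>. qv_error \<eta> (t - s) (W t \<omega> - W s \<omega>) \<partial>M) = 0"
    using int by (simp add: qv_error_def prob_space)
  moreover have "integrable M (\<lambda>\<omega>. qv_error \<eta> (t - s) (W t \<omega> - W s \<omega>))"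
    using int by (simp add: qv_error_def)
  ultimately show ?thesis by simp
qed

text \<open>The norm of v \<otimes> v is |v|^2, so the second moment of the tensor part is
  controlled by the fourth moment of the increment of W.\<close>

lemma qv_error_bound:
  "\<exists>C\<ge>0. \<forall>s t. 0 \<le> s \<and> s \<le> t \<longrightarrow>
     integrable M (\<lambda>\<omega>. (norm (qv_error \<eta> (t - s) (W t \<omega> - W s \<omega>)))\<^sup>2) \<and>
     (\<integral>\<omega>. (norm (qv_error \<eta> (t - s) (W t \<omega> - W s \<omega>)))\<^sup>2 \<partial>M) \<le> C * (t - s)\<^sup>2"
proof -
  obtain K where K0: "0 \<le> K" and K: "\<And>s t. 0 \<le> s \<Longrightarrow> s \<le> t \<Longrightarrow>
      (\<integral>\<^sup>+\<omega>. ennreal (norm (W t \<omega> - W s \<omega>) ^ 4) \<partial>M) \<le> ennreal (K * (t - s)\<^sup>2)"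
    using increment_norm4 by blast
  define H where "H = (norm (hs_of_blinfun (\<eta> o\<^sub>L Q o\<^sub>L adj \<eta>)))\<^sup>2"
  define C where "C = 2 * norm \<eta> ^ 4 * K + 2 * H"
  have H0: "0 \<le> H" and C0: "0 \<le> C" unfolding C_def H_def using K0 by auto
  have "integrable M (\<lambda>\<omega>. (norm (qv_error \<eta> (t - s) (W t \<omega> - W s \<omega>)))\<^sup>2) \<and>
     (\<integral>\<omega>. (norm (qv_error \<eta> (t - s) (W t \<omega> - W s \<omega>)))\<^sup>2 \<partial>M) \<le> C * (t - s)\<^sup>2"
    if st: "0 \<le> s" "s \<le> t" for s t
  proof -
    note [measurable] = increment_measurable[OF st]
    let ?E = "\<lambda>\<omega>. qv_error \<eta> (t - s) (W t \<omega> - W s \<omega>)"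
    have [measurable]: "?E \<in> borel_measurable M"
      by (rule measurable_compose[OF increment_measurable[OF st] qv_error_measurable])
    have pt: "(norm (qv_error \<eta> c v))\<^sup>2 \<le> 2 * norm \<eta> ^ 4 * norm v ^ 4 + 2 * H * c\<^sup>2" for v c
    proof -
      have "norm (qv_error \<eta> c v) \<le> norm (\<eta> v) * norm (\<eta> v) + \<bar>c\<bar> * sqrt H"
        unfolding qv_error_def H_def by (rule order_trans[OF norm_triangle_ineq4]) (simp add: norm_hs_tensor)
      also have "\<dots> \<le> (norm \<eta> * norm v) * (norm \<eta> * norm v) + \<bar>c\<bar> * sqrt H"
        by (intro add_right_mono mult_mono norm_blinfun) auto
      also have "\<dots> = (norm \<eta>)\<^sup>2 * (norm v)\<^sup>2 + \<bar>c\<bar> * sqrt H" by (simp add: power2_eq_square)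
      finally have "(norm (qv_error \<eta> c v))\<^sup>2 \<le> ((norm \<eta>)\<^sup>2 * (norm v)\<^sup>2 + \<bar>c\<bar> * sqrt H)\<^sup>2"
        by (intro power_mono) auto
      also have "\<dots> \<le> 2 * (((norm \<eta>)\<^sup>2 * (norm v)\<^sup>2)\<^sup>2 + (\<bar>c\<bar> * sqrt H)\<^sup>2)"
        by (rule sum2_le)
      also have "\<dots> = 2 * norm \<eta> ^ 4 * norm v ^ 4 + 2 * H * c\<^sup>2"
        using H0 by (simp add: power_mult_distrib flip: power_mult)
      finally show ?thesis .
    qed
    have "(\<integral>\<^sup>+\<omega>. ennreal ((norm (?E \<omega>))\<^sup>2) \<partial>M) \<le> ennreal (2 * norm \<eta> ^ 4 * (K * (t - s)\<^sup>2) + 2 * H * (t - s)\<^sup>2)"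
      by (rule nn_integral_linear_bound[where g="\<lambda>\<omega>. norm (W t \<omega> - W s \<omega>) ^ 4" and h="\<lambda>_. (t - s)\<^sup>2"])
        (use pt K[OF st] K0 H0 in \<open>auto simp: emeasure_space_1\<close>)
    also have "2 * norm \<eta> ^ 4 * (K * (t - s)\<^sup>2) + 2 * H * (t - s)\<^sup>2 = C * (t - s)\<^sup>2"
      by (simp add: C_def algebra_simps)
    finally have le: "(\<integral>\<^sup>+\<omega>. ennreal ((norm (?E \<omega>))\<^sup>2) \<partial>M) \<le> ennreal (C * (t - s)\<^sup>2)" .
    have int: "integrable M (\<lambda>\<omega>. (norm (?E \<omega>))\<^sup>2)"
      using le by (intro integrableI_nonneg) (auto simp: less_top[symmetric] top_unique)
    with le have "ennreal (\<integral>\<omega>. (norm (?E \<omega>))\<^sup>2 \<partial>M) \<le> ennreal (C * (t - s)\<^sup>2)"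
      by (simp add: nn_integral_eq_integral)
    with int show ?thesis using C0 by (simp add: ennreal_le_iff)
  qed
  with C0 show ?thesis by blast
qed

text \<open>For j < k the j-th error is known at time \<open>t k\<close>, and the k-th is a centred
  function of the increment that follows. The mixed terms vanish and second moments add, which gives
  a factor n instead of n^2.\<close>

lemma qv_error_sum:
  "\<exists>C\<ge>0. \<forall>n t \<delta>. 0 \<le> t 0 \<and> (\<forall>k. t (Suc k) = t k + \<delta>) \<and> 0 \<le> \<delta> \<longrightarrow>
     (\<integral>\<^sup>+\<omega>. ennreal ((norm (\<Sum>k<n. qv_error \<eta> \<delta> (W (t (Suc k)) \<omega> - W (t k) \<omega>)))\<^sup>2) \<partial>M)
       \<le> ennreal (real n * (C * \<delta>\<^sup>2))"
proof -
  obtain C where C0: "0 \<le> C" and i: "\<And>s t. 0 \<le> s \<Longrightarrow> s \<le> t \<Longrightarrow>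
      integrable M (\<lambda>\<omega>. (norm (qv_error \<eta> (t - s) (W t \<omega> - W s \<omega>)))\<^sup>2)"
    and C: "\<And>s t. 0 \<le> s \<Longrightarrow> s \<le> t \<Longrightarrow>
     (\<integral>\<omega>. (norm (qv_error \<eta> (t - s) (W t \<omega> - W s \<omega>)))\<^sup>2 \<partial>M) \<le> C * (t - s)\<^sup>2"
    using qv_error_bound[of \<eta>] by blast
  have "(\<integral>\<^sup>+\<omega>. ennreal ((norm (\<Sum>k<n. qv_error \<eta> \<delta> (W (t (Suc k)) \<omega> - W (t k) \<omega>)))\<^sup>2) \<partial>M)
       \<le> ennreal (real n * (C * \<delta>\<^sup>2))"
    if t0: "0 \<le> t 0" and t1: "\<And>k. t (Suc k) = t k + \<delta>" and \<delta>: "0 \<le> \<delta>" for n t \<delta>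
  proof -
    have mono: "t j \<le> t k" if "j \<le> k" for j k
      by (rule lift_Suc_mono_le[OF _ that]) (simp add: t1 \<delta>)
    have pos: "0 \<le> t k" for k using mono[of 0 k] t0 by simp
    have diff: "t (Suc k) - t k = \<delta>" for k by (simp add: t1)
    have step: "t k \<le> t (Suc k)" for k by (rule mono) simp
    let ?E = "\<lambda>k \<omega>. qv_error \<eta> \<delta> (W (t (Suc k)) \<omega> - W (t k) \<omega>)"
    have EF: "?E j \<in> borel_measurable (F (t k))" if "j < k" for j k
    proof -
      have "t (Suc j) \<le> t k" using that by (intro mono) auto
      then have [measurable]: "W (t (Suc j)) \<in> borel_measurable (F (t k))" "W (t j) \<in> borel_measurable (F (t k))"
        using pos step[of j] by (auto intro!: measurable_F_mono[OF _ _ W_measurable_F])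
      show ?thesis by (rule measurable_compose[OF _ qv_error_measurable]) measurable
    qed
    have [measurable]: "?E k \<in> borel_measurable M" for k
      by (rule measurable_F[OF _ EF[of k "Suc k"]]) (auto simp: pos)
    have Ei: "integrable M (\<lambda>\<omega>. (norm (?E k \<omega>))\<^sup>2)" for k
      using i[OF pos step, of k] unfolding diff .
    have EC: "(\<integral>\<omega>. (norm (?E k \<omega>))\<^sup>2 \<partial>M) \<le> C * \<delta>\<^sup>2" for k
      using C[OF pos step, of k] unfolding diff .
    have less: "(\<integral>\<omega>. ?E j \<omega> \<bullet> ?E k \<omega> \<partial>M) = 0" if "j < k" for j k
      by (rule increment_orthogonal[where \<phi>="qv_error \<eta> \<delta>", OF pos step EF[OF that] Ei qv_error_measurable Ei])
        (use qv_error_mean[OF pos step, of \<eta> k] in \<open>simp add: diff\<close>)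
    have orth: "(\<integral>\<omega>. ?E j \<omega> \<bullet> ?E k \<omega> \<partial>M) = (if j = k then (\<integral>\<omega>. (norm (?E k \<omega>))\<^sup>2 \<partial>M) else 0)" for j k
      using less[of j k] less[of k j] by (cases j k rule: linorder_cases) (simp_all add: inner_commute power2_norm_eq_inner)
    have ij: "integrable M (\<lambda>\<omega>. ?E j \<omega> \<bullet> ?E k \<omega>)" for j k
      by (rule integrable_inner_of_squares(2)) (simp_all add: Ei)
    have sq: "(norm (\<Sum>k<n. ?E k \<omega>))\<^sup>2 = (\<Sum>j<n. \<Sum>k<n. ?E j \<omega> \<bullet> ?E k \<omega>)" for \<omega>
      by (simp add: power2_norm_eq_inner inner_sum_left inner_sum_right) (rule sum.swap)
    have "(\<integral>\<omega>. (norm (\<Sum>k<n. ?E k \<omega>))\<^sup>2 \<partial>M) = (\<Sum>j<n. \<Sum>k<n. \<integral>\<omega>. ?E j \<omega> \<bullet> ?E k \<omega> \<partial>M)"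
      unfolding sq by (simp add: Bochner_Integration.integral_sum ij)
    also have "\<dots> = (\<Sum>j<n. \<integral>\<omega>. (norm (?E j \<omega>))\<^sup>2 \<partial>M)"
      unfolding orth by (simp add: sum.delta')
    also have "\<dots> \<le> real n * (C * \<delta>\<^sup>2)"
      using sum_bounded_above[of "{..<n}" "\<lambda>j. \<integral>\<omega>. (norm (?E j \<omega>))\<^sup>2 \<partial>M" "C * \<delta>\<^sup>2"] EC by simp
    finally have le: "(\<integral>\<omega>. (norm (\<Sum>k<n. ?E k \<omega>))\<^sup>2 \<partial>M) \<le> real n * (C * \<delta>\<^sup>2)" .
    have "integrable M (\<lambda>\<omega>. (norm (\<Sum>k<n. ?E k \<omega>))\<^sup>2)" unfolding sq by (intro Bochner_Integration.integrable_sum ij)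
    then show ?thesis using le by (subst nn_integral_eq_integral) (auto intro: ennreal_leI)
  qed
  with C0 show ?thesis by blast
qed

text \<open>Dominated convergence along simple functions with |g_i| <= 2 |f|, hence |g_i - f|^2 <= 9
  |f|^2. The weight is measurable for \<open>M\<close> rather than for \<open>F r\<close>: it will
  contain an increment of W after time r, while \<open>g\<close> must be known at r.\<close>

lemma simple_approximation:
  fixes f :: "'w \<Rightarrow> 'h" and D :: "'w \<Rightarrow> real"
  assumes r: "0 \<le> r" and f: "f \<in> borel_measurable (F r)" and [measurable]: "D \<in> borel_measurable M"
    and D0: "\<And>\<omega>. 0 \<le> D \<omega>"
    and fin: "(\<integral>\<^sup>+\<omega>. ennreal ((norm (f \<omega>))\<^sup>2 * D \<omega>) \<partial>M) < \<infinity>" and \<epsilon>: "0 < \<epsilon>"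
  shows "\<exists>g. simple_function (F r) g \<and> (\<integral>\<^sup>+\<omega>. ennreal ((norm (g \<omega> - f \<omega>))\<^sup>2 * D \<omega>) \<partial>M) \<le> ennreal \<epsilon>"
proof -
  obtain g where sg: "\<And>i. simple_function (F r) (g i)"
    and lim: "\<And>x. x \<in> space (F r) \<Longrightarrow> (\<lambda>i. g i x) \<longlonglongrightarrow> f x"
    and bd: "\<And>i x. x \<in> space (F r) \<Longrightarrow> dist (g i x) 0 \<le> 2 * dist (f x) 0"
    using borel_measurable_implies_sequence_metric[OF f, of 0] by blast
  have [measurable]: "f \<in> borel_measurable M" "g i \<in> borel_measurable M" for i
    using measurable_F[OF r f] measurable_F[OF r borel_measurable_simple_function[OF sg]] by auto
  have "(\<lambda>i. \<integral>\<^sup>+\<omega>. ennreal ((norm (g i \<omega> - f \<omega>))\<^sup>2 * D \<omega>) \<partial>M) \<longlonglongrightarrow> (\<integral>\<^sup>+\<omega>. 0 \<partial>M)"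
  proof (rule nn_integral_dominated_convergence[where w="\<lambda>\<omega>. 9 * ennreal ((norm (f \<omega>))\<^sup>2 * D \<omega>)"])
    show "(\<integral>\<^sup>+\<omega>. 9 * ennreal ((norm (f \<omega>))\<^sup>2 * D \<omega>) \<partial>M) < \<infinity>"
      using fin by (simp add: nn_integral_cmult ennreal_mult_less_top)
    show "AE \<omega> in M. ennreal ((norm (g i \<omega> - f \<omega>))\<^sup>2 * D \<omega>) \<le> 9 * ennreal ((norm (f \<omega>))\<^sup>2 * D \<omega>)" for i
    proof (rule AE_I2)
      fix \<omega> assume "\<omega> \<in> space M"
      then have "norm (g i \<omega> - f \<omega>) \<le> 3 * norm (f \<omega>)"
        using bd[of \<omega> i] norm_triangle_ineq4[of "g i \<omega>" "f \<omega>"] r by (simp add: space_F)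
      then have "(norm (g i \<omega> - f \<omega>))\<^sup>2 \<le> (3 * norm (f \<omega>))\<^sup>2" by (intro power_mono) auto
      then have "(norm (g i \<omega> - f \<omega>))\<^sup>2 * D \<omega> \<le> 9 * ((norm (f \<omega>))\<^sup>2 * D \<omega>)"
        using mult_right_mono[OF _ D0] by (fastforce simp: power_mult_distrib mult.assoc)
      then have "ennreal ((norm (g i \<omega> - f \<omega>))\<^sup>2 * D \<omega>) \<le> ennreal (9 * ((norm (f \<omega>))\<^sup>2 * D \<omega>))"
        by (rule ennreal_leI)
      then show "ennreal ((norm (g i \<omega> - f \<omega>))\<^sup>2 * D \<omega>) \<le> 9 * ennreal ((norm (f \<omega>))\<^sup>2 * D \<omega>)"
        using D0 by (simp add: ennreal_mult')
    qed
    show "AE \<omega> in M. (\<lambda>i. ennreal ((norm (g i \<omega> - f \<omega>))\<^sup>2 * D \<omega>)) \<longlonglongrightarrow> 0"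
    proof (rule AE_I2)
      fix \<omega> assume "\<omega> \<in> space M"
      then have "(\<lambda>i. (norm (g i \<omega> - f \<omega>))\<^sup>2 * D \<omega>) \<longlonglongrightarrow> (norm (f \<omega> - f \<omega>))\<^sup>2 * D \<omega>"
        using r by (intro tendsto_intros lim) (simp add: space_F)
      then show "(\<lambda>i. ennreal ((norm (g i \<omega> - f \<omega>))\<^sup>2 * D \<omega>)) \<longlonglongrightarrow> 0"
        using tendsto_ennrealI by fastforce
    qed
  qed simp_all
  then have "(\<lambda>i. \<integral>\<^sup>+\<omega>. ennreal ((norm (g i \<omega> - f \<omega>))\<^sup>2 * D \<omega>) \<partial>M) \<longlonglongrightarrow> 0" by simp
  from order_tendstoD(2)[OF this, of "ennreal \<epsilon>"] \<epsilon>
  obtain i where "(\<integral>\<^sup>+\<omega>. ennreal ((norm (g i \<omega> - f \<omega>))\<^sup>2 * D \<omega>) \<partial>M) < ennreal \<epsilon>"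
    by (auto simp: eventually_sequentially)
  with sg show ?thesis by (auto intro: less_imp_le)
qed

text \<open>One tuple for each value of \<open>g\<close>, restricted to its level set; at each
  \<omega> exactly one of these sets is hit.\<close>

lemma simple_segment:
  fixes L :: "'h \<Rightarrow> 'h \<Rightarrow>\<^sub>L 'u::real_inner"
  assumes rs: "0 \<le> r" "r \<le> s" and g: "simple_function (F r) g"
  shows "\<exists>xs. simple_adapted F xs \<and>
    (\<forall>\<omega>\<in>space M. \<forall>u. simple_process xs u \<omega> = (if r < u \<and> u \<le> s then L (g \<omega>) else 0)) \<and>
    (\<forall>\<omega>\<in>space M. \<forall>t. simple_integral W xs t \<omega> = L (g \<omega>) (W (min s t) \<omega> - W (min r t) \<omega>))"
proof -
  have "finite (g ` space M)" using simple_functionD(1)[OF g] rs by (simp add: space_F)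
  then obtain vs where vs: "set vs = g ` space M" "distinct vs" using finite_distinct_list by blast
  define xs where "xs = map (\<lambda>v. (r, s, {\<omega> \<in> space M. g \<omega> = v}, L v)) vs"
  have "{\<omega> \<in> space M. g \<omega> = v} \<in> sets (F r)" for v
  proof -
    have "{\<omega> \<in> space M. g \<omega> = v} = g -` {v} \<inter> space (F r)" using rs by (auto simp: space_F)
    then show ?thesis using simple_functionD(2)[OF g] by simp
  qed
  then have "simple_adapted F xs" using rs by (auto simp: simple_adapted_def xs_def)
  moreover have "simple_process xs u \<omega> = (if r < u \<and> u \<le> s then L (g \<omega>) else 0)"
    if "\<omega> \<in> space M" for u \<omega>
  proof -
    have "simple_process xs u \<omega> = (\<Sum>v\<in>g ` space M. if r < u \<and> u \<le> s \<and> g \<omega> = v then L v else 0)"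
      using that vs unfolding simple_process_def xs_def
      by (simp add: o_def sum_list_distinct_conv_sum_set)
    also have "\<dots> = (\<Sum>v\<in>g ` space M. if g \<omega> = v then (if r < u \<and> u \<le> s then L v else 0) else 0)"
      by (intro sum.cong) auto
    also have "\<dots> = (if r < u \<and> u \<le> s then L (g \<omega>) else 0)"
      using that \<open>finite (g ` space M)\<close> by (subst sum.delta') auto
    finally show ?thesis .
  qed
  moreover have "simple_integral W xs t \<omega> = L (g \<omega>) (W (min s t) \<omega> - W (min r t) \<omega>)"
    if "\<omega> \<in> space M" for t \<omega>
  proof -
    have "simple_integral W xs t \<omega> = (\<Sum>v\<in>g ` space M. if g \<omega> = v then L v (W (min s t) \<omega> - W (min r t) \<omega>) else 0)"
      using that vs unfolding simple_integral_def xs_def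
      by (simp add: o_def sum_list_distinct_conv_sum_set)
    then show ?thesis using that \<open>finite (g ` space M)\<close> by (subst (asm) sum.delta') auto
  qed
  ultimately show ?thesis by blast
qed

lemma simple_on_grid:
  fixes L :: "'h \<Rightarrow> 'h \<Rightarrow>\<^sub>L 'u::real_inner" and t :: "nat \<Rightarrow> real"
  assumes "\<And>k. k < n \<Longrightarrow> 0 \<le> t k" "\<And>k. k < n \<Longrightarrow> t k \<le> t (Suc k)"
    and "\<And>k. k < n \<Longrightarrow> simple_function (F (t k)) (g k)"
  shows "\<exists>xs. simple_adapted F xs \<and>
    (\<forall>\<omega>\<in>space M. \<forall>u. simple_process xs u \<omega> = (\<Sum>k<n. if t k < u \<and> u \<le> t (Suc k) then L (g k \<omega>) else 0)) \<and>
    (\<forall>\<omega>\<in>space M. \<forall>T. simple_integral W xs T \<omega>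
      = (\<Sum>k<n. L (g k \<omega>) (W (min (t (Suc k)) T) \<omega> - W (min (t k) T) \<omega>)))"
  using assms
proof (induction n)
  case 0
  show ?case by (intro exI[of _ "[]"]) (simp add: simple_adapted_def simple_process_def simple_integral_def)
next
  case (Suc n)
  obtain xs where xs: "simple_adapted F xs"
    "\<forall>\<omega>\<in>space M. \<forall>u. simple_process xs u \<omega> = (\<Sum>k<n. if t k < u \<and> u \<le> t (Suc k) then L (g k \<omega>) else 0)"
    "\<forall>\<omega>\<in>space M. \<forall>T. simple_integral W xs T \<omega>
      = (\<Sum>k<n. L (g k \<omega>) (W (min (t (Suc k)) T) \<omega> - W (min (t k) T) \<omega>))"
  proof -
    have "\<And>k. k < n \<Longrightarrow> 0 \<le> t k" "\<And>k. k < n \<Longrightarrow> t k \<le> t (Suc k)"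
      "\<And>k. k < n \<Longrightarrow> simple_function (F (t k)) (g k)"
      using Suc.prems by auto
    from Suc.IH[OF this] show thesis using that by blast
  qed
  obtain zs where zs: "simple_adapted F zs"
    "\<forall>\<omega>\<in>space M. \<forall>u. simple_process zs u \<omega> = (if t n < u \<and> u \<le> t (Suc n) then L (g n \<omega>) else 0)"
    "\<forall>\<omega>\<in>space M. \<forall>T. simple_integral W zs T \<omega> = L (g n \<omega>) (W (min (t (Suc n)) T) \<omega> - W (min (t n) T) \<omega>)"
    using simple_segment[of "t n" "t (Suc n)" "g n" L] Suc.prems by blast
  have "simple_process (xs @ zs) u \<omega> = simple_process xs u \<omega> + simple_process zs u \<omega>"
    "simple_integral W (xs @ zs) T \<omega> = simple_integral W xs T \<omega> + simple_integral W zs T \<omega>" for u T \<omega>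
    by (simp_all add: simple_process_def simple_integral_def)
  moreover have "simple_adapted F (xs @ zs)" using xs zs by (auto simp: simple_adapted_def)
  ultimately show ?case using xs zs by (intro exI[of _ "xs @ zs"]) simp
qed

end

subsection \<open>Convergence of the Riemann sums\<close>

lemma norm_sum_power2_le:
  fixes x :: "nat \<Rightarrow> 'a::real_normed_vector"
  shows "(norm (\<Sum>k<n. x k))\<^sup>2 \<le> real n * (\<Sum>k<n. (norm (x k))\<^sup>2)"
proof -
  have "(norm (\<Sum>k<n. x k))\<^sup>2 \<le> (\<Sum>k<n. 1 * norm (x k))\<^sup>2"
    by (intro power_mono) (simp_all add: norm_sum)
  also have "\<dots> \<le> (\<Sum>k<n. 1\<^sup>2) * (\<Sum>k<n. (norm (x k))\<^sup>2)" by (rule Cauchy_Schwarz_ineq_sum)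
  finally show ?thesis by simp
qed

text \<open>Cauchy-Schwarz costs the factor n^2, harmless when c is of order n^-3, as for
  \<open>remainder\<close> and for the errors of the simple functions.\<close>

lemma nn_integral_norm_sum_bound:
  fixes x :: "nat \<Rightarrow> 'w \<Rightarrow> 'a::{real_normed_vector,second_countable_topology}"
  assumes [measurable]: "\<And>k. k < n \<Longrightarrow> x k \<in> borel_measurable M"
    and x: "\<And>k. k < n \<Longrightarrow> (\<integral>\<^sup>+\<omega>. ennreal ((norm (x k \<omega>))\<^sup>2) \<partial>M) \<le> ennreal c" and c: "0 \<le> c"
  shows "(\<integral>\<^sup>+\<omega>. ennreal ((norm (\<Sum>k<n. x k \<omega>))\<^sup>2) \<partial>M) \<le> ennreal ((real n)\<^sup>2 * c)"
proof -
  have "(\<integral>\<^sup>+\<omega>. ennreal ((norm (\<Sum>k<n. x k \<omega>))\<^sup>2) \<partial>M)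
      \<le> (\<integral>\<^sup>+\<omega>. ennreal (real n) * (\<Sum>k<n. ennreal ((norm (x k \<omega>))\<^sup>2)) \<partial>M)"
    using norm_sum_power2_le
    by (intro nn_integral_mono) (simp add: sum_ennreal sum_nonneg ennreal_leI flip: ennreal_mult)
  also have "\<dots> = ennreal (real n) * (\<integral>\<^sup>+\<omega>. (\<Sum>k<n. ennreal ((norm (x k \<omega>))\<^sup>2)) \<partial>M)"
    by (intro nn_integral_cmult borel_measurable_sum) simp
  also have "(\<integral>\<^sup>+\<omega>. (\<Sum>k<n. ennreal ((norm (x k \<omega>))\<^sup>2)) \<partial>M)
      = (\<Sum>k<n. \<integral>\<^sup>+\<omega>. ennreal ((norm (x k \<omega>))\<^sup>2) \<partial>M)"
    by (rule nn_integral_sum) simp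
  also have "ennreal (real n) * (\<Sum>k<n. \<integral>\<^sup>+\<omega>. ennreal ((norm (x k \<omega>))\<^sup>2) \<partial>M)
      \<le> ennreal (real n) * (\<Sum>k<n. ennreal c)"
    by (intro mult_left_mono sum_mono x) auto
  also have "\<dots> = ennreal ((real n)\<^sup>2 * c)"
    using c by (simp add: power2_eq_square ennreal_mult' mult.assoc ennreal_of_nat_eq_real_of_nat)
  finally show ?thesis .
qed

lemma tendsto_0_of_inverse_bound:
  fixes a :: "nat \<Rightarrow> ennreal"
  assumes "\<And>n. a n \<le> ennreal (C / real (Suc n))"
  shows "a \<longlonglongrightarrow> 0"
proof (rule tendsto_sandwich[of "\<lambda>_. 0" a _ "\<lambda>n. ennreal (C / real (Suc n))"])
  have "(\<lambda>n. C * inverse (real (Suc n))) \<longlonglongrightarrow> C * 0"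
    by (intro tendsto_intros LIMSEQ_inverse_real_of_nat)
  then have "(\<lambda>n. ennreal (C / real (Suc n))) \<longlonglongrightarrow> ennreal 0"
    by (intro tendsto_ennrealI) (simp add: divide_inverse)
  then show "(\<lambda>n. ennreal (C / real (Suc n))) \<longlonglongrightarrow> 0" by simp
  show "(\<lambda>n. 0 :: ennreal) \<longlonglongrightarrow> 0" by simp
qed (use assms in auto)

context hilbert_wiener begin

text \<open>Both sides are expectations over the increment on [0, 1], compared pointwise;
  \<open>q_norm2 Q id_blinfun\<close> is the trace of \<open>Q\<close>.\<close>

lemma q_norm2_le:
  fixes L :: "'h \<Rightarrow>\<^sub>L 'u::{real_inner,banach,second_countable_topology}"
  shows "q_norm2 Q L \<le> (norm L)\<^sup>2 * q_norm2 Q id_blinfun"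
proof -
  have L: "has_bochner_integral M (\<lambda>\<omega>. (norm (L (W 1 \<omega> - W 0 \<omega>)))\<^sup>2) (q_norm2 Q L)"
    using increment_q_norm2(1)[of 0 1 L] by simp
  have I: "has_bochner_integral M (\<lambda>\<omega>. (norm L)\<^sup>2 * (norm (id_blinfun (W 1 \<omega> - W 0 \<omega>)))\<^sup>2)
      ((norm L)\<^sup>2 * q_norm2 Q id_blinfun)"
    using increment_q_norm2(1)[of 0 1 "id_blinfun :: 'h \<Rightarrow>\<^sub>L 'h"] by (intro has_bochner_integral_mult_right) simp
  have "(norm (L v))\<^sup>2 \<le> (norm L)\<^sup>2 * (norm (id_blinfun v))\<^sup>2" for v
    unfolding power_mult_distrib[symmetric] by (intro power_mono) (simp_all add: norm_blinfun)
  then have "(\<integral>\<omega>. (norm (L (W 1 \<omega> - W 0 \<omega>)))\<^sup>2 \<partial>M) \<le> (\<integral>\<omega>. (norm L)\<^sup>2 * (norm (id_blinfun (W 1 \<omega> - W 0 \<omega>)))\<^sup>2 \<partial>M)"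
    by (rule integral_mono[OF integrable.intros[OF L] integrable.intros[OF I]])
  then show ?thesis
    unfolding has_bochner_integral_integral_eq[OF L] has_bochner_integral_integral_eq[OF I] .
qed

end

section \<open>The volatility operator, uniform grids and the stochastic integral\<close>

context linear_sde begin

text \<open>\<Psi> as a function of the state. It is linear in \<open>v\<close>, so an error in Y
  becomes an error of the same form in the integrand.\<close>

definition vol :: "'h \<Rightarrow> 'h \<Rightarrow>\<^sub>L 'h hs" where
  "vol v = Blinfun (\<lambda>h. \<eta> h \<otimes> v + v \<otimes> \<eta> h)"

lemma vol_apply: "vol v h = \<eta> h \<otimes> v + v \<otimes> \<eta> h"
  unfolding vol_def by (simp add: bounded_linear_Blinfun_apply bounded_linear_tensor_sym)

lemma vol_diff: "vol v - vol w = vol (v - w)"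
  by (rule blinfun_eqI)
    (simp add: vol_apply blinfun.diff_left bounded_bilinear.diff_left[OF bounded_bilinear_hs_tensor]
      bounded_bilinear.diff_right[OF bounded_bilinear_hs_tensor])

lemma norm_vol_apply: "norm (vol v h) \<le> 2 * norm \<eta> * norm v * norm h"
proof -
  have "norm (vol v h) \<le> 2 * (norm (\<eta> h) * norm v)"
    unfolding vol_apply by (rule norm_triangle_le) (simp add: norm_hs_tensor mult.commute)
  also have "\<dots> \<le> 2 * (norm \<eta> * norm h * norm v)"
    by (intro mult_left_mono mult_right_mono norm_blinfun) auto
  finally show ?thesis by (simp add: mult_ac)
qed

lemma q_norm2_vol: "q_norm2 Q (vol v) \<le> 4 * (norm \<eta>)\<^sup>2 * q_norm2 Q id_blinfun * (norm v)\<^sup>2"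
proof -
  have "norm (vol v) \<le> 2 * norm \<eta> * norm v"
    by (rule norm_blinfun_bound) (auto intro: norm_vol_apply)
  then have "(norm (vol v))\<^sup>2 \<le> (2 * norm \<eta> * norm v)\<^sup>2" by (intro power_mono) auto
  then have "(norm (vol v))\<^sup>2 * q_norm2 Q id_blinfun \<le> (2 * norm \<eta> * norm v)\<^sup>2 * q_norm2 Q id_blinfun"
    using increment_q_norm2(2)[of 0 0 "id_blinfun :: 'h \<Rightarrow>\<^sub>L 'h"] by (intro mult_right_mono) auto
  with q_norm2_le[of "vol v"] show ?thesis by (simp add: power_mult_distrib mult_ac)
qed

text \<open>\<open>Suc n\<close> cells instead of n, which keeps the mesh meaningful at n =
  0.\<close>

definition grid :: "nat \<Rightarrow> nat \<Rightarrow> real" where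
  "grid n k = real k * (T / real (Suc n))"

lemma grid_0: "grid n 0 = 0"
  by (simp add: grid_def)

lemma grid_Suc: "grid n (Suc k) = grid n k + T / real (Suc n)"
  by (simp add: grid_def distrib_right add_divide_distrib)

lemma grid_last: "grid n (Suc n) = T"
  by (simp add: grid_def del: of_nat_Suc)

lemma grid_mono: "j \<le> k \<Longrightarrow> grid n j \<le> grid n k"
  unfolding grid_def using T by (intro mult_right_mono) auto

lemma grid_bounds: "0 \<le> grid n k" "k \<le> Suc n \<Longrightarrow> grid n k \<le> T"
  using grid_mono[of 0 k n] grid_mono[of k "Suc n" n] by (simp_all add: grid_0 grid_last)

lemma grid_le_Suc: "grid n k \<le> grid n (Suc k)"
  by (rule grid_mono) simp

text \<open>The value that the Ito integral of \<open>\<Psi>\<close> over \<open>[0, T]\<close> must have for the representation to hold.\<close>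

definition ito_part :: "'w \<Rightarrow> 'h hs" where
  "ito_part \<omega> = Y T \<omega> \<otimes> Y T \<omega> - Y 0 \<omega> \<otimes> Y 0 \<omega>
    - ((\<integral>u. drift u \<omega> \<partial>lborel_on 0 T) + T *\<^sub>R hs_of_blinfun (\<eta> o\<^sub>L Q o\<^sub>L adj \<eta>))"

lemma ito_part_measurable [measurable]: "ito_part \<in> borel_measurable M"
proof -
  note [measurable] = drift_integral_measurable
  have [measurable]: "Y 0 \<in> borel_measurable M" "Y T \<in> borel_measurable M"
    using T by (auto intro!: Y_measurable)
  show ?thesis unfolding ito_part_def by measurable
qed

lemma riemann_sum_measurable:
  assumes "g \<in> borel_measurable M"
  shows "(\<lambda>\<omega>. vol (g \<omega>) (W (grid n (Suc k)) \<omega> - W (grid n k) \<omega>)) \<in> borel_measurable M"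
proof -
  note [measurable] = assms
  have [measurable]: "(\<lambda>\<omega>. \<eta> (W (grid n (Suc k)) \<omega> - W (grid n k) \<omega>)) \<in> borel_measurable M"
    by (intro borel_measurable_blinfun increment_measurable grid_bounds grid_le_Suc)
  show ?thesis unfolding vol_apply by measurable
qed

text \<open>The increments of Y \<otimes> Y telescope, and the difference is the sum of the
  remainders plus the sum of the quadratic variation errors. With N = \<open>Suc n\<close> cells of
  length T/N their second moments are at most N^2 C (T/N)^3 and N D (T/N)^2, both O(1/N).\<close>

lemma ito_part_riemann_sum:
  "\<exists>C\<ge>0. \<forall>n. (\<integral>\<^sup>+\<omega>. ennreal ((norm (ito_part \<omega> - (\<Sum>k<Suc n. vol (Y (grid n k) \<omega>)
     (W (grid n (Suc k)) \<omega> - W (grid n k) \<omega>))))\<^sup>2) \<partial>M) \<le> ennreal (C / real (Suc n))"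
proof -
  obtain C where C0: "0 \<le> C" and C: "\<And>r s. 0 \<le> r \<Longrightarrow> r \<le> s \<Longrightarrow> s \<le> T \<Longrightarrow>
     (\<integral>\<^sup>+\<omega>. ennreal ((norm (remainder r s \<omega>))\<^sup>2) \<partial>M) \<le> ennreal (C * (s - r) ^ 3)"
    using remainder_bound by blast
  obtain D where D0: "0 \<le> D" and D: "\<And>n t \<delta>. 0 \<le> t 0 \<Longrightarrow> (\<forall>k. t (Suc k) = t k + \<delta>) \<Longrightarrow> 0 \<le> \<delta> \<Longrightarrow>
     (\<integral>\<^sup>+\<omega>. ennreal ((norm (\<Sum>k<n. qv_error \<eta> \<delta> (W (t (Suc k)) \<omega> - W (t k) \<omega>)))\<^sup>2) \<partial>M)
       \<le> ennreal (real n * (D * \<delta>\<^sup>2))"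
    using qv_error_sum[of \<eta>] by blast
  let ?H = "hs_of_blinfun (\<eta> o\<^sub>L Q o\<^sub>L adj \<eta>)"
  have "(\<integral>\<^sup>+\<omega>. ennreal ((norm (ito_part \<omega> - (\<Sum>k<Suc n. vol (Y (grid n k) \<omega>)
     (W (grid n (Suc k)) \<omega> - W (grid n k) \<omega>))))\<^sup>2) \<partial>M) \<le> ennreal ((2 * C * T ^ 3 + 2 * D * T\<^sup>2) / real (Suc n))" for n
  proof -
    define N where "N = real (Suc n)"
    have N: "0 < N" unfolding N_def by simp
    define \<delta> where "\<delta> = T / N"
    have \<delta>0: "0 \<le> \<delta>" unfolding \<delta>_def using T N by simp
    let ?t = "grid n"
    have t: "?t (Suc k) - ?t k = \<delta>" for k unfolding grid_Suc \<delta>_def N_def by simp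
    let ?R = "\<lambda>\<omega>. \<Sum>k<Suc n. remainder (?t k) (?t (Suc k)) \<omega>"
    let ?E = "\<lambda>\<omega>. \<Sum>k<Suc n. qv_error \<eta> \<delta> (W (?t (Suc k)) \<omega> - W (?t k) \<omega>)"
    have rm [measurable]: "remainder (?t k) (?t (Suc k)) \<in> borel_measurable M" if "k < Suc n" for k
      using that by (intro remainder_measurable grid_bounds grid_le_Suc) auto
    have Rm: "(\<lambda>\<omega>. (norm (?R \<omega>))\<^sup>2) \<in> borel_measurable M"
      by (intro borel_measurable_power borel_measurable_norm borel_measurable_sum rm) auto
    have Em: "(\<lambda>\<omega>. (norm (?E \<omega>))\<^sup>2) \<in> borel_measurable M"
    proof -
      have [measurable]: "(\<lambda>\<omega>. qv_error \<eta> \<delta> (W (?t (Suc k)) \<omega> - W (?t k) \<omega>)) \<in> borel_measurable M" for k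
        by (rule measurable_compose[OF increment_measurable qv_error_measurable]) (rule grid_bounds grid_le_Suc)+
      show ?thesis by measurable
    qed
    have R: "(\<integral>\<^sup>+\<omega>. ennreal ((norm (?R \<omega>))\<^sup>2) \<partial>M) \<le> ennreal ((real (Suc n))\<^sup>2 * (C * \<delta> ^ 3))"
    proof (rule nn_integral_norm_sum_bound[OF rm])
      fix k assume "k < Suc n"
      then show "(\<integral>\<^sup>+\<omega>. ennreal ((norm (remainder (?t k) (?t (Suc k)) \<omega>))\<^sup>2) \<partial>M) \<le> ennreal (C * \<delta> ^ 3)"
        using C[of "?t k" "?t (Suc k)"] grid_bounds[where n=n] grid_le_Suc by (simp add: t)
    qed (use C0 \<delta>0 in auto)
    have E: "(\<integral>\<^sup>+\<omega>. ennreal ((norm (?E \<omega>))\<^sup>2) \<partial>M) \<le> ennreal (real (Suc n) * (D * \<delta>\<^sup>2))"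
      by (rule D) (simp_all add: grid_0 grid_Suc \<delta>_def N_def T)
    have ae: "AE \<omega> in M. (norm (ito_part \<omega> - (\<Sum>k<Suc n. vol (Y (?t k) \<omega>) (W (?t (Suc k)) \<omega> - W (?t k) \<omega>))))\<^sup>2
        \<le> 2 * (norm (?R \<omega>))\<^sup>2 + 2 * (norm (?E \<omega>))\<^sup>2"
      using drift_integrable
    proof eventually_elim
      case (elim \<omega>)
      have int: "(\<Sum>k<m. \<integral>u. drift u \<omega> \<partial>lborel_on (?t k) (?t (Suc k))) = (\<integral>u. drift u \<omega> \<partial>lborel_on 0 (?t m))"
        if "m \<le> Suc n" for m
        using that
      proof (induction m)
        case 0
        have "(\<integral>u. drift u \<omega> \<partial>lborel_on 0 0) = 0"
          unfolding LINT_eq_lborel_on[symmetric] by (rule LINT_singleton)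
        then show ?case by (simp add: grid_0)
      next
        case (Suc m)
        have "set_integrable lborel {0..T} (\<lambda>u. drift u \<omega>)"
          using elim by (simp only: set_integrable_eq_lborel_on)
        then have "set_integrable lborel {0..?t (Suc m)} (\<lambda>u. drift u \<omega>)"
          by (rule set_integrable_subset) (use grid_bounds[of "Suc m" n] Suc.prems in auto)
        from LINT_split[OF grid_bounds(1) grid_le_Suc this] Suc show ?case
          by (simp add: LINT_eq_lborel_on)
      qed
      \<comment> \<open>The tensor square of the noise increment occurs in \<open>remainder\<close>
        and in \<open>qv_error\<close> with opposite signs and cancels; what is left of
        \<open>qv_error\<close> is -\<delta> \<eta> Q \<eta>*.\<close>
      have "?R \<omega> + ?E \<omega> = (\<Sum>k<Suc n. (Y (?t (Suc k)) \<omega> \<otimes> Y (?t (Suc k)) \<omega> - Y (?t k) \<omega> \<otimes> Y (?t k) \<omega>)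
          - (\<integral>u. drift u \<omega> \<partial>lborel_on (?t k) (?t (Suc k)))
          - vol (Y (?t k) \<omega>) (W (?t (Suc k)) \<omega> - W (?t k) \<omega>) - \<delta> *\<^sub>R ?H)"
        unfolding sum.distrib[symmetric]
        by (intro sum.cong) (simp_all add: remainder_def qv_error_def vol_apply)
      also have "\<dots> = (\<Sum>k<Suc n. Y (?t (Suc k)) \<omega> \<otimes> Y (?t (Suc k)) \<omega> - Y (?t k) \<omega> \<otimes> Y (?t k) \<omega>)
          - (\<Sum>k<Suc n. \<integral>u. drift u \<omega> \<partial>lborel_on (?t k) (?t (Suc k)))
          - (\<Sum>k<Suc n. vol (Y (?t k) \<omega>) (W (?t (Suc k)) \<omega> - W (?t k) \<omega>)) - (\<Sum>k<Suc n. \<delta> *\<^sub>R ?H)"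
        by (simp only: sum_subtractf)
      also have "(\<Sum>k<Suc n. Y (?t (Suc k)) \<omega> \<otimes> Y (?t (Suc k)) \<omega> - Y (?t k) \<omega> \<otimes> Y (?t k) \<omega>)
          = Y T \<omega> \<otimes> Y T \<omega> - Y 0 \<omega> \<otimes> Y 0 \<omega>"
        using sum_lessThan_telescope[of "\<lambda>k. Y (?t k) \<omega> \<otimes> Y (?t k) \<omega>" "Suc n"] unfolding grid_last grid_0 .
      also have "(\<Sum>k<Suc n. \<integral>u. drift u \<omega> \<partial>lborel_on (?t k) (?t (Suc k))) = (\<integral>u. drift u \<omega> \<partial>lborel_on 0 T)"
        using int[of "Suc n"] unfolding grid_last by simp
      also have "(\<Sum>k<Suc n. \<delta> *\<^sub>R ?H) = T *\<^sub>R ?H"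
        unfolding sum_constant_scaleR using N by (simp add: \<delta>_def N_def del: of_nat_Suc)
      finally have eq: "ito_part \<omega> - (\<Sum>k<Suc n. vol (Y (?t k) \<omega>) (W (?t (Suc k)) \<omega> - W (?t k) \<omega>)) = ?R \<omega> + ?E \<omega>"
        by (simp add: ito_part_def)
      have "(norm (?R \<omega> + ?E \<omega>))\<^sup>2 \<le> (norm (?R \<omega>) + norm (?E \<omega>))\<^sup>2"
        by (intro power_mono norm_triangle_ineq) auto
      also have "\<dots> \<le> 2 * ((norm (?R \<omega>))\<^sup>2 + (norm (?E \<omega>))\<^sup>2)" by (rule sum2_le)
      finally show ?case unfolding eq by (simp only: distrib_left)
    qed
    have "(\<integral>\<^sup>+\<omega>. ennreal ((norm (ito_part \<omega> - (\<Sum>k<Suc n. vol (Y (?t k) \<omega>) (W (?t (Suc k)) \<omega> - W (?t k) \<omega>))))\<^sup>2) \<partial>M)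
       \<le> ennreal (2 * ((real (Suc n))\<^sup>2 * (C * \<delta> ^ 3)) + 2 * (real (Suc n) * (D * \<delta>\<^sup>2)))"
      by (rule nn_integral_linear_bound[OF Rm Em ae _ _ _ _ _ _ R E]) (use C0 D0 \<delta>0 in auto)
    also have "2 * ((real (Suc n))\<^sup>2 * (C * \<delta> ^ 3)) + 2 * (real (Suc n) * (D * \<delta>\<^sup>2)) = (2 * C * T ^ 3 + 2 * D * T\<^sup>2) / real (Suc n)"
      unfolding N_def[symmetric] \<delta>_def using N by (simp add: field_simps power2_eq_square power3_eq_cube)
    finally show ?thesis .
  qed
  moreover have "0 \<le> 2 * C * T ^ 3 + 2 * D * T\<^sup>2" using C0 D0 T by simp
  ultimately show ?thesis by blast
qed

text \<open>In the weight, 1 serves the convergence of the integrands and the squared increment of W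
  that of the integrals. The fourth moments of Y and of the increment make the weighted square of Y
  integrable.\<close>

lemma Y_simple_approximation:
  assumes k: "k < Suc n" and \<epsilon>: "0 < \<epsilon>"
  shows "\<exists>g. simple_function (F (grid n k)) g \<and> (\<integral>\<^sup>+\<omega>. ennreal ((norm (g \<omega> - Y (grid n k) \<omega>))\<^sup>2
    * (1 + (norm (W (grid n (Suc k)) \<omega> - W (grid n k) \<omega>))\<^sup>2)) \<partial>M) \<le> ennreal \<epsilon>"
proof (rule simple_approximation[OF grid_bounds(1) Y_measurable_F[OF grid_bounds(1)] _ _ _ \<epsilon>])
  let ?d = "\<lambda>\<omega>. W (grid n (Suc k)) \<omega> - W (grid n k) \<omega>" and ?Y = "Y (grid n k)"
  have [measurable]: "?d \<in> borel_measurable M" by (intro increment_measurable grid_bounds grid_le_Suc)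
  have [measurable]: "?Y \<in> borel_measurable M" by (intro Y_measurable grid_bounds)
  show "(\<lambda>\<omega>. 1 + (norm (?d \<omega>))\<^sup>2) \<in> borel_measurable M" by measurable
  show "0 \<le> 1 + (norm (?d \<omega>))\<^sup>2" for \<omega> by simp
  obtain K where K0: "0 \<le> K" and K: "\<And>s t. 0 \<le> s \<Longrightarrow> s \<le> t \<Longrightarrow>
      (\<integral>\<^sup>+\<omega>. ennreal (norm (W t \<omega> - W s \<omega>) ^ 4) \<partial>M) \<le> ennreal (K * (t - s)\<^sup>2)"
    using increment_norm4 by blast
  obtain C where C0: "0 \<le> C" and C: "\<And>t. t \<in> {0..T} \<Longrightarrow> (\<integral>\<^sup>+\<omega>. ennreal (norm (Y t \<omega>) ^ 4) \<partial>M) \<le> ennreal C"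
    using norm4_Y by blast
  have pt: "a\<^sup>2 * (1 + b\<^sup>2) \<le> 1 + 2 * a ^ 4 + b ^ 4" for a b :: real
  proof -
    have "2 * a\<^sup>2 \<le> 1 + a ^ 4" "2 * (a\<^sup>2 * b\<^sup>2) \<le> a ^ 4 + b ^ 4" "0 \<le> a ^ 4" "0 \<le> b ^ 4"
      using sum_squares_bound[of 1 "a\<^sup>2"] sum_squares_bound[of "a\<^sup>2" "b\<^sup>2"]
      by (simp_all flip: power_mult)
    then show ?thesis unfolding distrib_left by linarith
  qed
  have 1: "(\<integral>\<^sup>+\<omega>. ennreal (2 * norm (?Y \<omega>) ^ 4 + 1 * norm (?d \<omega>) ^ 4) \<partial>M)
      \<le> ennreal (2 * C + 1 * (K * (grid n (Suc k) - grid n k)\<^sup>2))"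
    by (rule nn_integral_linear_bound[where g="\<lambda>\<omega>. norm (?Y \<omega>) ^ 4" and h="\<lambda>\<omega>. norm (?d \<omega>) ^ 4"])
      (use K0 C0 k in \<open>auto intro!: K C grid_bounds grid_le_Suc\<close>)
  have "(\<integral>\<^sup>+\<omega>. ennreal ((norm (?Y \<omega>))\<^sup>2 * (1 + (norm (?d \<omega>))\<^sup>2)) \<partial>M)
      \<le> (\<integral>\<^sup>+\<omega>. 1 + ennreal (2 * norm (?Y \<omega>) ^ 4 + 1 * norm (?d \<omega>) ^ 4) \<partial>M)"
    using pt by (intro nn_integral_mono) (simp add: ennreal_leI add.assoc flip: ennreal_1 ennreal_plus)
  also have "\<dots> < \<infinity>"
    using 1 by (subst nn_integral_add) (auto simp: emeasure_space_1 ennreal_add_eq_top less_top[symmetric] top_unique)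
  finally show "(\<integral>\<^sup>+\<omega>. ennreal ((norm (?Y \<omega>))\<^sup>2 * (1 + (norm (?d \<omega>))\<^sup>2)) \<partial>M) < \<infinity>" .
qed

text \<open>Cells are open on the left like the intervals of \<open>simple_process\<close>, so the
  point 0 lies in none. The index comes from the first grid point at or above
  \<open>u\<close>.\<close>

lemma in_grid_cell:
  assumes u: "0 < u" "u \<le> T"
  obtains k where "k < Suc n" "grid n k < u" "u \<le> grid n (Suc k)"
proof -
  define j where "j = (LEAST j. u \<le> grid n j)"
  have "u \<le> grid n (Suc n)" using u by (simp add: grid_last)
  then have j: "u \<le> grid n j" "j \<le> Suc n"
    unfolding j_def by (rule LeastI, rule Least_le)
  moreover have "j \<noteq> 0" using j u by (intro notI) (simp add: grid_0)
  then obtain k where k: "j = Suc k" using not0_implies_Suc by blast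
  moreover have "\<not> u \<le> grid n k" by (rule not_less_Least) (use k in \<open>simp add: j_def[symmetric]\<close>)
  ultimately show thesis by (intro that[of k]) auto
qed

lemma sum_grid_cell:
  fixes L :: "nat \<Rightarrow> 'a::comm_monoid_add"
  assumes k: "k < m" "grid n k < u" "u \<le> grid n (Suc k)"
  shows "(\<Sum>j<m. if grid n j < u \<and> u \<le> grid n (Suc j) then L j else 0) = L k"
proof -
  have "(grid n j < u \<and> u \<le> grid n (Suc j)) \<longleftrightarrow> j = k" for j
    using grid_mono[of "Suc j" k n] grid_mono[of "Suc k" j n] k
    by (cases j k rule: linorder_cases) auto
  then have "(\<Sum>j<m. if grid n j < u \<and> u \<le> grid n (Suc j) then L j else 0) = (\<Sum>j<m. if j = k then L j else 0)"
    by simp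
  also have "\<dots> = L k" using k by simp
  finally show ?thesis .
qed

lemma vol_progressively_measurable: "progressively_measurable F (\<lambda>s \<omega>. vol (Y s \<omega>) h)"
  unfolding progressively_measurable_def
proof (intro allI impI)
  fix t :: real assume "0 \<le> t"
  then have [measurable]: "(\<lambda>(s, \<omega>). Y s \<omega>) \<in> borel_measurable (restrict_space borel {0..t} \<Otimes>\<^sub>M F t)"
    using solution by (auto simp: strong_solution_def progressively_measurable_def)
  then show "(\<lambda>(s, \<omega>). vol (Y s \<omega>) h) \<in> borel_measurable (restrict_space borel {0..t} \<Otimes>\<^sub>M F t)"
    unfolding vol_apply case_prod_unfold by measurable
qed

text \<open>Freezing \<open>Y\<close> at the left end points of the grid and approximating its values there by simple
  functions, with error \<open>1 / N\<^sup>3\<close> over \<open>N\<close> cells, gives admissible simple integrands.\<close>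

lemma vol_stoch_integral: "has_stoch_integral M F Q W (\<lambda>s \<omega>. vol (Y s \<omega>)) T ito_part"
proof -
  let ?d = "\<lambda>n k \<omega>. W (grid n (Suc k)) \<omega> - W (grid n k) \<omega>"
  \<comment> \<open>The exponent is 3 because the sum over N cells is estimated with a factor N^2,
    and N^2 / N^3 tends to 0.\<close>
  have eps: "0 < 1 / real (Suc n) ^ 3" for n by simp
  have "\<forall>n k. \<exists>g. k < Suc n \<longrightarrow> simple_function (F (grid n k)) g \<and>
      (\<integral>\<^sup>+\<omega>. ennreal ((norm (g \<omega> - Y (grid n k) \<omega>))\<^sup>2 * (1 + (norm (?d n k \<omega>))\<^sup>2)) \<partial>M) \<le> ennreal (1 / real (Suc n) ^ 3)"
    using Y_simple_approximation[OF _ eps] by blast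
  then obtain g where sg: "\<And>n k. k < Suc n \<Longrightarrow> simple_function (F (grid n k)) (g n k)"
    and g: "\<And>n k. k < Suc n \<Longrightarrow>
      (\<integral>\<^sup>+\<omega>. ennreal ((norm (g n k \<omega> - Y (grid n k) \<omega>))\<^sup>2 * (1 + (norm (?d n k \<omega>))\<^sup>2)) \<partial>M) \<le> ennreal (1 / real (Suc n) ^ 3)"
    by (simp only: choice_iff) blast
  have "\<forall>n. \<exists>xs. simple_adapted F xs \<and>
    (\<forall>\<omega>\<in>space M. \<forall>u. simple_process xs u \<omega> = (\<Sum>k<Suc n. if grid n k < u \<and> u \<le> grid n (Suc k) then vol (g n k \<omega>) else 0)) \<and>
    (\<forall>\<omega>\<in>space M. \<forall>S. simple_integral W xs S \<omega>
      = (\<Sum>k<Suc n. vol (g n k \<omega>) (W (min (grid n (Suc k)) S) \<omega> - W (min (grid n k) S) \<omega>)))"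
    by (intro allI simple_on_grid grid_bounds grid_le_Suc sg)
  then obtain xs where ad: "\<And>n. simple_adapted F (xs n)"
    and proc: "\<And>n \<omega> u. \<omega> \<in> space M \<Longrightarrow> simple_process (xs n) u \<omega>
      = (\<Sum>k<Suc n. if grid n k < u \<and> u \<le> grid n (Suc k) then vol (g n k \<omega>) else 0)"
    and int: "\<And>n \<omega> S. \<omega> \<in> space M \<Longrightarrow> simple_integral W (xs n) S \<omega>
      = (\<Sum>k<Suc n. vol (g n k \<omega>) (W (min (grid n (Suc k)) S) \<omega> - W (min (grid n k) S) \<omega>))"
    by (simp only: choice_iff) blast
  let ?z = "\<lambda>n k \<omega>. g n k \<omega> - Y (grid n k) \<omega>" and ?r = "\<lambda>n k u \<omega>. y u \<omega> - Y (grid n k) \<omega>"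
    and ?q = "\<lambda>n u \<omega>. ennreal (q_norm2 Q (simple_process (xs n) u \<omega> - vol (Y u \<omega>)))"
  have gM [measurable]: "g n k \<in> borel_measurable M" if "k < Suc n" for n k
    by (rule measurable_F[OF grid_bounds(1) borel_measurable_simple_function[OF sg[OF that]]])
  have YM [measurable]: "Y (grid n k) \<in> borel_measurable M" for n k
    by (intro Y_measurable grid_bounds)
  have dM [measurable]: "?d n k \<in> borel_measurable M" for n k
    by (intro increment_measurable grid_bounds grid_le_Suc)
  have g2: "(\<integral>\<^sup>+\<omega>. ennreal ((norm (?z n k \<omega>))\<^sup>2) \<partial>M) \<le> ennreal (1 / real (Suc n) ^ 3)"
    if "k < Suc n" for n k
  proof -
    have "(\<integral>\<^sup>+\<omega>. ennreal ((norm (?z n k \<omega>))\<^sup>2) \<partial>M)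
      \<le> (\<integral>\<^sup>+\<omega>. ennreal ((norm (?z n k \<omega>))\<^sup>2 * (1 + (norm (?d n k \<omega>))\<^sup>2)) \<partial>M)"
      by (intro nn_integral_mono ennreal_leI) (simp add: distrib_left)
    also have "\<dots> \<le> ennreal (1 / real (Suc n) ^ 3)" by (rule g[OF that])
    finally show ?thesis .
  qed
  have "(\<lambda>n. \<integral>\<^sup>+\<omega>. (\<integral>\<^sup>+u\<in>{0..T}. ?q n u \<omega> \<partial>lborel) \<partial>M) \<longlonglongrightarrow> 0"
  proof -
    obtain D where D0: "0 \<le> D" and D: "\<And>r u. 0 \<le> r \<Longrightarrow> r \<le> u \<Longrightarrow> u \<le> T \<Longrightarrow>
      (\<integral>\<^sup>+\<omega>. ennreal (norm (Y u \<omega> - Y r \<omega>) ^ 4) \<partial>M) \<le> ennreal (D * (u - r)\<^sup>2)"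
      using norm4_Y_increment by blast
    define c where "c = 4 * (norm \<eta>)\<^sup>2 * q_norm2 Q id_blinfun"
    have c0: "0 \<le> c"
      unfolding c_def using increment_q_norm2(2)[of 0 0 "id_blinfun :: 'h \<Rightarrow>\<^sub>L 'h"] by simp
    have "(\<integral>\<^sup>+\<omega>. (\<integral>\<^sup>+u\<in>{0..T}. ?q n u \<omega> \<partial>lborel) \<partial>M)
        \<le> ennreal (c * (3 + D * T\<^sup>2) * T / real (Suc n))" for n
    proof -
      define N where "N = real (Suc n)"
      have N: "0 < N" "1 \<le> N" unfolding N_def by simp_all
      \<comment> \<open>Second powers of Y(u) - Y(r) are traded for fourth powers, whose moments are
        known, by 2 x^2 <= 1/N + N x^4. As the fourth moment is O(N^-2), the result is
        O(1/N).\<close>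
      define f where "f k u \<omega> = 2 * c * (norm (?z n k \<omega>))\<^sup>2
        + c * (1 / N + N * norm (?r n k u \<omega>) ^ 4)" for k u \<omega>
      have f0: "0 \<le> f k u \<omega>" for k u \<omega> unfolding f_def using c0 N by simp
      have fm [measurable]: "case_prod (f k) \<in> borel_measurable (lborel \<Otimes>\<^sub>M M)" if "k < Suc n" for k
      proof -
        note [measurable] = gM[OF that]
        show ?thesis using y_measurable unfolding f_def case_prod_unfold by measurable
      qed
      \<comment> \<open>At each u in (0, T] exactly one summand of the simple process is active.
        Closed cells on the right only enlarge the bound and have the form of the sets in
        \<open>expectation_time_integral\<close>.\<close>
      have pt: "?q n u \<omega> * indicator {0..T} u
          \<le> (\<Sum>k<Suc n. ennreal (f k u \<omega>) * indicator {grid n k..grid n (Suc k)} u)"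
        if \<omega>: "\<omega> \<in> space M" and u: "u \<noteq> 0" for u \<omega>
      proof (cases "u \<in> {0..T}")
        case True
        then have u: "0 < u" "u \<le> T" using u by auto
        obtain k where k: "k < Suc n" "grid n k < u" "u \<le> grid n (Suc k)"
          using in_grid_cell[OF u] .
        have "q_norm2 Q (simple_process (xs n) u \<omega> - vol (Y u \<omega>)) = q_norm2 Q (vol (g n k \<omega> - y u \<omega>))"
          using u unfolding proc[OF \<omega>] sum_grid_cell[OF k] by (simp add: vol_diff y_eq)
        also have "\<dots> \<le> c * (norm (g n k \<omega> - y u \<omega>))\<^sup>2" unfolding c_def by (rule q_norm2_vol)
        also have "\<dots> \<le> c * (2 * ((norm (?z n k \<omega>))\<^sup>2 + (norm (?r n k u \<omega>))\<^sup>2))"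
        proof (intro mult_left_mono c0)
          have "norm (g n k \<omega> - y u \<omega>) \<le> norm (?z n k \<omega>) + norm (?r n k u \<omega>)"
            using norm_triangle_ineq4[of "g n k \<omega> - Y (grid n k) \<omega>" "y u \<omega> - Y (grid n k) \<omega>"] by simp
          then have "(norm (g n k \<omega> - y u \<omega>))\<^sup>2 \<le> (norm (?z n k \<omega>) + norm (?r n k u \<omega>))\<^sup>2"
            by (intro power_mono) auto
          also note sum2_le
          finally show "(norm (g n k \<omega> - y u \<omega>))\<^sup>2
            \<le> 2 * ((norm (?z n k \<omega>))\<^sup>2 + (norm (?r n k u \<omega>))\<^sup>2)" .
        qed
        also have "\<dots> \<le> f k u \<omega>"
        proof -
          have "2 * x\<^sup>2 \<le> 1 / N + N * x ^ 4" for x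
          proof -
            have "0 \<le> (N * x\<^sup>2 - 1)\<^sup>2 / N" using N by simp
            also have "\<dots> = N * x ^ 4 - 2 * x\<^sup>2 + 1 / N"
              using N by (simp add: power2_diff field_simps power2_eq_square power4_eq_xxxx)
            finally show ?thesis by simp
          qed
          from mult_left_mono[OF this c0] show ?thesis unfolding f_def by (simp add: distrib_left)
        qed
        finally have "?q n u \<omega> * indicator {0..T} u
            \<le> ennreal (f k u \<omega>) * indicator {grid n k..grid n (Suc k)} u"
          using True k by (simp add: ennreal_leI)
        also have "\<dots> \<le> (\<Sum>k<Suc n. ennreal (f k u \<omega>) * indicator {grid n k..grid n (Suc k)} u)"
          using k by (intro member_le_sum) auto
        finally show ?thesis .
      qed simp
      \<comment> \<open>The 3 is 2 from the simple functions, where 1 / N^3 <= 1 / N, plus 1 from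
        the term c / N in \<open>f\<close>.\<close>
      define b where "b = c * (3 + D * T\<^sup>2) / N"
      have b0: "0 \<le> b" unfolding b_def using c0 D0 N by simp
      have fE: "(\<integral>\<^sup>+\<omega>. ennreal (f k u \<omega>) \<partial>M) \<le> ennreal b"
        if k: "k < Suc n" and u: "grid n k \<le> u" "u \<le> grid n (Suc k)" for k u
      proof -
        note [measurable] = gM[OF k]
        have u': "0 \<le> u" "u \<le> T" using grid_bounds(1)[of n k] grid_bounds(2)[of "Suc k" n] k u by auto
        have [measurable]: "y u \<in> borel_measurable M" by (rule section_measurable(2)[OF y_measurable])
        have diff: "(u - grid n k)\<^sup>2 \<le> T\<^sup>2 / N\<^sup>2"
        proof -
          have "u - grid n k \<le> T / N" using u unfolding grid_Suc N_def by simp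
          then have "(u - grid n k)\<^sup>2 \<le> (T / N)\<^sup>2" using u by (intro power_mono) auto
          then show ?thesis by (simp add: power_divide)
        qed
        have 4: "(\<integral>\<^sup>+\<omega>. ennreal (norm (?r n k u \<omega>) ^ 4) \<partial>M) \<le> ennreal (D * (T\<^sup>2 / N\<^sup>2))"
        proof -
          have "(\<integral>\<^sup>+\<omega>. ennreal (norm (?r n k u \<omega>) ^ 4) \<partial>M) \<le> ennreal (D * (u - grid n k)\<^sup>2)"
            using D[OF grid_bounds(1) u(1) u'(2)] u' by (simp add: y_eq)
          also have "\<dots> \<le> ennreal (D * (T\<^sup>2 / N\<^sup>2))" by (intro ennreal_leI mult_left_mono diff D0)
          finally show ?thesis .
        qed
        have 5: "(\<integral>\<^sup>+\<omega>. ennreal (c / N * 1 + c * N * norm (?r n k u \<omega>) ^ 4) \<partial>M)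
            \<le> ennreal (c / N * 1 + c * N * (D * (T\<^sup>2 / N\<^sup>2)))"
          by (rule nn_integral_linear_bound[where g="\<lambda>_. 1" and h="\<lambda>\<omega>. norm (?r n k u \<omega>) ^ 4"])
            (use c0 N D0 4 in \<open>auto simp: emeasure_space_1\<close>)
        have "(\<integral>\<^sup>+\<omega>. ennreal (f k u \<omega>) \<partial>M)
            \<le> ennreal (2 * c * (1 / N ^ 3) + 1 * (c / N * 1 + c * N * (D * (T\<^sup>2 / N\<^sup>2))))"
          by (rule nn_integral_linear_bound[OF _ _ _ _ _ _ _ _ _ g2[OF k, folded N_def] 5])
            (use c0 N D0 in \<open>auto simp: f_def distrib_left\<close>)
        also have "\<dots> \<le> ennreal b"
        proof (rule ennreal_leI)
          have "1 / N ^ 3 \<le> 1 / N"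
            using N power_increasing[of 1 3 N] by (intro divide_left_mono) auto
          then have "2 * c * (1 / N ^ 3) \<le> 2 * c * (1 / N)" using c0 by (intro mult_left_mono) auto
          moreover have "c / N * 1 + c * N * (D * (T\<^sup>2 / N\<^sup>2)) = c * (1 + D * T\<^sup>2) / N"
            using N by (simp add: field_simps power2_eq_square)
          moreover have "2 * c * (1 / N) + c * (1 + D * T\<^sup>2) / N = b"
            unfolding b_def add_divide_distrib[symmetric] by (simp add: algebra_simps flip: add_divide_distrib)
          ultimately show "2 * c * (1 / N ^ 3) + 1 * (c / N * 1 + c * N * (D * (T\<^sup>2 / N\<^sup>2))) \<le> b" by simp
        qed
        finally show ?thesis .
      qed
      have sec: "(\<lambda>u. f k u \<omega>) \<in> borel_measurable lborel" if "k < Suc n" "\<omega> \<in> space M" for k \<omega>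
        by (rule section_measurable(1)[OF fm[OF that(1)] that(2)])
      have "(\<integral>\<^sup>+\<omega>. (\<integral>\<^sup>+u\<in>{0..T}. ?q n u \<omega> \<partial>lborel) \<partial>M)
        \<le> (\<integral>\<^sup>+\<omega>. (\<Sum>k<Suc n. \<integral>\<^sup>+u\<in>{grid n k..grid n (Suc k)}. ennreal (f k u \<omega>) \<partial>lborel) \<partial>M)"
      proof (rule nn_integral_mono)
        fix \<omega> assume \<omega>: "\<omega> \<in> space M"
        have "(\<integral>\<^sup>+u\<in>{0..T}. ?q n u \<omega> \<partial>lborel)
          \<le> (\<integral>\<^sup>+u. (\<Sum>k<Suc n. ennreal (f k u \<omega>) * indicator {grid n k..grid n (Suc k)} u) \<partial>lborel)"
          by (rule nn_integral_mono_AE) (use AE_lborel_singleton[of "0::real"] in eventually_elim, rule pt[OF \<omega>])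
        also have "\<dots> = (\<Sum>k<Suc n. \<integral>\<^sup>+u\<in>{grid n k..grid n (Suc k)}. ennreal (f k u \<omega>) \<partial>lborel)"
        proof (rule nn_integral_sum)
          fix k assume "k \<in> {..<Suc n}"
          then have [measurable]: "(\<lambda>u. f k u \<omega>) \<in> borel_measurable lborel" using sec \<omega> by simp
          show "(\<lambda>u. ennreal (f k u \<omega>) * indicator {grid n k..grid n (Suc k)} u) \<in> borel_measurable lborel"
            by measurable
        qed
        finally show "(\<integral>\<^sup>+u\<in>{0..T}. ?q n u \<omega> \<partial>lborel)
          \<le> (\<Sum>k<Suc n. \<integral>\<^sup>+u\<in>{grid n k..grid n (Suc k)}. ennreal (f k u \<omega>) \<partial>lborel)" .
      qed
      also have "\<dots> = (\<Sum>k<Suc n. \<integral>\<^sup>+\<omega>. (\<integral>\<^sup>+u\<in>{grid n k..grid n (Suc k)}. ennreal (f k u \<omega>) \<partial>lborel) \<partial>M)"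
      proof (rule nn_integral_sum)
        fix k assume "k \<in> {..<Suc n}"
        then have "(\<lambda>(\<omega>, u). f k u \<omega>) \<in> borel_measurable (M \<Otimes>\<^sub>M lborel)"
          using measurable_pair_swap[OF fm[of k]] by (simp add: case_prod_unfold)
        then show "(\<lambda>\<omega>. \<integral>\<^sup>+u\<in>{grid n k..grid n (Suc k)}. ennreal (f k u \<omega>) \<partial>lborel) \<in> borel_measurable M"
          by measurable
      qed
      also have "\<dots> \<le> (\<Sum>k<Suc n. ennreal (b * (T / N)))"
      proof (rule sum_mono)
        fix k assume "k \<in> {..<Suc n}"
        then have k: "k < Suc n" by simp
        from expectation_time_integral(4)[OF fm[OF k] f0 fE[OF k] b0 grid_le_Suc]
        show "(\<integral>\<^sup>+\<omega>. (\<integral>\<^sup>+u\<in>{grid n k..grid n (Suc k)}. ennreal (f k u \<omega>) \<partial>lborel) \<partial>M) \<le> ennreal (b * (T / N))"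
          by (simp add: grid_Suc N_def)
      qed
      also have "\<dots> = ennreal (N * (b * (T / N)))"
        unfolding sum_constant card_lessThan ennreal_of_nat_eq_real_of_nat N_def[symmetric]
        by (rule ennreal_mult[symmetric]) (use b0 T N in auto)
      also have "N * (b * (T / N)) = c * (3 + D * T\<^sup>2) * T / real (Suc n)"
        using N by (simp add: b_def N_def del: of_nat_Suc)
      finally show ?thesis .
    qed
    then show ?thesis by (rule tendsto_0_of_inverse_bound)
  qed
  moreover have "(\<lambda>n. \<integral>\<^sup>+\<omega>. ennreal ((norm (simple_integral W (xs n) T \<omega> - ito_part \<omega>))\<^sup>2) \<partial>M) \<longlonglongrightarrow> 0"
  proof -
    obtain C where C0: "0 \<le> C" and C: "\<And>n. (\<integral>\<^sup>+\<omega>. ennreal ((norm (ito_part \<omega> - (\<Sum>k<Suc n. vol (Y (grid n k) \<omega>)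
       (?d n k \<omega>))))\<^sup>2) \<partial>M) \<le> ennreal (C / real (Suc n))"
      using ito_part_riemann_sum by blast
    have "(\<integral>\<^sup>+\<omega>. ennreal ((norm (simple_integral W (xs n) T \<omega> - ito_part \<omega>))\<^sup>2) \<partial>M)
        \<le> ennreal ((2 * C + 8 * (norm \<eta>)\<^sup>2) / real (Suc n))" for n
    proof -
      define N where "N = real (Suc n)"
      have N: "0 < N" unfolding N_def by simp
      let ?I = "\<lambda>\<omega>. ito_part \<omega> - (\<Sum>k<Suc n. vol (Y (grid n k) \<omega>) (?d n k \<omega>))"
      let ?x = "\<lambda>k \<omega>. vol (?z n k \<omega>) (?d n k \<omega>)"
      have xm [measurable]: "?x k \<in> borel_measurable M" if "k < Suc n" for k
        by (intro riemann_sum_measurable borel_measurable_diff gM[OF that] YM)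
      \<comment> \<open>Here the part of the weight with the squared increment is used, since |vol z
        d| <= 2 |\<eta>| |z| |d|.\<close>
      have x2: "(\<integral>\<^sup>+\<omega>. ennreal ((norm (?x k \<omega>))\<^sup>2) \<partial>M) \<le> ennreal (4 * (norm \<eta>)\<^sup>2 * (1 / N ^ 3))" if k: "k < Suc n" for k
      proof (rule nn_integral_mult_bound[OF _ _ _ _ _ g[OF k, folded N_def]])
        note [measurable] = gM[OF k]
        show "(\<lambda>\<omega>. (norm (?z n k \<omega>))\<^sup>2 * (1 + (norm (?d n k \<omega>))\<^sup>2)) \<in> borel_measurable M"
          by measurable
        have "(norm (?x k \<omega>))\<^sup>2 \<le> 4 * (norm \<eta>)\<^sup>2 * ((norm (?z n k \<omega>))\<^sup>2 * (1 + (norm (?d n k \<omega>))\<^sup>2))" for \<omega>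
        proof -
          have "(norm (?x k \<omega>))\<^sup>2 \<le> (2 * norm \<eta> * norm (?z n k \<omega>) * norm (?d n k \<omega>))\<^sup>2"
            by (intro power_mono norm_vol_apply) auto
          also have "\<dots> = 4 * (norm \<eta>)\<^sup>2 * ((norm (?z n k \<omega>))\<^sup>2 * (norm (?d n k \<omega>))\<^sup>2)"
            by (simp add: power_mult_distrib)
          also have "\<dots> \<le> 4 * (norm \<eta>)\<^sup>2 * ((norm (?z n k \<omega>))\<^sup>2 * (1 + (norm (?d n k \<omega>))\<^sup>2))"
            by (intro mult_left_mono) auto
          finally show ?thesis .
        qed
        then show "AE \<omega> in M. (norm (?x k \<omega>))\<^sup>2
          \<le> 4 * (norm \<eta>)\<^sup>2 * ((norm (?z n k \<omega>))\<^sup>2 * (1 + (norm (?d n k \<omega>))\<^sup>2))" by simp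
      qed (use N in auto)
      have X: "(\<integral>\<^sup>+\<omega>. ennreal ((norm (\<Sum>k<Suc n. ?x k \<omega>))\<^sup>2) \<partial>M) \<le> ennreal ((real (Suc n))\<^sup>2 * (4 * (norm \<eta>)\<^sup>2 * (1 / N ^ 3)))"
        by (rule nn_integral_norm_sum_bound[OF xm x2]) (use N in auto)
      have Xm: "(\<lambda>\<omega>. (norm (\<Sum>k<Suc n. ?x k \<omega>))\<^sup>2) \<in> borel_measurable M"
        by (intro borel_measurable_power borel_measurable_norm borel_measurable_sum xm) auto
      have Im: "(\<lambda>\<omega>. (norm (?I \<omega>))\<^sup>2) \<in> borel_measurable M"
      proof -
        have [measurable]: "(\<lambda>\<omega>. vol (Y (grid n k) \<omega>) (?d n k \<omega>)) \<in> borel_measurable M" for k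
          by (intro riemann_sum_measurable YM)
        show ?thesis by measurable
      qed
      have ae: "AE \<omega> in M. (norm (simple_integral W (xs n) T \<omega> - ito_part \<omega>))\<^sup>2
          \<le> 2 * (norm (?I \<omega>))\<^sup>2 + 2 * (norm (\<Sum>k<Suc n. ?x k \<omega>))\<^sup>2"
      proof (rule AE_I2)
        fix \<omega> assume \<omega>: "\<omega> \<in> space M"
        \<comment> \<open>The grid points concerned lie in [0, T], so stopping at T changes
          nothing.\<close>
        have "simple_integral W (xs n) T \<omega> = (\<Sum>k<Suc n. vol (g n k \<omega>) (?d n k \<omega>))"
          unfolding int[OF \<omega>]
        proof (rule sum.cong)
          fix k assume "k \<in> {..<Suc n}"
          then show "vol (g n k \<omega>) (W (min (grid n (Suc k)) T) \<omega> - W (min (grid n k) T) \<omega>) = vol (g n k \<omega>) (?d n k \<omega>)"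
            using grid_bounds(2)[of k n] grid_bounds(2)[of "Suc k" n] by (simp add: min_absorb1)
        qed simp
        moreover have "(\<Sum>k<Suc n. ?x k \<omega>) = (\<Sum>k<Suc n. vol (g n k \<omega>) (?d n k \<omega>)) - (\<Sum>k<Suc n. vol (Y (grid n k) \<omega>) (?d n k \<omega>))"
          unfolding vol_diff[symmetric] blinfun.diff_left by (rule sum_subtractf)
        ultimately have eq: "simple_integral W (xs n) T \<omega> - ito_part \<omega> = (\<Sum>k<Suc n. ?x k \<omega>) - ?I \<omega>" by simp
        have "(norm ((\<Sum>k<Suc n. ?x k \<omega>) - ?I \<omega>))\<^sup>2 \<le> (norm (\<Sum>k<Suc n. ?x k \<omega>) + norm (?I \<omega>))\<^sup>2"
          by (intro power_mono norm_triangle_ineq4) auto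
        also note sum2_le
        finally show "(norm (simple_integral W (xs n) T \<omega> - ito_part \<omega>))\<^sup>2
          \<le> 2 * (norm (?I \<omega>))\<^sup>2 + 2 * (norm (\<Sum>k<Suc n. ?x k \<omega>))\<^sup>2" unfolding eq by (simp only: distrib_left add.commute)
      qed
      have "(\<integral>\<^sup>+\<omega>. ennreal ((norm (simple_integral W (xs n) T \<omega> - ito_part \<omega>))\<^sup>2) \<partial>M)
          \<le> ennreal (2 * (C / real (Suc n)) + 2 * ((real (Suc n))\<^sup>2 * (4 * (norm \<eta>)\<^sup>2 * (1 / N ^ 3))))"
        by (rule nn_integral_linear_bound[OF Im Xm ae _ _ _ _ _ _ C X]) (use C0 N in auto)
      also have "2 * (C / real (Suc n)) + 2 * ((real (Suc n))\<^sup>2 * (4 * (norm \<eta>)\<^sup>2 * (1 / N ^ 3)))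
          = (2 * C + 8 * (norm \<eta>)\<^sup>2) / real (Suc n)"
        unfolding N_def[symmetric] using N by (simp add: field_simps power2_eq_square power3_eq_cube)
      finally show ?thesis .
    qed
    then show ?thesis by (rule tendsto_0_of_inverse_bound)
  qed
  ultimately show ?thesis
    unfolding has_stoch_integral_def using vol_progressively_measurable ito_part_measurable ad by blast
qed

end

theorem proposition11:
  fixes M :: "'w measure" and F :: "real \<Rightarrow> 'w measure"
    and Q A \<eta> :: "'h::{real_inner,banach,second_countable_topology} \<Rightarrow>\<^sub>L 'h"
    and W Y :: "real \<Rightarrow> 'w \<Rightarrow> 'h" and Y\<^sub>0 :: 'h
    and V \<Phi> :: "real \<Rightarrow> 'w \<Rightarrow> 'h hs"
    and \<Psi> :: "real \<Rightarrow> 'w \<Rightarrow> 'h \<Rightarrow>\<^sub>L 'h hs"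
  assumes "filtered_prob_space M F"
    and "covariance_operator Q"
    and "wiener_process M F Q W"
    and "strong_solution M F Q W A \<eta> Y\<^sub>0 Y"
    and "V = (\<lambda>t \<omega>. Y t \<omega> \<otimes> Y t \<omega>)"
    and "\<Phi> = (\<lambda>s \<omega>. A (Y s \<omega>) \<otimes> Y s \<omega> + Y s \<omega> \<otimes> A (Y s \<omega>)
               + hs_of_blinfun (\<eta> o\<^sub>L Q o\<^sub>L adj \<eta>))"
    and "\<Psi> = (\<lambda>s \<omega>. Blinfun (\<lambda>h. \<eta> h \<otimes> Y s \<omega> + Y s \<omega> \<otimes> \<eta> h))"
  shows "\<exists>I. \<forall>t\<ge>0. has_stoch_integral M F Q W \<Psi> t (I t) \<and>
           (AE \<omega> in M. set_integrable lborel {0..t} (\<lambda>s. \<Phi> s \<omega>) \<and>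
              V t \<omega> = V 0 \<omega> + (LINT s:{0..t}|lborel. \<Phi> s \<omega>) + I t \<omega>)"
proof (rule choice, intro allI)
  fix t :: real
  show "\<exists>I. 0 \<le> t \<longrightarrow> has_stoch_integral M F Q W \<Psi> t I \<and>
      (AE \<omega> in M. set_integrable lborel {0..t} (\<lambda>s. \<Phi> s \<omega>) \<and>
         V t \<omega> = V 0 \<omega> + (LINT s:{0..t}|lborel. \<Phi> s \<omega>) + I \<omega>)"
  proof (cases "0 \<le> t")
    case t: True
    \<comment> \<open>The horizon of the locale is the present t, so \<open>grid\<close>,
      \<open>y\<close> and \<open>ito_part\<close> vary with it; choice collects the resulting
      integrals into one family.\<close>
    interpret linear_sde M F Q W A \<eta> Y\<^sub>0 Y t
      by unfold_locales (use assms(1-4) t in auto)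
    let ?H = "hs_of_blinfun (\<eta> o\<^sub>L Q o\<^sub>L adj \<eta>)"
    have \<Psi>: "\<Psi> = (\<lambda>s \<omega>. vol (Y s \<omega>))" unfolding assms(7) vol_def ..
    have "AE \<omega> in M. set_integrable lborel {0..t} (\<lambda>s. \<Phi> s \<omega>) \<and>
        V t \<omega> = V 0 \<omega> + (LINT s:{0..t}|lborel. \<Phi> s \<omega>) + ito_part \<omega>"
      using drift_integrable
    proof eventually_elim
      case (elim \<omega>)
      have cong: "\<Phi> s \<omega> = drift s \<omega> + ?H" if "s \<in> {0..t}" for s
        using that by (simp add: assms(6) drift_def y_eq)
      have const: "integrable (lborel_on 0 t) (\<lambda>_. ?H)"
        by (rule finite_measure.integrable_const[OF finite_measure_lborel_on])
      have "integrable (lborel_on 0 t) (\<lambda>s. \<Phi> s \<omega>) \<longleftrightarrow> integrable (lborel_on 0 t) (\<lambda>s. drift s \<omega> + ?H)"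
        by (rule Bochner_Integration.integrable_cong) (auto simp: space_restrict_space cong)
      then have int: "integrable (lborel_on 0 t) (\<lambda>s. \<Phi> s \<omega>)" using elim const by simp
      have "(\<integral>s. \<Phi> s \<omega> \<partial>lborel_on 0 t) = (\<integral>s. drift s \<omega> + ?H \<partial>lborel_on 0 t)"
        by (rule Bochner_Integration.integral_cong) (auto simp: space_restrict_space cong)
      also have "\<dots> = (\<integral>s. drift s \<omega> \<partial>lborel_on 0 t) + t *\<^sub>R ?H"
        using elim const measure_lborel_on[OF t] by simp
      finally show ?case
        using int unfolding set_integrable_eq_lborel_on LINT_eq_lborel_on
        by (simp add: ito_part_def assms(5))
    qed
    with vol_stoch_integral show ?thesis unfolding \<Psi> by blast
  qed simp
qed

end
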